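(* Let $M\subset\mathbb R^n$ be a smooth closed submanifold of dimension $m$. (i) $B_M(z)$ can have poles only at $z=-m-2i$ with $i\in\mathbb Z$, $i\ge0$. (ii) Away from the poles of $B_M(z)$, analytic continuation and Hadamard's finite part coincide: $E_M(z)=B_M(z)$ for $z\ne -m,-m-2,-m-4,\dots$, and the same holds for $z=-k$ if $\int_M b_{M,k}(x)\,dx=0$. (iii) If $B_M(z)$ has a pole at $z=-k$, then $$E_M(-k)=\lim_{z\to-k}\left(B_M(z)-\frac{1}{z+k}R_M(-k)\right)=\lim_{z\to-k}\left(B_M(z)-\frac{k}{z+k}\int_M b_{M,k}(x)\,dx\right).$$
   Context: A closed submanifold is a compact submanifold of $\mathbb R^n$ without boundary; $dx,dy$ denote the Riemannian volume element of $M$; $\Delta_t=\{(x,y)\in\mathbb R^n\times\mathbb R^n:|x-y|\le t\}$; $B_t(x)$ is the ball of center $x$ and radius $t$ in $\mathbb R^n$. Let $\psi_{M,x}(t)=\mathrm{vol}(M\cap B_t(x))$ for $x\in M$, $t\ge0$; there is $d>0$ such that for all $x\in M$ this function is smooth on $[0,d)$ (including at $0$). Its Taylor coefficients at $0$ are $b_{M,k}(x)=\frac1{k!}\frac{d^k}{dt^k}\big|_{t=0}\psi_{M,x}(t)$. Put $\psi_M(t)=\int_M\psi_{M,x}(t)\,dx$. The integral $\int_{M\times M}|x-y|^z\,dxdy$ converges absolutely for $\mathrm{Re}\,z>-m$ and extends by analytic continuation to a meromorphic function on $\mathbb C$, denoted $B_M(z)$ (the beta function of $M$). $R_M(-k)$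 denotes the residue of $B_M$ at $z=-k$. For $z\in\mathbb C$ the regularized $z$-energy is Hadamard's finite part: choosing an integer $k\ge 0$ with $\mathrm{Re}\,z>-k-1$, $$E_M(z)=\lim_{\varepsilon\to0^+}\left[\int_{(M\times M)\setminus\Delta_\varepsilon}|x-y|^z\,dxdy+\sum_{j=1}^{k}\frac{\psi_M^{(j)}(0)}{(j-1)!}\,\frac{\varepsilon^{z+j}}{z+j}\right],$$ where $\varepsilon^{0}/0$ is replaced by $\log\varepsilon$ if it occurs. *)

theory Defs
  imports "HOL-Complex_Analysis.Complex_Analysis"
begin

(* smooth_on is the usual C-infinity notion on an open set S: continuity of all iterated
   directional derivatives. *)

primrec times_differentiable_on ::
  "nat \<Rightarrow> ('a::real_normed_vector \<Rightarrow> 'b::real_normed_vector) \<Rightarrow> 'a set \<Rightarrow> bool" where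
  "times_differentiable_on 0 f S \<longleftrightarrow> continuous_on S f"
| "times_differentiable_on (Suc k) f S \<longleftrightarrow>
     (\<forall>x\<in>S. f differentiable (at x)) \<and>
     (\<forall>v. times_differentiable_on k (\<lambda>x. frechet_derivative f (at x) v) S)"

definition smooth_on :: "('a::real_normed_vector \<Rightarrow> 'b::real_normed_vector) \<Rightarrow> 'a set \<Rightarrow> bool" where
  "smooth_on f S \<longleftrightarrow> (\<forall>k. times_differentiable_on k f S)"

(* The model space of an m-dimensional submanifold of R^n is a coordinate subspace given by a
   set K of m coordinates. This lets the dimension m be a natural number (m = 0 included). *)

definition coord_subspace :: "'n::finite set \<Rightarrow> (real^'n) set" where
  "coord_subspace K = {x. \<forall>i. i \<notin> K \<longrightarrow> x $ i = 0}"

definition coord_lborel :: "'n::finite set \<Rightarrow> (real^'n) measure" where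
  "coord_lborel K =
     distr (\<Pi>\<^sub>M i\<in>K. lborel) borel (\<lambda>f. \<chi> i. if i \<in> K then f i else 0)"

(* phi is a diffeomorphism between open subsets V and phi ` V of R^n that straightens M;
   its restriction to the slice of V is a local parametrization of M. *)

definition slice_chart ::
  "nat \<Rightarrow> (real^'n) set \<Rightarrow> 'n::finite set \<Rightarrow> (real^'n) set \<Rightarrow> (real^'n \<Rightarrow> real^'n) \<Rightarrow> bool" where
  "slice_chart m M K V \<phi> \<longleftrightarrow>
     card K = m \<and> open V \<and> open (\<phi> ` V) \<and> inj_on \<phi> V \<and>
     smooth_on \<phi> V \<and> smooth_on (inv_into V \<phi>) (\<phi> ` V) \<and>
     \<phi> ` (V \<inter> coord_subspace K) = \<phi> ` V \<inter> M"

definition closed_submanifold :: "nat \<Rightarrow> (real^'n::finite) set \<Rightarrow> bool" where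
  "closed_submanifold m M \<longleftrightarrow>
     compact M \<and> (\<forall>p\<in>M. \<exists>K V \<phi>. slice_chart m M K V \<phi> \<and> p \<in> \<phi> ` V)"

(* Determinant of the first fundamental form of the parametrization restricted to
   coord_subspace K: the K-by-K Gram block is completed by an identity block, which leaves
   the determinant unchanged. *)

definition gram_det :: "'n::finite set \<Rightarrow> (real^'n \<Rightarrow> real^'n) \<Rightarrow> real^'n \<Rightarrow> real" where
  "gram_det K \<phi> x =
     det (\<chi> i j. if i \<in> K \<and> j \<in> K
                 then frechet_derivative \<phi> (at x) (axis i 1) \<bullet> frechet_derivative \<phi> (at x) (axis j 1)
                 else if i = j then 1 else 0)"

(* The Riemannian volume element sqrt(det g) du in every chart; it is a measure on M itself. *)

definition is_riemannian_volume :: "nat \<Rightarrow> (real^'n::finite) set \<Rightarrow> (real^'n) measure \<Rightarrow> bool" where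
  "is_riemannian_volume m M \<mu> \<longleftrightarrow>
     sets \<mu> = sets (restrict_space borel M) \<and>
     (\<forall>K V \<phi> A. slice_chart m M K V \<phi> \<longrightarrow> A \<in> sets borel \<longrightarrow> A \<subseteq> V \<inter> coord_subspace K \<longrightarrow>
        emeasure \<mu> (\<phi> ` A) = (\<integral>\<^sup>+x\<in>A. ennreal (sqrt (gram_det K \<phi> x)) \<partial>coord_lborel K))"

definition riemannian_volume :: "nat \<Rightarrow> (real^'n::finite) set \<Rightarrow> (real^'n) measure" where
  "riemannian_volume m M = (THE \<mu>. is_riemannian_volume m M \<mu>)"

(* Iterated derivatives on [0,\<infinity>), one-sided at 0. *)

definition halfline_deriv :: "nat \<Rightarrow> (real \<Rightarrow> real) \<Rightarrow> real \<Rightarrow> real" where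
  "halfline_deriv k f = ((\<lambda>g t. vector_derivative g (at t within {0..})) ^^ k) f"

definition psi_at :: "nat \<Rightarrow> (real^'n::finite) set \<Rightarrow> real^'n \<Rightarrow> real \<Rightarrow> real" where
  "psi_at m M x t = measure (riemannian_volume m M) (M \<inter> cball x t)"

definition psi :: "nat \<Rightarrow> (real^'n::finite) set \<Rightarrow> real \<Rightarrow> real" where
  "psi m M t = (LINT x|riemannian_volume m M. psi_at m M x t)"

definition taylor_b :: "nat \<Rightarrow> (real^'n::finite) set \<Rightarrow> nat \<Rightarrow> real^'n \<Rightarrow> real" where
  "taylor_b m M k x = 1 / fact k * halfline_deriv k (psi_at m M x) 0"

(* On the diagonal the integrand takes the value 0 powr z = 0; this only matters for m = 0. *)

definition riesz_integral_on ::
  "nat \<Rightarrow> (real^'n::finite) set \<Rightarrow> ((real^'n) \<times> (real^'n)) set \<Rightarrow> complex \<Rightarrow> complex" where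
  "riesz_integral_on m M S z =
     (LINT p:S|riemannian_volume m M \<Otimes>\<^sub>M riemannian_volume m M.
        complex_of_real (norm (fst p - snd p)) powr z)"

(* A nicely meromorphic function has its removable singularities filled in (and the dummy
   value 0 at poles), so the analytic continuation is unique as a HOL function. *)

definition beta_function :: "nat \<Rightarrow> (real^'n::finite) set \<Rightarrow> complex \<Rightarrow> complex" where
  "beta_function m M =
     (THE B. B nicely_meromorphic_on UNIV \<and>
             (\<forall>z. Re z > - real m \<longrightarrow> B z = riesz_integral_on m M (M \<times> M) z))"

definition diagonal_nbhd :: "real \<Rightarrow> ((real^'n::finite) \<times> (real^'n)) set" where
  "diagonal_nbhd t = {(x, y). norm (x - y) \<le> t}"

definition counterterm :: "complex \<Rightarrow> nat \<Rightarrow> real \<Rightarrow> complex" where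
  "counterterm z j \<epsilon> =
     (if z + of_nat j = 0 then of_real (ln \<epsilon>)
      else of_real \<epsilon> powr (z + of_nat j) / (z + of_nat j))"

(* "The limit defining E_M(z) exists and equals E". The order k of the expansion may be any
   admissible one: further terms tend to 0, so the limit does not depend on it. *)

definition has_regularized_energy ::
  "nat \<Rightarrow> (real^'n::finite) set \<Rightarrow> complex \<Rightarrow> complex \<Rightarrow> bool" where
  "has_regularized_energy m M z E \<longleftrightarrow>
     (\<forall>k::nat. Re z > - real k - 1 \<longrightarrow>
        ((\<lambda>\<epsilon>. riesz_integral_on m M (M \<times> M - diagonal_nbhd \<epsilon>) z +
               (\<Sum>j=1..k. of_real (halfline_deriv j (psi m M) 0 / fact (j - 1)) * counterterm z j \<epsilon>))
          \<longlongrightarrow> E) (at_right 0))"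

definition regularized_energy :: "nat \<Rightarrow> (real^'n::finite) set \<Rightarrow> complex \<Rightarrow> complex" where
  "regularized_energy m M z = (THE E. has_regularized_energy m M z E)"

end

theory Submission
  imports Defs
begin

text \<open>
  Fix a base point \<open>x = \<phi> a\<close> of the manifold in a slice chart. The rescaled chart
  \<open>f a t u = (\<phi> (a + t u) - \<phi> a) / t\<close> extends smoothly to \<open>t = 0\<close>, and
  \<open>vol (M \<inter> B_t x) = t^m G t\<close>, where \<open>G t\<close> is the integral of the volume density over
  \<open>{u. |f a t u| \<le> 1}\<close>. A smooth field \<open>X\<close> carrying these sublevel sets along in \<open>t\<close> shows that
  the derivative of \<open>G\<close> is again an integral of a smooth function over the same sets (Reynolds'
  transport theorem), so all derivatives of \<open>G\<close> exist on a symmetric interval around \<open>0\<close>, with bounds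
  that are locally uniform in \<open>a\<close>. Since \<open>f a (-t) (-u) = - f a t u\<close>, the function \<open>G\<close> is even, and
  only the Taylor coefficients of order \<open>m + 2 i\<close> survive.

  The image of \<open>\<mu> \<otimes> \<mu>\<close> under the distance has \<open>\<psi>_M\<close> as its distribution function, hence a smooth
  density \<open>\<psi>_M'\<close> near \<open>0\<close>. Subtracting a Taylor polynomial of \<open>\<psi>_M'\<close> from \<open>\<integral> r^z \<psi>_M' dr\<close> leaves an
  integral holomorphic in a larger half-plane; the polynomial contributes the possible simple poles
  \<open>\<delta>^(z+j) / (z+j)\<close> to the continuation, and to the finite part the same terms, with \<open>ln \<delta>\<close> in place
  of the polar term when \<open>z = -j\<close>.
\<close>

section \<open>Calculus of smooth functions\<close>

text \<open>Integrating over sublevel sets in polar coordinates would need spheres and an implicit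
  radius function. Transport by a vector field keeps every integral on one fixed ball and treats
  \<open>t < 0\<close>, \<open>t = 0\<close> and \<open>t > 0\<close> alike, and only two-sided
  smoothness at 0 lets evenness remove every second coefficient. The field comes from a linear
  system that is the Gram system when \<open>t u = 0\<close>, hence still solvable when
  \<open>t u\<close> is small. \<open>riemannian_volume\<close> is a definite description, so
  nothing is known about it before existence and uniqueness; that is what the change of variables
  between charts is for. Two charts may use different coordinate sets \<open>K\<close> of the same
  size. As \<psi>_M integrates local expansions over the base point, radii and derivative bounds
  must be uniform, first near a point and then on \<open>M\<close> by compactness. Continuation and
  finite part share one remainder; near \<open>z = -k\<close> they differ by
  \<open>\<delta> powr w / w\<close> against \<open>ln \<delta>\<close>, with
  \<open>w = z + k\<close>, and \<open>(\<delta> powr w - 1) / w\<close> tends to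
  \<open>ln \<delta>\<close>. An atom of the distance distribution at 0 can occur only for
  \<open>m = 0\<close>; the convention \<open>0 powr z = 0\<close> ignores it.\<close>

lemma times_differentiable_onD:
  assumes "times_differentiable_on (Suc k) f S" "x \<in> S"
  shows "(f has_derivative frechet_derivative f (at x)) (at x)"
  using assms by (simp add: frechet_derivative_works)

lemma times_differentiable_on_cong:
  assumes "open S" "\<And>x. x \<in> S \<Longrightarrow> f x = g x" "times_differentiable_on k f S"
  shows "times_differentiable_on k g S"
  using assms
proof (induction k arbitrary: f g)
  case 0
  then show ?case using continuous_on_cong[of S S f g] by simp
next
  case (Suc k)
  have D: "(g has_derivative frechet_derivative f (at x)) (at x)" if "x \<in> S" for x
    using has_derivative_transform_within_open[OF times_differentiable_onD[OF Suc.prems(3) that] Suc.prems(1) that]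
      Suc.prems(2) by blast
  have eq: "frechet_derivative g (at x) = frechet_derivative f (at x)" if "x \<in> S" for x
    by (rule frechet_derivative_at[OF D[OF that], symmetric])
  have "times_differentiable_on k (\<lambda>x. frechet_derivative g (at x) v) S" for v
  proof (rule Suc.IH[OF Suc.prems(1)])
    show "times_differentiable_on k (\<lambda>x. frechet_derivative f (at x) v) S" using Suc.prems(3) by simp
  qed (simp only: eq)
  moreover have "\<forall>x\<in>S. g differentiable (at x)" using D differentiableI by blast
  ultimately show ?case by simp
qed

text \<open>By uniqueness of derivatives any explicit formula \<open>f'\<close> may replace
  \<open>frechet_derivative\<close>. The closure properties below feed the sum, product and chain
  rules into this criterion.\<close>

lemma times_differentiable_on_SucI:
  assumes "open S" and D: "\<And>x. x \<in> S \<Longrightarrow> (f has_derivative f' x) (at x)"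
    and "\<And>v. times_differentiable_on k (\<lambda>x. f' x v) S"
  shows "times_differentiable_on (Suc k) f S"
proof -
  have eq: "frechet_derivative f (at x) = f' x" if "x \<in> S" for x
    by (rule frechet_derivative_at[OF D[OF that], symmetric])
  have "times_differentiable_on k (\<lambda>x. frechet_derivative f (at x) v) S" for v
    by (rule times_differentiable_on_cong[OF assms(1) _ assms(3)]) (simp only: eq)
  moreover have "\<forall>x\<in>S. f differentiable (at x)" using D differentiableI by blast
  ultimately show ?thesis by simp
qed

lemma times_differentiable_on_SucD: "times_differentiable_on (Suc k) f S \<Longrightarrow> times_differentiable_on k f S"
proof (induction k arbitrary: f)
  case 0
  then show ?case
    by (simp add: continuous_on_eq_continuous_within)
      (meson differentiable_at_withinI differentiable_imp_continuous_within)
next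
  case (Suc k)
  then show ?case by auto
qed

lemma times_differentiable_on_imp_continuous_on: "times_differentiable_on k f S \<Longrightarrow> continuous_on S f"
proof (induction k)
  case (Suc k)
  then show ?case using times_differentiable_on_SucD by blast
qed simp

lemma times_differentiable_on_subset: "times_differentiable_on k f S \<Longrightarrow> T \<subseteq> S \<Longrightarrow> times_differentiable_on k f T"
  by (induction k arbitrary: f) (auto intro: continuous_on_subset)

lemma times_differentiable_on_const: "open S \<Longrightarrow> times_differentiable_on k (\<lambda>_. c) S"
proof (induction k arbitrary: c)
  case (Suc k)
  then show ?case by (intro times_differentiable_on_SucI[of _ _ "\<lambda>_ _. 0"]) auto
qed auto

lemma times_differentiable_on_linear:
  assumes "open S" "bounded_linear h" shows "times_differentiable_on k h S"
proof (cases k)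
  case 0
  then show ?thesis using assms by (simp add: linear_continuous_on)
next
  case (Suc l)
  then show ?thesis using assms
    by (auto intro!: times_differentiable_on_SucI[of _ _ "\<lambda>_. h"] times_differentiable_on_const
          bounded_linear_imp_has_derivative simp del: times_differentiable_on.simps)
qed

lemma times_differentiable_on_linear_compose:
  assumes "open S" "bounded_linear h" "times_differentiable_on k f S" shows "times_differentiable_on k (\<lambda>x. h (f x)) S"
  using assms(3)
proof (induction k arbitrary: f)
  case 0
  then show ?case using bounded_linear.continuous_on[OF assms(2)] by simp
next
  case (Suc k)
  show ?case
  proof (rule times_differentiable_on_SucI[OF assms(1)])
    fix x assume "x \<in> S"
    then show "((\<lambda>x. h (f x)) has_derivative (\<lambda>v. h (frechet_derivative f (at x) v))) (at x)"
      using bounded_linear.has_derivative[OF assms(2) times_differentiable_onD[OF Suc.prems]] by auto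
  qed (use Suc in auto)
qed

lemma times_differentiable_on_add:
  assumes "open S" "times_differentiable_on k f S" "times_differentiable_on k g S" shows "times_differentiable_on k (\<lambda>x. f x + g x) S"
  using assms(2,3)
proof (induction k arbitrary: f g)
  case (Suc k)
  show ?case
  proof (rule times_differentiable_on_SucI[OF assms(1)])
    fix x assume "x \<in> S"
    then show "((\<lambda>x. f x + g x) has_derivative
        (\<lambda>v. frechet_derivative f (at x) v + frechet_derivative g (at x) v)) (at x)"
      by (intro has_derivative_add times_differentiable_onD[OF Suc.prems(1)]
          times_differentiable_onD[OF Suc.prems(2)])
  qed (use Suc in auto)
qed (auto intro: continuous_intros)

lemma times_differentiable_on_bilinear:
  assumes "open S" "bounded_bilinear h" "times_differentiable_on k f S" "times_differentiable_on k g S"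
  shows "times_differentiable_on k (\<lambda>x. h (f x) (g x)) S"
  using assms(3,4)
proof (induction k arbitrary: f g)
  case (Suc k)
  show ?case
  proof (rule times_differentiable_on_SucI[OF assms(1)])
    fix x assume "x \<in> S"
    then show "((\<lambda>x. h (f x) (g x)) has_derivative
        (\<lambda>v. h (f x) (frechet_derivative g (at x) v) + h (frechet_derivative f (at x) v) (g x))) (at x)"
      by (intro bounded_bilinear.FDERIV[OF assms(2)] times_differentiable_onD[OF Suc.prems(1)]
          times_differentiable_onD[OF Suc.prems(2)])
  next
    fix v
    show "times_differentiable_on k (\<lambda>x. h (f x) (frechet_derivative g (at x) v) + h (frechet_derivative f (at x) v) (g x)) S"
      using Suc.prems times_differentiable_on_SucD[OF Suc.prems(1)] times_differentiable_on_SucD[OF Suc.prems(2)]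
      by (intro times_differentiable_on_add assms(1) Suc.IH) auto
  qed
qed (auto intro: bounded_bilinear.continuous_on[OF assms(2)])

lemma times_differentiable_on_sum:
  assumes "open S" "\<And>i. i \<in> I \<Longrightarrow> times_differentiable_on k (f i) S"
  shows "times_differentiable_on k (\<lambda>x. \<Sum>i\<in>I. f i x) S"
  using assms(2)
  by (induction I rule: infinite_finite_induct)
     (auto intro: times_differentiable_on_const times_differentiable_on_add assms(1))

lemma linear_basis_expansion:
  fixes h :: "'a::euclidean_space \<Rightarrow> 'b::real_normed_vector"
  assumes "bounded_linear h"
  shows "h v = (\<Sum>b\<in>Basis. (v \<bullet> b) *\<^sub>R h b)"
proof -
  have "h v = h (\<Sum>b\<in>Basis. (v \<bullet> b) *\<^sub>R b)" by (simp add: euclidean_representation)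
  then show ?thesis
    using assms by (simp add: bounded_linear.linear linear_sum linear_cmul)
qed

text \<open>The chain rule applies the derivative of \<open>f\<close> to a direction that varies
  with \<open>x\<close>, whereas the induction hypothesis covers fixed directions only. Expanding
  the direction in \<open>Basis\<close> gives a sum of products of functions of order
  \<open>k\<close>; hence the Euclidean type in the middle.\<close>

lemma times_differentiable_on_compose:
  fixes f :: "'a::euclidean_space \<Rightarrow> 'b::real_normed_vector"
  assumes "open S" "open T" "g ` S \<subseteq> T" "times_differentiable_on k f T" "times_differentiable_on k g S"
  shows "times_differentiable_on k (\<lambda>x. f (g x)) S"
  using assms(4,5)
proof (induction k arbitrary: f)
  case 0
  then show ?case using assms(3) by (auto intro: continuous_on_compose2)
next
  case (Suc k)
  show ?case
  proof (rule times_differentiable_on_SucI[OF assms(1)])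
    fix x assume x: "x \<in> S"
    have Df: "(f has_derivative frechet_derivative f (at (g x))) (at (g x))"
      using times_differentiable_onD[OF Suc.prems(1)] assms(3) x by blast
    have "((\<lambda>x. f (g x)) has_derivative
        (\<lambda>v. frechet_derivative f (at (g x)) (frechet_derivative g (at x) v))) (at x)"
      using has_derivative_compose[OF times_differentiable_onD[OF Suc.prems(2) x] Df] .
    then show "((\<lambda>x. f (g x)) has_derivative
        (\<lambda>v. \<Sum>b\<in>Basis. (frechet_derivative g (at x) v \<bullet> b) *\<^sub>R frechet_derivative f (at (g x)) b)) (at x)"
      by (rule has_derivative_eq_rhs)
        (rule ext, rule linear_basis_expansion[OF has_derivative_bounded_linear[OF Df]])
  next
    fix v
    have "times_differentiable_on k (\<lambda>x. frechet_derivative f (at (g x)) b) S" for b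
      using Suc.prems times_differentiable_on_SucD[OF Suc.prems(2)] by (intro Suc.IH) auto
    moreover have "times_differentiable_on k (\<lambda>x. frechet_derivative g (at x) v \<bullet> b) S" for b
      using Suc.prems
      by (intro times_differentiable_on_linear_compose[of S "\<lambda>y. y \<bullet> b"] assms(1)) (auto intro: bounded_linear_inner_left)
    ultimately show "times_differentiable_on k (\<lambda>x. \<Sum>b\<in>Basis. (frechet_derivative g (at x) v \<bullet> b) *\<^sub>R frechet_derivative f (at (g x)) b) S"
      by (intro times_differentiable_on_sum assms(1)
            times_differentiable_on_bilinear[OF _ bounded_bilinear_scaleR])
  qed
qed

text \<open>Bootstrapping: the derivative of \<open>1 / f\<close> is a polynomial in
  \<open>1 / f\<close> and the derivative of \<open>f\<close>, so order \<open>k\<close> of the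
  reciprocal yields order \<open>Suc k\<close>. The square root below works the same way.\<close>

lemma times_differentiable_on_inverse:
  fixes f :: "'a::real_normed_vector \<Rightarrow> real"
  assumes "open S" "\<And>x. x \<in> S \<Longrightarrow> f x \<noteq> 0" "times_differentiable_on k f S"
  shows "times_differentiable_on k (\<lambda>x. inverse (f x)) S"
  using assms(3)
proof (induction k)
  case 0
  then show ?case using assms(2) by (auto intro: continuous_intros)
next
  case (Suc k)
  have inv: "times_differentiable_on k (\<lambda>x. inverse (f x)) S"
    by (rule Suc.IH[OF times_differentiable_on_SucD[OF Suc.prems]])
  show ?case
  proof (rule times_differentiable_on_SucI[OF assms(1)])
    fix x assume "x \<in> S"
    then show "((\<lambda>x. inverse (f x)) has_derivative
        (\<lambda>v. - 1 * (inverse (f x) * (frechet_derivative f (at x) v * inverse (f x))))) (at x)"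
      using Deriv.has_derivative_inverse[OF assms(2) times_differentiable_onD[OF Suc.prems]]
      by (simp add: mult.assoc)
  next
    fix v
    show "times_differentiable_on k (\<lambda>x. - 1 * (inverse (f x) * (frechet_derivative f (at x) v * inverse (f x)))) S"
      using Suc.prems
      by (intro times_differentiable_on_bilinear[OF assms(1) bounded_bilinear_mult]
         times_differentiable_on_const assms(1) inv) auto
  qed
qed

lemma times_differentiable_on_sqrt:
  fixes f :: "'a::real_normed_vector \<Rightarrow> real"
  assumes "open S" "\<And>x. x \<in> S \<Longrightarrow> f x > 0" "times_differentiable_on k f S"
  shows "times_differentiable_on k (\<lambda>x. sqrt (f x)) S"
  using assms(3)
proof (induction k)
  case 0
  then show ?case by (auto intro: continuous_intros)
next
  case (Suc k)
  have inv: "times_differentiable_on k (\<lambda>x. inverse (sqrt (f x))) S"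
    using Suc.IH[OF times_differentiable_on_SucD[OF Suc.prems]] assms(2)
    by (intro times_differentiable_on_inverse assms(1)) (auto simp: less_le)
  show ?case
  proof (rule times_differentiable_on_SucI[OF assms(1)])
    fix x assume x: "x \<in> S"
    show "((\<lambda>x. sqrt (f x)) has_derivative
        (\<lambda>v. frechet_derivative f (at x) v * (inverse (sqrt (f x)) * (1/2)))) (at x)"
      using has_derivative_real_sqrt[OF assms(2)[OF x] times_differentiable_onD[OF Suc.prems x]]
      by (simp add: field_simps)
  next
    fix v
    show "times_differentiable_on k (\<lambda>x. frechet_derivative f (at x) v * (inverse (sqrt (f x)) * (1/2))) S"
      using Suc.prems
      by (intro times_differentiable_on_bilinear[OF assms(1) bounded_bilinear_mult]
         times_differentiable_on_const assms(1) inv) auto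
  qed
qed

text \<open>The parameter \<open>s\<close> is allowed to run over an open \<open>T\<close> around
  \<open>{0..1}\<close>, so that the hypothesis concerns an open product and is inherited by the
  derivatives in \<open>x\<close>.\<close>

lemma times_differentiable_on_integral:
  fixes f :: "real \<Rightarrow> 'a::euclidean_space \<Rightarrow> 'b::euclidean_space"
  assumes "open S" "open T" "{0..1} \<subseteq> T" "times_differentiable_on k (\<lambda>p. f (fst p) (snd p)) (T \<times> S)"
  shows "times_differentiable_on k (\<lambda>x. integral {0..1} (\<lambda>s. f s x)) S"
  using assms(4)
proof (induction k arbitrary: f)
  case 0
  have sub: "prod.swap ` (S \<times> cbox 0 1) \<subseteq> T \<times> S" using assms(3) by auto
  have "continuous_on (S \<times> cbox 0 1) (\<lambda>q. (\<lambda>p. f (fst p) (snd p)) (prod.swap q))"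
    by (rule continuous_on_compose2[OF _ continuous_on_swap sub]) (use 0 in simp)
  then have "continuous_on (S \<times> cbox 0 1) (\<lambda>(x, s). f s x)"
    by (simp add: split_beta')
  from integral_continuous_on_param[OF this] show ?case by simp
next
  case (Suc k)
  define F where "F = (\<lambda>p. f (fst p) (snd p))"
  define D where "D = (\<lambda>s x v. frechet_derivative F (at (s, x)) (0, v))"
  have F: "times_differentiable_on (Suc k) F (T \<times> S)" using Suc.prems by (simp only: F_def)
  have D: "((\<lambda>x. f s x) has_derivative D s x) (at x)" if "s \<in> T" "x \<in> S" for s x
  proof -
    have "((\<lambda>x. F (s, x)) has_derivative (\<lambda>v. frechet_derivative F (at (s, x)) (0, v))) (at x)"
      using that
      by (intro has_derivative_compose[of "\<lambda>x. (s, x)" "\<lambda>v. (0, v)" x UNIV F] times_differentiable_onD[OF F])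
         (use that in \<open>auto intro!: has_derivative_Pair has_derivative_const has_derivative_ident\<close>)
    then show ?thesis by (simp only: F_def D_def fst_conv snd_conv)
  qed
  have blD: "bounded_linear (D s x)" if "s \<in> T" "x \<in> S" for s x
    using has_derivative_bounded_linear[OF D[OF that]] .
  have tdD: "times_differentiable_on k (\<lambda>p. D (fst p) (snd p) v) (T \<times> S)" for v
  proof -
    have "times_differentiable_on k (\<lambda>p. frechet_derivative F (at p) (0, v)) (T \<times> S)" using F by simp
    then show ?thesis by (simp add: D_def)
  qed
  have cD: "continuous_on (T \<times> S) (\<lambda>p. D (fst p) (snd p) v)" for v
    by (rule times_differentiable_on_imp_continuous_on[OF tdD])
  have cD': "continuous_on (A \<times> cbox 0 1) (\<lambda>p. D (snd p) (fst p) v)" if "A \<subseteq> S" for v A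
  proof -
    have sub: "prod.swap ` (A \<times> cbox 0 1) \<subseteq> T \<times> S" using assms(3) that by auto
    have "continuous_on (A \<times> cbox 0 1) (\<lambda>q. (\<lambda>p. D (fst p) (snd p) v) (prod.swap q))"
      by (rule continuous_on_compose2[OF cD continuous_on_swap sub])
    then show ?thesis by (simp only: fst_swap snd_swap)
  qed
  show ?case
  proof (rule times_differentiable_on_SucI[OF assms(1)])
    fix x0 assume x0: "x0 \<in> S"
    obtain e where e: "e > 0" "ball x0 e \<subseteq> S" using assms(1) x0 by (meson open_contains_ball)
    define U where "U = ball x0 e"
    have U: "U \<subseteq> S" "x0 \<in> U" "convex U" "open U" using e by (auto simp: U_def)
    \<comment> \<open>\<open>leibniz_rule\<close> wants the derivative as a continuous family of
      bounded linear maps; in finite dimension its continuity can be tested on basis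
      vectors.\<close>
    define fx where "fx = (\<lambda>x s. Blinfun (D s x))"
    have fx: "blinfun_apply (fx x s) = D s x" if "x \<in> U" "s \<in> cbox 0 1" for x s
      unfolding fx_def using that U assms(3) by (intro bounded_linear_Blinfun_apply blD) auto
    have cfx: "continuous_on (U \<times> cbox 0 1) (\<lambda>(x, s). fx x s)"
    proof (rule continuous_on_blinfun_componentwise)
      fix i :: 'a
      show "continuous_on (U \<times> cbox 0 1) (\<lambda>p. blinfun_apply (case p of (x, s) \<Rightarrow> fx x s) i)"
        by (rule continuous_on_cong[THEN iffD1, OF _ _ cD'[OF U(1), of i]]) (auto simp: fx)
    qed
    have "((\<lambda>x. integral (cbox 0 1) (\<lambda>s. f s x)) has_derivative blinfun_apply (integral (cbox 0 1) (fx x0))) (at x0 within U)"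
    proof (rule leibniz_rule[OF _ _ cfx U(2,3)])
      fix x s assume *: "x \<in> U" "s \<in> cbox 0 (1::real)"
      then have "((\<lambda>x. f s x) has_derivative D s x) (at x)" using U assms(3) by (intro D) auto
      then show "((\<lambda>x. f s x) has_derivative blinfun_apply (fx x s)) (at x within U)"
        using * by (simp add: fx has_derivative_at_withinI)
    next
      fix x assume x: "x \<in> U"
      have "continuous_on (T \<times> S) F"
        by (rule times_differentiable_on_imp_continuous_on[OF F])
      then have "continuous_on (cbox 0 1) (\<lambda>s. F (s, x))"
        by (rule continuous_on_compose2) (use x U assms(3) in \<open>auto intro!: continuous_intros\<close>)
      then show "(\<lambda>s. f s x) integrable_on cbox 0 1"
        by (intro integrable_continuous) (simp only: F_def fst_conv snd_conv)
    qed
    note der = this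
    have integrable_blinfun: "fx x0 integrable_on cbox 0 1"
    proof (rule integrable_continuous)
      have "continuous_on (cbox 0 1) (\<lambda>s. (\<lambda>(x, s). fx x s) (x0, s))"
        by (rule continuous_on_compose2[OF cfx]) (use U in \<open>auto intro!: continuous_intros\<close>)
      then show "continuous_on (cbox 0 1) (fx x0)" by (simp only: split_conv)
    qed
    have "blinfun_apply (integral (cbox 0 1) (fx x0)) v = integral {0..1} (\<lambda>s. D s x0 v)" for v
    proof -
      have "blinfun_apply (integral (cbox 0 1) (fx x0)) v = integral (cbox 0 1) ((\<lambda>F. blinfun_apply F v) \<circ> fx x0)"
        by (rule integral_linear[OF integrable_blinfun blinfun.bounded_linear_left, symmetric])
      also have "\<dots> = integral (cbox 0 1) (\<lambda>s. D s x0 v)"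
        using U by (intro integral_cong) (auto simp: fx)
      finally show ?thesis by simp
    qed
    then have "((\<lambda>x. integral (cbox 0 1) (\<lambda>s. f s x)) has_derivative (\<lambda>v. integral {0..1} (\<lambda>s. D s x0 v))) (at x0 within U)"
      by (intro has_derivative_eq_rhs[OF der] ext)
    then show "((\<lambda>x. integral {0..1} (\<lambda>s. f s x)) has_derivative (\<lambda>v. integral {0..1} (\<lambda>s. D s x0 v))) (at x0)"
      using at_within_open[OF U(2) U(4)] by (simp only: box_real)
  next
    fix v
    show "times_differentiable_on k (\<lambda>x. integral {0..1} (\<lambda>s. D s x v)) S"
      by (rule Suc.IH[of "\<lambda>s x. D s x v"]) (use tdD[of v] in simp)
  qed
qed


section \<open>Closure properties of smooth functions\<close>

lemma smooth_onI: "(\<And>k. times_differentiable_on k f S) \<Longrightarrow> smooth_on f S" by (simp add: smooth_on_def)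
lemma smooth_onD: "smooth_on f S \<Longrightarrow> times_differentiable_on k f S" by (simp add: smooth_on_def)

lemma smooth_on_imp_continuous_on: "smooth_on f S \<Longrightarrow> continuous_on S f"
  using smooth_onD[of f S 0] by simp

lemma smooth_on_has_derivative:
  "smooth_on f S \<Longrightarrow> x \<in> S \<Longrightarrow> (f has_derivative frechet_derivative f (at x)) (at x)"
  by (rule times_differentiable_onD[OF smooth_onD[of f S "Suc 0"]])

lemma smooth_on_frechet_derivative:
  "smooth_on f S \<Longrightarrow> smooth_on (\<lambda>x. frechet_derivative f (at x) v) S"
  using smooth_onD[of f S "Suc _"] by (intro smooth_onI) simp

lemma smooth_on_subset: "smooth_on f S \<Longrightarrow> T \<subseteq> S \<Longrightarrow> smooth_on f T"
  by (intro smooth_onI) (rule times_differentiable_on_subset[OF smooth_onD])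

lemma smooth_on_const: "open S \<Longrightarrow> smooth_on (\<lambda>_. c) S"
  by (intro smooth_onI times_differentiable_on_const)

lemma smooth_on_linear: "open S \<Longrightarrow> bounded_linear h \<Longrightarrow> smooth_on h S"
  by (intro smooth_onI times_differentiable_on_linear)

lemma smooth_on_linear_compose:
  "open S \<Longrightarrow> bounded_linear h \<Longrightarrow> smooth_on f S \<Longrightarrow> smooth_on (\<lambda>x. h (f x)) S"
  by (rule smooth_onI) (rule times_differentiable_on_linear_compose[OF _ _ smooth_onD])

lemma smooth_on_add:
  "open S \<Longrightarrow> smooth_on f S \<Longrightarrow> smooth_on g S \<Longrightarrow> smooth_on (\<lambda>x. f x + g x) S"
  by (rule smooth_onI) (rule times_differentiable_on_add[OF _ smooth_onD smooth_onD])

lemma smooth_on_bilinear: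
  "open S \<Longrightarrow> bounded_bilinear h \<Longrightarrow> smooth_on f S \<Longrightarrow> smooth_on g S \<Longrightarrow> smooth_on (\<lambda>x. h (f x) (g x)) S"
  by (rule smooth_onI) (rule times_differentiable_on_bilinear[OF _ _ smooth_onD smooth_onD])

lemmas smooth_on_mult =
  smooth_on_bilinear[OF _ bounded_bilinear_mult[where 'a=real]]
lemmas smooth_on_scaleR = smooth_on_bilinear[OF _ bounded_bilinear_scaleR]
lemmas smooth_on_inner = smooth_on_bilinear[OF _ bounded_bilinear_inner]

lemma smooth_on_minus: "open S \<Longrightarrow> smooth_on f S \<Longrightarrow> smooth_on (\<lambda>x. - f x) S"
  by (rule smooth_on_linear_compose[of S uminus]) (auto intro: bounded_linear_minus bounded_linear_ident)

lemma smooth_on_Pair: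
  assumes "open S" "smooth_on f S" "smooth_on g S" shows "smooth_on (\<lambda>x. (f x, g x)) S"
proof -
  have "smooth_on (\<lambda>x. (f x, 0) + (0, g x)) S"
    using assms
    by (intro smooth_on_add smooth_on_linear_compose[of S "\<lambda>y. (y, 0)" f]
        smooth_on_linear_compose[of S "\<lambda>y. (0, y)" g])
       (auto intro!: bounded_linear_Pair bounded_linear_ident bounded_linear_zero)
  then show ?thesis by simp
qed

lemma smooth_on_sum:
  "open S \<Longrightarrow> (\<And>i. i \<in> I \<Longrightarrow> smooth_on (f i) S) \<Longrightarrow> smooth_on (\<lambda>x. \<Sum>i\<in>I. f i x) S"
  by (intro smooth_onI times_differentiable_on_sum) (auto intro: smooth_onD)

lemma smooth_on_prod:
  fixes f :: "'i \<Rightarrow> 'a::real_normed_vector \<Rightarrow> real"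
  assumes "open S" "\<And>i. i \<in> I \<Longrightarrow> smooth_on (f i) S"
  shows "smooth_on (\<lambda>x. \<Prod>i\<in>I. f i x) S"
  using assms(2)
  by (induction I rule: infinite_finite_induct)
     (auto intro: smooth_on_const smooth_on_mult assms(1))

lemma smooth_on_compose:
  fixes f :: "'a::euclidean_space \<Rightarrow> 'b::real_normed_vector"
  shows "open S \<Longrightarrow> open T \<Longrightarrow> g ` S \<subseteq> T \<Longrightarrow> smooth_on f T \<Longrightarrow> smooth_on g S \<Longrightarrow> smooth_on (\<lambda>x. f (g x)) S"
  by (intro smooth_onI) (rule times_differentiable_on_compose[OF _ _ _ smooth_onD smooth_onD])

lemma smooth_on_inverse:
  fixes f :: "'a::real_normed_vector \<Rightarrow> real"
  shows "open S \<Longrightarrow> (\<And>x. x \<in> S \<Longrightarrow> f x \<noteq> 0) \<Longrightarrow> smooth_on f S \<Longrightarrow> smooth_on (\<lambda>x. inverse (f x)) S"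
  by (intro smooth_onI) (rule times_differentiable_on_inverse[OF _ _ smooth_onD])

lemma smooth_on_sqrt:
  fixes f :: "'a::real_normed_vector \<Rightarrow> real"
  shows "open S \<Longrightarrow> (\<And>x. x \<in> S \<Longrightarrow> f x > 0) \<Longrightarrow> smooth_on f S \<Longrightarrow> smooth_on (\<lambda>x. sqrt (f x)) S"
  by (intro smooth_onI) (rule times_differentiable_on_sqrt[OF _ _ smooth_onD])

lemma smooth_on_integral:
  fixes f :: "real \<Rightarrow> 'a::euclidean_space \<Rightarrow> 'b::euclidean_space"
  shows "open S \<Longrightarrow> open T \<Longrightarrow> {0..1} \<subseteq> T \<Longrightarrow> smooth_on (\<lambda>p. f (fst p) (snd p)) (T \<times> S) \<Longrightarrow>
    smooth_on (\<lambda>x. integral {0..1} (\<lambda>s. f s x)) S"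
  by (intro smooth_onI) (rule times_differentiable_on_integral[OF _ _ _ smooth_onD])

lemma smooth_on_det:
  fixes A :: "'a::real_normed_vector \<Rightarrow> real^'n^'n"
  assumes "open S" "\<And>i j. smooth_on (\<lambda>x. A x $ i $ j) S"
  shows "smooth_on (\<lambda>x. det (A x)) S"
  unfolding det_def
  by (intro smooth_on_sum smooth_on_mult smooth_on_prod smooth_on_const assms)

section \<open>Integration over coordinate subspaces\<close>

text \<open>On a convex set the mean value inequality bounds all difference quotients by
  \<open>w\<close>, and dominated convergence does the rest. The scalar field is left open because
  the lemma serves real radii as well as complex exponents, and \<open>within S\<close> includes
  one-sided derivatives at an endpoint.\<close>

lemma has_field_derivative_integral:
  fixes f :: "'k::{real_normed_field,banach,second_countable_topology} \<Rightarrow> 'a \<Rightarrow> 'k"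
  assumes "convex S" "t \<in> S"
    and int: "\<And>s. s \<in> S \<Longrightarrow> integrable N (f s)"
    and der: "\<And>s x. s \<in> S \<Longrightarrow> x \<in> space N \<Longrightarrow> ((\<lambda>s. f s x) has_field_derivative f' s x) (at s within S)"
    and bnd: "\<And>s x. s \<in> S \<Longrightarrow> x \<in> space N \<Longrightarrow> norm (f' s x) \<le> w x"
    and w: "integrable N w" and meas: "f' t \<in> borel_measurable N"
  shows "((\<lambda>s. \<integral>x. f s x \<partial>N) has_field_derivative (\<integral>x. f' t x \<partial>N)) (at t within S)"
  unfolding has_field_derivative_iff tendsto_at_iff_sequentially
proof (intro allI impI)
  fix X :: "nat \<Rightarrow> 'k" assume X: "\<forall>i. X i \<in> S - {t}" "X \<longlonglongrightarrow> t"
  have "(\<lambda>i. \<integral>x. (f (X i) x - f t x) / (X i - t) \<partial>N) \<longlonglongrightarrow> (\<integral>x. f' t x \<partial>N)"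
  proof (rule integral_dominated_convergence[OF meas _ w])
    show "(\<lambda>x. (f (X i) x - f t x) / (X i - t)) \<in> borel_measurable N" for i
      using X assms(2) int by (intro borel_measurable_integrable integrable_divide Bochner_Integration.integrable_diff) auto
    show "AE x in N. (\<lambda>i. (f (X i) x - f t x) / (X i - t)) \<longlonglongrightarrow> f' t x"
    proof (rule AE_I2)
      fix x assume "x \<in> space N"
      from der[OF assms(2) this] show "(\<lambda>i. (f (X i) x - f t x) / (X i - t)) \<longlonglongrightarrow> f' t x"
        unfolding has_field_derivative_iff tendsto_at_iff_sequentially using X by (auto simp: o_def)
    qed
    show "AE x in N. norm ((f (X i) x - f t x) / (X i - t)) \<le> w x" for i
    proof (rule AE_I2)
      fix x assume x: "x \<in> space N"
      have "norm (f (X i) x - f t x) \<le> w x * norm (X i - t)"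
        using assms(1) X assms(2) x der bnd
        by (intro field_differentiable_bound[of S "\<lambda>s. f s x" "\<lambda>s. f' s x"]) auto
      moreover have "X i \<noteq> t" using X by auto
      ultimately show "norm ((f (X i) x - f t x) / (X i - t)) \<le> w x"
        by (simp add: norm_divide divide_le_eq)
    qed
  qed
  moreover have eq: "(\<integral>x. (f (X i) x - f t x) / (X i - t) \<partial>N) = ((\<integral>x. f (X i) x \<partial>N) - (\<integral>x. f t x \<partial>N)) / (X i - t)" for i
    using Bochner_Integration.integral_diff[OF int[of "X i"] int[OF assms(2)]] X by simp
  ultimately show "((\<lambda>y. ((\<integral>x. f y x \<partial>N) - (\<integral>x. f t x \<partial>N)) / (y - t)) \<circ> X) \<longlonglongrightarrow> (\<integral>x. f' t x \<partial>N)"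
    by (simp only: o_def eq)
qed

section \<open>Lebesgue measure on coordinate subspaces\<close>

lemma borel_measurable_vecI:
  fixes f :: "'a \<Rightarrow> real^'n::finite"
  assumes "\<And>i. (\<lambda>x. f x $ i) \<in> borel_measurable M"
  shows "f \<in> borel_measurable M"
  by (subst borel_measurable_euclidean_space) (use assms in \<open>auto simp: Basis_vec_def inner_axis\<close>)

definition coord_proj :: "'n::finite set \<Rightarrow> real^'n \<Rightarrow> real^'n" where
  "coord_proj K x = (\<chi> i. if i \<in> K then x $ i else 0)"

text \<open>The coordinates outside \<open>K\<close> fill a cube of volume 1, so integrating over
  the slab is the same as integrating over the slice.\<close>

definition unit_slab :: "'n::finite set \<Rightarrow> (real^'n) set" where
  "unit_slab K = {x. \<forall>i. i \<notin> K \<longrightarrow> x $ i \<in> {0..1}}"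

lemma coord_proj_nth [simp]: "coord_proj K x $ i = (if i \<in> K then x $ i else 0)"
  by (simp add: coord_proj_def)

lemma linear_coord_proj: "linear (coord_proj K)"
  by (auto simp: linear_iff vec_eq_iff)

lemma borel_measurable_coord_proj [measurable]: "coord_proj K \<in> borel_measurable borel"
  by (intro borel_measurable_continuous_onI linear_continuous_on)
     (simp add: linear_coord_proj linear_conv_bounded_linear[symmetric])

lemma unit_slab_borel [measurable]: "unit_slab K \<in> sets borel"
proof -
  have "closed (unit_slab K)"
    unfolding unit_slab_def by (intro closed_Collect_all closed_Collect_imp) (auto intro!: closed_Collect_conj closed_Collect_le continuous_intros)
  then show ?thesis by (rule borel_closed)
qed

lemma coord_proj_in_coord_subspace [simp]: "coord_proj K x \<in> coord_subspace K"
  by (simp add: coord_subspace_def)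

lemma coord_proj_id [simp]: "x \<in> coord_subspace K \<Longrightarrow> coord_proj K x = x"
  by (auto simp: coord_subspace_def vec_eq_iff)

lemma sum_Basis_vec_nth:
  fixes f :: "real^'n::finite \<Rightarrow> real"
  shows "(\<Sum>b\<in>Basis. f b *\<^sub>R b) $ i = f (axis i 1)"
proof -
  have "(\<Sum>b\<in>Basis. f b *\<^sub>R b) $ i = (\<Sum>b\<in>Basis. f b *\<^sub>R b) \<bullet> axis i 1"
    by (simp add: inner_axis)
  also have "\<dots> = f (axis i 1)" by (intro inner_sum_left_Basis) (auto simp: Basis_vec_def)
  finally show ?thesis .
qed

text \<open>Lebesgue measure is a product over \<open>Basis\<close>; the axes reindex this product
  by coordinates.\<close>

lemma emeasure_lborel_vec_rectangle:
  fixes A :: "'n::finite \<Rightarrow> real set"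
  assumes [measurable]: "\<And>i. A i \<in> sets borel"
  shows "emeasure lborel {x::real^'n. \<forall>i. x $ i \<in> A i} = (\<Prod>i\<in>UNIV. emeasure lborel (A i))"
proof -
  interpret product_sigma_finite "\<lambda>_::real^'n. lborel :: real measure" ..
  define ax where "ax = (\<lambda>i::'n. axis i (1::real))"
  have inj: "inj ax" by (auto simp: ax_def inj_on_def axis_eq_axis)
  have B: "Basis = range ax" by (auto simp: Basis_vec_def ax_def)
  define A' where "A' = (\<lambda>b. A (inv ax b))"
  have nth: "(\<Sum>b\<in>Basis. f b *\<^sub>R b) $ i = f (ax i)" for f :: "real^'n \<Rightarrow> real" and i
    unfolding ax_def by (rule sum_Basis_vec_nth)
  have meas: "{x::real^'n. \<forall>i. x $ i \<in> A i} \<in> sets borel" by measurable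
  have "emeasure lborel {x::real^'n. \<forall>i. x $ i \<in> A i} =
     emeasure (\<Pi>\<^sub>M b\<in>(Basis::(real^'n) set). lborel)
       ((\<lambda>f. \<Sum>b\<in>Basis. f b *\<^sub>R b) -` {x::real^'n. \<forall>i. x $ i \<in> A i} \<inter> space (\<Pi>\<^sub>M b\<in>(Basis::(real^'n) set). lborel))"
    by (subst lborel_eq, subst emeasure_distr) (use meas in auto)
  also have "(\<lambda>f. \<Sum>b\<in>Basis. f b *\<^sub>R b) -` {x::real^'n. \<forall>i. x $ i \<in> A i} \<inter> space (\<Pi>\<^sub>M b\<in>(Basis::(real^'n) set). lborel)
     = (\<Pi>\<^sub>E b\<in>Basis. A' b)"
    by (simp only: vimage_def mem_Collect_eq nth) (auto simp: B space_PiM PiE_iff A'_def inj)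
  also have "emeasure (\<Pi>\<^sub>M b\<in>(Basis::(real^'n) set). lborel) (\<Pi>\<^sub>E b\<in>Basis. A' b) = (\<Prod>b\<in>Basis. emeasure lborel (A' b))"
    by (rule emeasure_PiM) (auto simp: A'_def)
  also have "\<dots> = (\<Prod>i\<in>UNIV. emeasure lborel (A i))"
    unfolding B using inj by (subst prod.reindex) (auto simp: A'_def)
  finally show ?thesis .
qed

lemma coord_lborel_eq:
  fixes K :: "'n::finite set"
  shows "coord_lborel K = distr (density lborel (indicator (unit_slab K))) borel (coord_proj K)"
proof -
  interpret product_sigma_finite "\<lambda>_::'n. lborel :: real measure" ..
  define r where "r = (\<lambda>x::real^'n. \<lambda>i\<in>K. x $ i)"
  have r[measurable]: "r \<in> borel \<rightarrow>\<^sub>M (\<Pi>\<^sub>M i\<in>K. lborel)"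
    unfolding r_def by measurable
  have "distr (density lborel (indicator (unit_slab K))) (\<Pi>\<^sub>M i\<in>K. lborel) r = (\<Pi>\<^sub>M i\<in>K. lborel)"
  proof (rule PiM_eqI)
    fix A :: "'n \<Rightarrow> real set" assume A: "\<And>i. i \<in> K \<Longrightarrow> A i \<in> sets lborel"
    define A' where "A' = (\<lambda>i. if i \<in> K then A i else {0..1})"
    have [measurable]: "A' i \<in> sets borel" for i using A by (auto simp: A'_def)
    have PiE: "Pi\<^sub>E K A \<in> sets (\<Pi>\<^sub>M i\<in>K. lborel)" using A by (intro sets_PiM_I_finite) auto
    have "emeasure (distr (density lborel (indicator (unit_slab K))) (\<Pi>\<^sub>M i\<in>K. lborel) r) (Pi\<^sub>E K A)
       = emeasure (density lborel (indicator (unit_slab K))) (r -` Pi\<^sub>E K A)"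
      using PiE by (subst emeasure_distr) auto
    also have "\<dots> = emeasure lborel (unit_slab K \<inter> r -` Pi\<^sub>E K A)"
      using measurable_sets[OF r PiE] by (subst emeasure_density) (auto simp: nn_integral_indicator[symmetric] indicator_inter_arith[symmetric] simp del: nn_integral_indicator)
    also have "unit_slab K \<inter> r -` Pi\<^sub>E K A = {x. \<forall>i. x $ i \<in> A' i}"
      by (auto simp: r_def A'_def unit_slab_def PiE_iff)
    also have "emeasure lborel \<dots> = (\<Prod>i\<in>UNIV. emeasure lborel (A' i))"
      by (rule emeasure_lborel_vec_rectangle) auto
    also have "\<dots> = (\<Prod>i\<in>K. emeasure lborel (A' i))"
      by (rule prod.mono_neutral_right) (auto simp: A'_def)
    also have "\<dots> = (\<Prod>i\<in>K. emeasure lborel (A i))" by (simp add: A'_def)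
    finally show "emeasure (distr (density lborel (indicator (unit_slab K))) (\<Pi>\<^sub>M i\<in>K. lborel) r) (Pi\<^sub>E K A)
       = (\<Prod>i\<in>K. emeasure lborel (A i))" .
  qed auto
  then have "coord_lborel K = distr (distr (density lborel (indicator (unit_slab K))) (\<Pi>\<^sub>M i\<in>K. lborel) r) borel (\<lambda>f. \<chi> i. if i \<in> K then f i else 0)"
    unfolding coord_lborel_def by simp
  also have "\<dots> = distr (density lborel (indicator (unit_slab K))) borel ((\<lambda>f. \<chi> i. if i \<in> K then f i else 0) \<circ> r)"
  proof (rule distr_distr)
    show "(\<lambda>f. \<chi> i. if i \<in> K then f i else 0) \<in> (\<Pi>\<^sub>M i\<in>K. lborel :: real measure) \<rightarrow>\<^sub>M (borel :: (real^'n) measure)"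
    proof (rule borel_measurable_vecI)
      fix i show "(\<lambda>f. (\<chi> i. if i \<in> K then f i else 0) $ i) \<in> borel_measurable (\<Pi>\<^sub>M i\<in>K. lborel :: real measure)"
        by (cases "i \<in> K") auto
    qed
  qed (use r in auto)
  also have "(\<lambda>f. \<chi> i. if i \<in> K then f i else 0) \<circ> r = coord_proj K"
    by (auto simp: fun_eq_iff r_def vec_eq_iff)
  finally show ?thesis .
qed

lemma sets_coord_lborel [simp, measurable_cong]: "sets (coord_lborel K) = sets borel"
  by (simp add: coord_lborel_def)

lemma space_coord_lborel [simp]: "space (coord_lborel K) = UNIV"
  by (simp add: coord_lborel_def)

lemma nn_integral_coord_lborel:
  assumes [measurable]: "f \<in> borel_measurable borel"
  shows "(\<integral>\<^sup>+x. f x \<partial>coord_lborel K) = (\<integral>\<^sup>+x. f (coord_proj K x) * indicator (unit_slab K) x \<partial>lborel)"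
  unfolding coord_lborel_eq
  by (subst nn_integral_distr) (auto simp: nn_integral_density mult.commute)

lemma closed_coord_subspace: "closed (coord_subspace K)"
  unfolding coord_subspace_def by (intro closed_Collect_all closed_Collect_imp) (auto intro!: closed_Collect_eq continuous_intros)

lemma AE_coord_lborel: "AE x in coord_lborel K. x \<in> coord_subspace K"
  unfolding coord_lborel_eq
proof (subst AE_distr_iff)
  have "coord_subspace K \<in> sets borel" by (rule borel_closed[OF closed_coord_subspace])
  then show "{x \<in> space borel. x \<in> coord_subspace K} \<in> sets borel" by simp
qed auto

lemma nn_integral_coord_lborel_affine:
  fixes a :: "real^'n::finite"
  assumes [measurable]: "f \<in> borel_measurable borel" and c: "c \<noteq> 0" and a: "a \<in> coord_subspace K"
  shows "(\<integral>\<^sup>+x. f x \<partial>coord_lborel K) = ennreal (\<bar>c\<bar> ^ card K) * (\<integral>\<^sup>+u. f (a + c *\<^sub>R u) \<partial>coord_lborel K)"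
proof -
  define ax where "ax = (\<lambda>i::'n. axis i (1::real))"
  have inj: "inj ax" by (auto simp: ax_def inj_on_def axis_eq_axis)
  have B: "Basis = range ax" by (auto simp: Basis_vec_def ax_def)
  \<comment> \<open>Only the coordinates in \<open>K\<close> are stretched. The slab is therefore
    preserved, and the Jacobian is the power with exponent \<open>card K\<close>.\<close>
  define cc where "cc = (\<lambda>b. if inv ax b \<in> K then c else 1)"
  define T where "T = (\<lambda>x. a + (\<Sum>j\<in>Basis. (cc j * (x \<bullet> j)) *\<^sub>R j))"
  have nth: "(\<Sum>b\<in>Basis. f b *\<^sub>R b) $ i = f (ax i)" for f :: "real^'n \<Rightarrow> real" and i
    unfolding ax_def by (rule sum_Basis_vec_nth)
  have T: "T x $ i = a $ i + (if i \<in> K then c else 1) * x $ i" for x i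
    by (simp only: T_def vector_add_component nth cc_def inv_f_f[OF inj]) (simp add: ax_def inner_axis)
  have leb: "lborel = density (distr lborel borel T) (\<lambda>_. (\<Prod>j\<in>Basis. \<bar>cc j\<bar>))"
    unfolding T_def by (rule lborel_affine_euclidean) (use c in \<open>auto simp: cc_def\<close>)
  have prod: "(\<Prod>j\<in>(Basis::(real^'n) set). \<bar>cc j\<bar>) = \<bar>c\<bar> ^ card K"
  proof -
    have "(\<Prod>j\<in>(Basis::(real^'n) set). \<bar>cc j\<bar>) = (\<Prod>i\<in>UNIV. if i \<in> K then \<bar>c\<bar> else 1)"
      unfolding B using inj by (subst prod.reindex) (auto simp: cc_def intro!: prod.cong)
    also have "\<dots> = \<bar>c\<bar> ^ card K" by (simp add: prod.If_cases)
    finally show ?thesis .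
  qed
  have [measurable]: "T \<in> borel_measurable borel"
    unfolding T_def by measurable
  have p: "coord_proj K (T x) = a + c *\<^sub>R coord_proj K x" for x
    using a by (auto simp: vec_eq_iff T coord_subspace_def)
  have s: "T x \<in> unit_slab K \<longleftrightarrow> x \<in> unit_slab K" for x
    using a by (auto simp: unit_slab_def T coord_subspace_def)
  have "(\<integral>\<^sup>+x. f x \<partial>coord_lborel K) = (\<integral>\<^sup>+x. f (coord_proj K x) * indicator (unit_slab K) x \<partial>lborel)"
    by (simp add: nn_integral_coord_lborel)
  also have "\<dots> = (\<integral>\<^sup>+x. ennreal (\<bar>c\<bar> ^ card K) * (f (coord_proj K (T x)) * indicator (unit_slab K) (T x)) \<partial>lborel)"
    by (subst leb) (simp add: nn_integral_density nn_integral_distr prod)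
  also have "\<dots> = ennreal (\<bar>c\<bar> ^ card K) * (\<integral>\<^sup>+x. f (a + c *\<^sub>R coord_proj K x) * indicator (unit_slab K) x \<partial>lborel)"
    by (subst nn_integral_cmult[symmetric]) (auto simp: p s indicator_def)
  also have "(\<integral>\<^sup>+x. f (a + c *\<^sub>R coord_proj K x) * indicator (unit_slab K) x \<partial>lborel) = (\<integral>\<^sup>+u. f (a + c *\<^sub>R u) \<partial>coord_lborel K)"
    by (subst nn_integral_coord_lborel) auto
  finally show ?thesis .
qed

lemma coord_lborel_affine:
  fixes a :: "real^'n::finite"
  assumes "c \<noteq> 0" "a \<in> coord_subspace K"
  shows "coord_lborel K = density (distr (coord_lborel K) borel (\<lambda>u. a + c *\<^sub>R u)) (\<lambda>_. ennreal (\<bar>c\<bar> ^ card K))"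
proof (rule measure_eqI)
  fix A assume "A \<in> sets (coord_lborel K)"
  then have [measurable]: "A \<in> sets borel" by simp
  have "emeasure (coord_lborel K) A = ennreal (\<bar>c\<bar> ^ card K) * (\<integral>\<^sup>+u. indicator A (a + c *\<^sub>R u) \<partial>coord_lborel K)"
    using nn_integral_coord_lborel_affine[of "indicator A" c a K] assms by simp
  also have "(\<integral>\<^sup>+u. indicator A (a + c *\<^sub>R u) \<partial>coord_lborel K) = emeasure (distr (coord_lborel K) borel (\<lambda>u. a + c *\<^sub>R u)) A"
    by (simp add: nn_integral_distr flip: nn_integral_indicator)
  also have "ennreal (\<bar>c\<bar> ^ card K) * \<dots> = emeasure (density (distr (coord_lborel K) borel (\<lambda>u. a + c *\<^sub>R u)) (\<lambda>_. ennreal (\<bar>c\<bar> ^ card K))) A"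
    by (simp add: emeasure_density nn_integral_cmult)
  finally show "emeasure (coord_lborel K) A = \<dots>" .
qed simp

lemma integral_coord_lborel_affine:
  fixes a :: "real^'n::finite" and f :: "real^'n \<Rightarrow> real"
  assumes "c \<noteq> 0" "a \<in> coord_subspace K" and [measurable]: "f \<in> borel_measurable borel"
  shows "(\<integral>x. f x \<partial>coord_lborel K) = \<bar>c\<bar> ^ card K * (\<integral>u. f (a + c *\<^sub>R u) \<partial>coord_lborel K)"
  by (subst coord_lborel_affine[OF assms(1,2)]) (simp add: integral_density integral_distr)

lemma emeasure_coord_lborel_cball:
  fixes K :: "'n::finite set"
  shows "emeasure (coord_lborel K) (cball 0 r) < \<infinity>"
proof -
  \<comment> \<open>The coordinates outside \<open>K\<close> range over \<open>{0..1}\<close>, hence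
    the 1.\<close>
  define R where "R = max r 1"
  have "emeasure (coord_lborel K) (cball 0 r) = (\<integral>\<^sup>+x. indicator (cball 0 r) (coord_proj K x) * indicator (unit_slab K) x \<partial>lborel)"
    by (subst nn_integral_coord_lborel[symmetric]) (auto intro!: borel_measurable_indicator)
  also have "\<dots> \<le> (\<integral>\<^sup>+x. indicator (cbox (\<chi> i. - R) (\<chi> i. R)) (x::real^'n) \<partial>lborel)"
  proof (rule nn_integral_mono)
    fix x :: "real^'n"
    have "x \<in> cbox (\<chi> i. - R) (\<chi> i. R)" if "norm (coord_proj K x) \<le> r" "x \<in> unit_slab K"
    proof -
      have "\<bar>x $ i\<bar> \<le> R" for i
      proof (cases "i \<in> K")
        case True
        then have "\<bar>x $ i\<bar> \<le> norm (coord_proj K x)" using component_le_norm_cart[of "coord_proj K x" i] by simp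
        then show ?thesis using that by (simp add: R_def)
      next
        case False
        then show ?thesis using that by (auto simp: unit_slab_def R_def)
      qed
      then show ?thesis by (auto simp: mem_box_cart abs_le_iff minus_le_iff)
    qed
    then show "indicator (cball 0 r) (coord_proj K x) * indicator (unit_slab K) x \<le> (indicator (cbox (\<chi> i. - R) (\<chi> i. R)) x :: ennreal)"
      by (auto simp: indicator_def)
  qed
  also have "\<dots> < \<infinity>" using emeasure_lborel_cbox_finite by simp
  finally show ?thesis .
qed


lemma integrable_coord_lborel_bounded:
  fixes f :: "real^'n::finite \<Rightarrow> real"
  assumes "f \<in> borel_measurable borel" "\<And>u. \<bar>f u\<bar> \<le> B * indicator (cball 0 R) u"
  shows "integrable (coord_lborel K) f"
proof (rule integrableI_bounded_set[of "cball 0 R"])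
  show "AE u\<in>cball 0 R in coord_lborel K. norm (f u) \<le> B"
    using assms(2) by (intro AE_I2) (metis indicator_simps(1) mult.right_neutral real_norm_def)
  show "AE u in coord_lborel K. u \<notin> cball 0 R \<longrightarrow> f u = 0"
    using assms(2) by (intro AE_I2 impI) (metis abs_le_zero_iff indicator_simps(2) mult_zero_right)
qed (use assms(1) emeasure_coord_lborel_cball[of K R] in auto)

lemma integrable_coord_lborel_cball:
  fixes K :: "'n::finite set"
  shows "integrable (coord_lborel K) (\<lambda>u. C * indicator (cball 0 R) u :: real)"
  using integrable_real_indicator[of "cball 0 R" "coord_lborel K"] emeasure_coord_lborel_cball[of K R]
  by (intro integrable_mult_right) simp

text \<open>Translation invariance replaces integration by parts: the integral of
  \<open>h (u + s e)\<close> does not depend on \<open>s\<close>, and differentiating it under the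
  integral at \<open>s = 0\<close> produces the integral of \<open>h'\<close>.\<close>

lemma integral_coord_lborel_partial_derivative:
  fixes h h' :: "real^'n::finite \<Rightarrow> real"
  assumes i: "i \<in> K"
    and der: "\<And>u. ((\<lambda>s. h (u + s *\<^sub>R axis i 1)) has_real_derivative h' u) (at 0)"
    and [measurable]: "h \<in> borel_measurable borel" "h' \<in> borel_measurable borel"
    and B: "\<And>u. \<bar>h u\<bar> \<le> B * indicator (cball 0 R) u" "\<And>u. \<bar>h' u\<bar> \<le> B * indicator (cball 0 R) u"
  shows "(\<integral>u. h' u \<partial>coord_lborel K) = 0"
proof -
  define e :: "real^'n" where "e = axis i 1"
  have e: "e \<in> coord_subspace K" "norm e = 1"
  proof -
    show "e \<in> coord_subspace K" using i by (auto simp: e_def coord_subspace_def axis_def)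
  qed (simp add: e_def)
  \<comment> \<open>Shifts by less than 1 keep the support within radius \<open>R + 1\<close>, which
    gives one dominating function for all of them.\<close>
  have B': "\<bar>g (u + s *\<^sub>R e)\<bar> \<le> \<bar>B\<bar> * indicator (cball 0 (R + 1)) u"
    if "\<bar>s\<bar> < 1" and g: "\<And>u. \<bar>g u\<bar> \<le> B * indicator (cball 0 R) u" for s u g
  proof -
    have "norm u \<le> norm (u + s *\<^sub>R e) + norm (s *\<^sub>R e)"
      using norm_triangle_ineq4[of "u + s *\<^sub>R e" "s *\<^sub>R e"] by simp
    then have "norm u \<le> R + 1" if "norm (u + s *\<^sub>R e) \<le> R"
      using that \<open>\<bar>s\<bar> < 1\<close> e by simp
    then show ?thesis using g[of "u + s *\<^sub>R e"]
      by (cases "norm (u + s *\<^sub>R e) \<le> R") auto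
  qed
  have shift: "((\<lambda>s. h (u + s *\<^sub>R e)) has_real_derivative h' (u + s *\<^sub>R e)) (at s)" for u s
  proof -
    have "((\<lambda>r. h ((u + s *\<^sub>R e) + r *\<^sub>R e)) has_real_derivative h' (u + s *\<^sub>R e)) (at (s - s))"
      using der[of "u + s *\<^sub>R e"] by (simp add: e_def)
    then have "((\<lambda>r. h ((u + s *\<^sub>R e) + (r - s) *\<^sub>R e)) has_real_derivative h' (u + s *\<^sub>R e)) (at s)"
      using DERIV_shift[of "\<lambda>r. h ((u + s *\<^sub>R e) + (r - s) *\<^sub>R e)" "h' (u + s *\<^sub>R e)" 0 s] by (simp add: add.commute)
    moreover have "(u + s *\<^sub>R e) + (r - s) *\<^sub>R e = u + r *\<^sub>R e" for r
      by (simp add: algebra_simps)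
    ultimately show ?thesis by simp
  qed
  have *: "((\<lambda>s. \<integral>u. h (u + s *\<^sub>R e) \<partial>coord_lborel K) has_field_derivative (\<integral>u. h' (u + 0 *\<^sub>R e) \<partial>coord_lborel K)) (at 0 within {-1<..<1})"
  proof (rule has_field_derivative_integral[where w="\<lambda>u. \<bar>B\<bar> * indicator (cball 0 (R + 1)) u"])
    show "integrable (coord_lborel K) (\<lambda>u. \<bar>B\<bar> * indicator (cball 0 (R + 1)) u)"
      by (rule integrable_coord_lborel_cball)
    show "integrable (coord_lborel K) (\<lambda>u. h (u + s *\<^sub>R e))" if "s \<in> {-1<..<1}" for s
      using that by (intro integrable_coord_lborel_bounded[of _ "\<bar>B\<bar>" "R + 1"] B' B) auto
    show "norm (h' (u + s *\<^sub>R e)) \<le> \<bar>B\<bar> * indicator (cball 0 (R + 1)) u" if "s \<in> {-1<..<1}" for s u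
      using that B'[of s h' u] B by auto
    show "((\<lambda>s. h (u + s *\<^sub>R e)) has_real_derivative h' (u + s *\<^sub>R e)) (at s within {- 1<..<1})" for s u
      by (rule has_field_derivative_at_within[OF shift])
  qed auto
  have "(\<integral>u. h (u + s *\<^sub>R e) \<partial>coord_lborel K) = (\<integral>u. h u \<partial>coord_lborel K)" for s
  proof -
    have "s *\<^sub>R e \<in> coord_subspace K" using e by (auto simp: coord_subspace_def)
    from integral_coord_lborel_affine[of 1, OF _ this, of h] show ?thesis by (simp add: add.commute)
  qed
  with * have "((\<lambda>s::real. \<integral>u. h u \<partial>coord_lborel K) has_field_derivative (\<integral>u. h' u \<partial>coord_lborel K)) (at 0 within {-1<..<1})"
    by simp
  then have "((\<lambda>s::real. \<integral>u. h u \<partial>coord_lborel K) has_field_derivative (\<integral>u. h' u \<partial>coord_lborel K)) (at 0)"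
    by (simp add: at_within_open[of 0 "{-1<..<1::real}"])
  then show ?thesis using DERIV_unique[OF _ DERIV_const] by blast
qed

section \<open>Transport of integrals over sublevel sets\<close>

definition sqpos :: "real \<Rightarrow> real" where "sqpos s = (max 0 s)\<^sup>2"

lemma DERIV_sqpos: "(sqpos has_real_derivative 2 * max 0 s) (at s)"
proof -
  consider "s < 0" | "s = 0" | "s > 0" by linarith
  then show ?thesis
  proof cases
    case 1
    have "((\<lambda>_. 0) has_real_derivative 2 * max 0 s) (at s)" using 1 by (auto intro!: derivative_eq_intros)
    then show ?thesis
      by (rule has_field_derivative_transform_within_open[of _ _ _ "{..<0}"]) (use 1 in \<open>auto simp: sqpos_def\<close>)
  next
    case 2
    have "((\<lambda>h. sqpos h / h) \<longlongrightarrow> 0) (at 0)"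
    proof (rule Lim_null_comparison)
      show "\<forall>\<^sub>F h in at 0. norm (sqpos h / h) \<le> \<bar>h\<bar>"
        by (rule always_eventually) (auto simp: sqpos_def max_def power2_eq_square)
      show "((\<lambda>h::real. \<bar>h\<bar>) \<longlongrightarrow> 0) (at 0)" by (auto intro!: tendsto_eq_intros)
    qed
    then show ?thesis using 2 by (simp add: has_field_derivative_iff sqpos_def)
  next
    case 3
    have "((\<lambda>s. s\<^sup>2) has_real_derivative 2 * max 0 s) (at s)" using 3 by (auto intro!: derivative_eq_intros)
    then show ?thesis
      by (rule has_field_derivative_transform_within_open[of _ _ _ "{0<..}"]) (use 3 in \<open>auto simp: sqpos_def\<close>)
  qed
qed

text \<open>The value is 1 for \<open>y \<le> 1\<close> and 0 from \<open>1 + 1 / Suc n\<close> on,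
  so the limit is the indicator of the closed half-line, as closed balls require. All cutoffs vanish
  beyond 2; this is the 2 in the hypothesis \<open>large\<close> below. One continuous derivative is
  enough, since a cutoff is differentiated only once.\<close>

definition cutoff :: "nat \<Rightarrow> real \<Rightarrow> real" where
  "cutoff n y = sqpos (1 - sqpos (real (Suc n) * (y - 1)))"

definition cutoff' :: "nat \<Rightarrow> real \<Rightarrow> real" where
  "cutoff' n y = 2 * max 0 (1 - sqpos (real (Suc n) * (y - 1))) * (- (2 * max 0 (real (Suc n) * (y - 1)) * real (Suc n)))"

lemma DERIV_cutoff: "(cutoff n has_real_derivative cutoff' n y) (at y)"
proof -
  have 1: "((\<lambda>y. 1 - sqpos (real (Suc n) * (y - 1))) has_real_derivative
      (- (2 * max 0 (real (Suc n) * (y - 1)) * real (Suc n)))) (at y)"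
    by (auto intro!: derivative_eq_intros DERIV_chain2[OF DERIV_sqpos])
  show ?thesis
    unfolding cutoff_def[abs_def] cutoff'_def by (rule DERIV_chain2[OF DERIV_sqpos 1])
qed

lemma continuous_cutoff: "continuous_on S (cutoff n)" "continuous_on S (cutoff' n)"
  unfolding cutoff_def[abs_def] cutoff'_def[abs_def] sqpos_def[abs_def] by (intro continuous_intros)+

lemma cutoff_le_1: "y \<le> 1 \<Longrightarrow> cutoff n y = 1"
  using mult_nonneg_nonpos[of "real (Suc n)" "y - 1"] unfolding cutoff_def sqpos_def
  by (simp add: max_absorb1 del: of_nat_Suc)

lemma cutoff_bounds: "0 \<le> cutoff n y" "cutoff n y \<le> 1"
proof -
  have "0 \<le> max 0 (1 - (max 0 (real (Suc n) * (y - 1)))\<^sup>2)" "max 0 (1 - (max 0 (real (Suc n) * (y - 1)))\<^sup>2) \<le> 1"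
    by auto
  then show "0 \<le> cutoff n y" "cutoff n y \<le> 1" by (auto simp: cutoff_def sqpos_def power_le_one)
qed

lemma cutoff_large:
  assumes "real (Suc n) * (y - 1) \<ge> 1" shows "cutoff n y = 0" "cutoff' n y = 0"
proof -
  have "1 \<le> (real (Suc n) * (y - 1))\<^sup>2" using assms by (rule one_le_power)
  moreover have "sqpos (real (Suc n) * (y - 1)) = (real (Suc n) * (y - 1))\<^sup>2"
    using assms unfolding sqpos_def by (simp only: max_def) auto
  ultimately have "1 - sqpos (real (Suc n) * (y - 1)) \<le> 0" by linarith
  then show "cutoff n y = 0" "cutoff' n y = 0" by (simp_all add: cutoff_def cutoff'_def sqpos_def[of "1 - _"])
qed

lemma cutoff_ge_2: assumes "y \<ge> 2" shows "cutoff n y = 0" "cutoff' n y = 0"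
proof -
  have "1 * 1 \<le> real (Suc n) * (y - 1)" using assms by (intro mult_mono) auto
  then show "cutoff n y = 0" "cutoff' n y = 0" using cutoff_large by auto
qed

lemma cutoff_tendsto: "(\<lambda>n. cutoff n y) \<longlonglongrightarrow> indicator {..1} y"
proof (cases "y \<le> 1")
  case True
  then show ?thesis by (simp add: cutoff_le_1)
next
  case False
  obtain N where N: "1 / (y - 1) < real N" using reals_Archimedean2 by blast
  have "cutoff n y = 0" if "n \<ge> N" for n
  proof (rule cutoff_large)
    have "1 / (y - 1) \<le> real (Suc n)" using N that by simp
    then show "1 \<le> real (Suc n) * (y - 1)" using False by (simp add: divide_le_eq)
  qed
  then have "\<forall>\<^sub>F n in sequentially. cutoff n y = indicator {..1} y"
    using False by (auto simp: eventually_sequentially)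
  then show ?thesis by (rule tendsto_eventually)
qed

text \<open>\<open>X\<close> is the velocity of the sublevel sets \<open>{u. F (a, t, u) \<le> 1}\<close> as \<open>t\<close> varies. The indicator
  function of a sublevel set is approximated by \<open>cutoff n (F (a, t, u))\<close>, for which differentiation
  under the integral sign and integration by parts are available.\<close>

locale reynolds =
  fixes K :: "'n::finite set" and P :: "'p::euclidean_space set"
    and F :: "'p \<times> real \<times> (real^'n) \<Rightarrow> real" and X :: "'n \<Rightarrow> 'p \<times> real \<times> (real^'n) \<Rightarrow> real"
    and \<Omega> :: "('p \<times> real \<times> (real^'n)) set" and d R :: real
  assumes open_dom: "open \<Omega>" and compact_P: "compact P"
    and box_sub: "P \<times> {-d..d} \<times> cball 0 R \<subseteq> \<Omega>"
    and smooth_F: "smooth_on F \<Omega>" and smooth_X: "\<And>i. i \<in> K \<Longrightarrow> smooth_on (X i) \<Omega>"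
    and transport: "\<And>a t u. a \<in> P \<Longrightarrow> \<bar>t\<bar> \<le> d \<Longrightarrow> norm u \<le> R \<Longrightarrow> u \<in> coord_subspace K \<Longrightarrow>
        frechet_derivative F (at (a, t, u)) (0, 1, 0)
        + (\<Sum>i\<in>K. X i (a, t, u) * frechet_derivative F (at (a, t, u)) (0, 0, axis i 1)) = 0"
    and large: "\<And>a t u. a \<in> P \<Longrightarrow> \<bar>t\<bar> \<le> d \<Longrightarrow> norm u \<le> R \<Longrightarrow> R / 2 \<le> norm u \<Longrightarrow> F (a, t, u) \<ge> 2"
    and R_pos: "R > 0" and d_pos: "d > 0"
begin

abbreviation "D \<equiv> (\<lambda>f p v. frechet_derivative f (at p) v)"

text \<open>The Reynolds density: time derivative of \<open>J\<close> plus the divergence of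
  \<open>J X\<close>, taken in the slice coordinates only.\<close>

definition transp :: "('p \<times> real \<times> (real^'n) \<Rightarrow> real) \<Rightarrow> 'p \<times> real \<times> (real^'n) \<Rightarrow> real" where
  "transp J p = D J p (0, 1, 0) + (\<Sum>i\<in>K. D (\<lambda>p. J p * X i p) p (0, 0, axis i 1))"

text \<open>The factor \<open>indicator (cball 0 R)\<close> confines the integral to the region
  where \<open>F\<close> and \<open>J\<close> are controlled; by \<open>large\<close> it cuts
  nothing off the sublevel set inside that ball except beyond \<open>R\<close>. \<open>H\<close>
  below is the same integral with a cutoff.\<close>

definition G :: "('p \<times> real \<times> (real^'n) \<Rightarrow> real) \<Rightarrow> 'p \<Rightarrow> real \<Rightarrow> real" where
  "G J a t = (\<integral>u. indicator (cball 0 R) u * (indicator {..1} (F (a, t, u)) * J (a, t, u)) \<partial>coord_lborel K)"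

definition H :: "nat \<Rightarrow> ('p \<times> real \<times> (real^'n) \<Rightarrow> real) \<Rightarrow> 'p \<Rightarrow> real \<Rightarrow> real" where
  "H n J a t = (\<integral>u. indicator (cball 0 R) u * (cutoff n (F (a, t, u)) * J (a, t, u)) \<partial>coord_lborel K)"

lemma smooth_transp: "smooth_on J \<Omega> \<Longrightarrow> smooth_on (transp J) \<Omega>"
  unfolding transp_def[abs_def]
  by (intro smooth_on_add smooth_on_sum smooth_on_frechet_derivative smooth_on_mult smooth_X open_dom)

lemma in_dom: "a \<in> P \<Longrightarrow> \<bar>t\<bar> \<le> d \<Longrightarrow> norm u \<le> R \<Longrightarrow> (a, t, u) \<in> \<Omega>"
  using box_sub by (auto simp: abs_le_iff)

lemma smooth_bounded:
  fixes J :: "'p \<times> real \<times> (real^'n) \<Rightarrow> real"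
  assumes "continuous_on \<Omega> J"
  obtains C where "C > 0" "\<And>a t u. a \<in> P \<Longrightarrow> \<bar>t\<bar> \<le> d \<Longrightarrow> norm u \<le> R \<Longrightarrow> \<bar>J (a, t, u)\<bar> \<le> C"
proof -
  have "compact (J ` (P \<times> {-d..d} \<times> cball 0 R))"
    by (intro compact_continuous_image continuous_on_subset[OF assms box_sub] compact_Times compact_P) auto
  then obtain C where C: "C > 0" "\<forall>y \<in> J ` (P \<times> {-d..d} \<times> cball 0 R). norm y \<le> C"
    using compact_imp_bounded bounded_pos by metis
  have "\<bar>J (a, t, u)\<bar> \<le> C" if "a \<in> P" "\<bar>t\<bar> \<le> d" "norm u \<le> R" for a t u
  proof -
    have "(a, t, u) \<in> P \<times> {-d..d} \<times> cball 0 R" using that by (auto simp: abs_le_iff)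
    then show ?thesis using C(2) by fastforce
  qed
  with C(1) show thesis by (rule that)
qed

lemma meas_cont:
  fixes J :: "'p \<times> real \<times> (real^'n) \<Rightarrow> real"
  assumes "continuous_on \<Omega> J" "a \<in> P" "\<bar>t\<bar> \<le> d"
  shows "(\<lambda>u. indicator (cball 0 R) u * J (a, t, u)) \<in> borel_measurable borel"
proof -
  have "continuous_on (cball 0 R) (\<lambda>u. J (a, t, u))"
    by (rule continuous_on_compose2[OF assms(1)]) (use in_dom assms in \<open>auto intro!: continuous_intros\<close>)
  from borel_measurable_continuous_on_indicator[OF _ this] show ?thesis by simp
qed

lemma cont_F: "continuous_on \<Omega> F" by (rule smooth_on_imp_continuous_on[OF smooth_F])

lemma meas_G:
  fixes J :: "'p \<times> real \<times> (real^'n) \<Rightarrow> real"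
  assumes "continuous_on \<Omega> J" "a \<in> P" "\<bar>t\<bar> \<le> d"
  shows "(\<lambda>u. indicator (cball 0 R) u * (indicator {..1} (F (a, t, u)) * J (a, t, u))) \<in> borel_measurable borel"
proof -
  note [measurable] = meas_cont[OF assms] meas_cont[OF cont_F assms(2,3)]
  have "(\<lambda>u. indicator {..1::real} (indicator (cball 0 R) u * F (a, t, u)) * (indicator (cball 0 R) u * J (a, t, u)) :: real) \<in> borel_measurable borel"
    by measurable
  moreover have "(\<lambda>u. indicator {..1} (indicator (cball 0 R) u * F (a, t, u)) * (indicator (cball 0 R) u * J (a, t, u)))
    = (\<lambda>u. indicator (cball 0 R) u * (indicator {..1} (F (a, t, u)) * J (a, t, u)))"
    by (auto simp: indicator_def fun_eq_iff)
  ultimately show ?thesis by simp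
qed

lemma cont_cutoff:
  fixes J :: "'p \<times> real \<times> (real^'n) \<Rightarrow> real"
  assumes "continuous_on \<Omega> J"
  shows "continuous_on \<Omega> (\<lambda>p. cutoff n (F p) * J p)" "continuous_on \<Omega> (\<lambda>p. cutoff' n (F p) * J p)"
  by (auto intro!: continuous_intros assms continuous_on_compose2[OF continuous_cutoff(1) cont_F]
      continuous_on_compose2[OF continuous_cutoff(2) cont_F])

lemma integrable_cont:
  fixes J :: "'p \<times> real \<times> (real^'n) \<Rightarrow> real"
  assumes "continuous_on \<Omega> J" "a \<in> P" "\<bar>t\<bar> \<le> d"
  shows "integrable (coord_lborel K) (\<lambda>u. indicator (cball 0 R) u * J (a, t, u))"
proof -
  obtain C where "C > 0" "\<And>a t u. a \<in> P \<Longrightarrow> \<bar>t\<bar> \<le> d \<Longrightarrow> norm u \<le> R \<Longrightarrow> \<bar>J (a, t, u)\<bar> \<le> C"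
    using smooth_bounded[OF assms(1)] by blast
  then show ?thesis
    using assms by (intro integrable_coord_lborel_bounded[of _ C R] meas_cont) (auto simp: indicator_def)
qed

lemma partial_t:
  assumes "smooth_on J \<Omega>" "(a, t, u) \<in> \<Omega>"
  shows "((\<lambda>t. J (a, t, u)) has_real_derivative D J (a, t, u) (0, 1, 0)) (at t)"
proof -
  note dJ = smooth_on_has_derivative[OF assms]
  have "((\<lambda>t. J (a, t, u)) has_derivative (\<lambda>s. D J (a, t, u) (0, s, 0))) (at t)"
    by (rule has_derivative_compose[of "\<lambda>t. (a, t, u)" "\<lambda>s. (0, s, 0)" t UNIV J, OF _ dJ])
      (auto intro!: has_derivative_Pair has_derivative_const has_derivative_ident)
  moreover have eq: "D J (a, t, u) (0, s, 0) = D J (a, t, u) (0, 1, 0) * s" for s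
    using linear_cmul[OF has_derivative_linear[OF dJ], of s "(0, 1, 0)"] by simp
  ultimately show ?thesis
    by (subst has_field_derivative_def) (rule has_derivative_eq_rhs[OF _ ext[OF eq]])
qed

lemma partial_u:
  assumes "smooth_on J \<Omega>" "(a, t, u) \<in> \<Omega>"
  shows "((\<lambda>s. J (a, t, u + s *\<^sub>R e)) has_real_derivative D J (a, t, u) (0, 0, e)) (at 0)"
proof -
  have dJ: "(J has_derivative D J (a, t, u)) (at (a, t, u + 0 *\<^sub>R e))"
    using smooth_on_has_derivative[OF assms] by simp
  have "((\<lambda>s. J (a, t, u + s *\<^sub>R e)) has_derivative (\<lambda>s. D J (a, t, u) (0, 0, s *\<^sub>R e))) (at 0)"
    by (rule has_derivative_compose[of "\<lambda>s. (a, t, u + s *\<^sub>R e)" "\<lambda>s. (0, 0, s *\<^sub>R e)" 0 UNIV J, OF _ dJ])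
      (auto intro!: has_derivative_Pair derivative_eq_intros)
  moreover have eq: "D J (a, t, u) (0, 0, s *\<^sub>R e) = D J (a, t, u) (0, 0, e) * s" for s
    using linear_cmul[OF has_derivative_linear[OF dJ], of s "(0, 0, e)"] by simp
  ultimately show ?thesis
    by (subst has_field_derivative_def) (rule has_derivative_eq_rhs[OF _ ext[OF eq]])
qed

lemma continuous_on_D: "smooth_on J \<Omega> \<Longrightarrow> continuous_on \<Omega> (\<lambda>p. D J p v)"
  by (rule smooth_on_imp_continuous_on[OF smooth_on_frechet_derivative])

text \<open>\<open>g'\<close> is the \<open>i\<close>-th partial derivative of
  \<open>cutoff n (F p) * Y p\<close>, a function that vanishes for
  \<open>R / 2 \<le> norm u \<le> R\<close> by \<open>large\<close>. There is thus no boundary term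
  on the sphere of radius \<open>R\<close>.\<close>

lemma integral_divergence:
  fixes n :: nat
  assumes Y: "smooth_on Y \<Omega>" and i: "i \<in> K" and a: "a \<in> P" and t: "\<bar>t\<bar> \<le> d"
  defines "g' \<equiv> (\<lambda>p. cutoff' n (F p) * (D F p (0, 0, axis i 1) * Y p) + cutoff n (F p) * D Y p (0, 0, axis i 1))"
  shows "(\<integral>u. indicator (cball 0 R) u * g' (a, t, u) \<partial>coord_lborel K) = 0"
proof -
  define g where "g = (\<lambda>p. cutoff n (F p) * Y p)"
  have cg: "continuous_on \<Omega> g" "continuous_on \<Omega> g'"
    unfolding g_def g'_def
    by (auto intro!: continuous_on_add cont_cutoff continuous_on_mult continuous_on_D[OF smooth_F] continuous_on_D[OF Y] smooth_on_imp_continuous_on[OF Y])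
  obtain C1 where C1: "C1 > 0" "\<And>a t u. a \<in> P \<Longrightarrow> \<bar>t\<bar> \<le> d \<Longrightarrow> norm u \<le> R \<Longrightarrow> \<bar>g (a, t, u)\<bar> \<le> C1"
    using smooth_bounded[OF cg(1)] by blast
  obtain C2 where C2: "C2 > 0" "\<And>a t u. a \<in> P \<Longrightarrow> \<bar>t\<bar> \<le> d \<Longrightarrow> norm u \<le> R \<Longrightarrow> \<bar>g' (a, t, u)\<bar> \<le> C2"
    using smooth_bounded[OF cg(2)] by blast
  show ?thesis
  proof (rule integral_coord_lborel_partial_derivative[where h="\<lambda>u. indicator (cball 0 R) u * g (a, t, u)" and R=R and B="max C1 C2", OF i])
    show "\<bar>indicator (cball 0 R) u * g (a, t, u)\<bar> \<le> max C1 C2 * indicator (cball 0 R) u" for u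
      using C1(2)[OF a t, of u] by (auto simp: indicator_def)
    show "\<bar>indicator (cball 0 R) u * g' (a, t, u)\<bar> \<le> max C1 C2 * indicator (cball 0 R) u" for u
      using C2(2)[OF a t, of u] by (auto simp: indicator_def)
    show "((\<lambda>s. indicator (cball 0 R) (u + s *\<^sub>R axis i 1) * g (a, t, u + s *\<^sub>R axis i 1)) has_real_derivative indicator (cball 0 R) u * g' (a, t, u)) (at 0)" for u
    proof (cases "norm u < R")
      case True
      then have in_d: "(a, t, u) \<in> \<Omega>" using in_dom a t by auto
      have "((\<lambda>s. g (a, t, u + s *\<^sub>R axis i 1)) has_real_derivative g' (a, t, u)) (at 0)"
        unfolding g_def g'_def
        by (rule DERIV_cong[OF DERIV_mult[OF DERIV_chain2[OF DERIV_cutoff partial_u[OF smooth_F in_d]] partial_u[OF Y in_d]]])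
          (simp add: algebra_simps)
      moreover have "open ((\<lambda>s. u + s *\<^sub>R axis i 1) -` ball 0 R)"
        by (intro open_vimage continuous_intros) auto
      ultimately have "((\<lambda>s. indicator (cball 0 R) (u + s *\<^sub>R axis i 1) * g (a, t, u + s *\<^sub>R axis i 1)) has_real_derivative g' (a, t, u)) (at 0)"
        by (rule has_field_derivative_transform_within_open) (use True in auto)
      then show ?thesis using True by simp
    next
      case False
      have z: "g' (a, t, u) = 0" if "norm u \<le> R"
        using large[OF a t that] False R_pos by (simp add: g'_def cutoff_ge_2)
      \<comment> \<open>On this neighbourhood of \<open>u\<close> either the indicator or the cutoff
        vanishes, so the jump of the indicator at the sphere is invisible.\<close>
      define V where "V = (\<lambda>s. u + s *\<^sub>R axis i 1) -` (- cball 0 (R / 2))"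
      have V: "open V" "0 \<in> V"
        unfolding V_def using False R_pos by (auto intro!: open_vimage continuous_intros)
      have z2: "indicator (cball 0 R) (u + s *\<^sub>R axis i 1) * g (a, t, u + s *\<^sub>R axis i 1) = 0" if "s \<in> V" for s
        using that large[OF a t, of "u + s *\<^sub>R axis i 1"]
        by (cases "norm (u + s *\<^sub>R axis i 1) \<le> R") (auto simp: V_def g_def cutoff_ge_2)
      have "((\<lambda>s. indicator (cball 0 R) (u + s *\<^sub>R axis i 1) * g (a, t, u + s *\<^sub>R axis i 1)) has_real_derivative 0) (at 0)"
        by (rule has_field_derivative_transform_within_open[OF DERIV_const V z2[symmetric]])
      then show ?thesis using z by (cases "norm u \<le> R") simp_all
    qed
  qed (use meas_cont[OF cg(1) a t] meas_cont[OF cg(2) a t] in auto)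
qed

text \<open>Differentiation under the integral leaves a term with \<open>cutoff'\<close>, which
  blows up as \<open>n\<close> grows. Adding the divergences \<open>h i\<close>, whose integrals are
  0, cancels it and leaves an expression of the shape \<open>H n\<close> again.\<close>

lemma DERIV_H:
  assumes J: "smooth_on J \<Omega>" and a: "a \<in> P" and t: "\<bar>t\<bar> < d"
  shows "(H n J a has_real_derivative H n (transp J) a t) (at t)"
proof -
  define S where "S = {-d<..<d}"
  have tS: "t \<in> S" using t by (auto simp: S_def)
  define g' where "g' = (\<lambda>p. cutoff' n (F p) * (D F p (0, 1, 0) * J p) + cutoff n (F p) * D J p (0, 1, 0))"
  define h where "h = (\<lambda>i p. cutoff' n (F p) * (D F p (0, 0, axis i 1) * (J p * X i p)) + cutoff n (F p) * D (\<lambda>p. J p * X i p) p (0, 0, axis i 1))"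
  note cJ = smooth_on_imp_continuous_on[OF J]
  have JX: "smooth_on (\<lambda>p. J p * X i p) \<Omega>" if "i \<in> K" for i
    using that by (intro smooth_on_mult open_dom J smooth_X)
  have cg': "continuous_on \<Omega> g'"
    unfolding g'_def by (auto intro!: continuous_on_add cont_cutoff continuous_on_mult continuous_on_D[OF smooth_F] continuous_on_D[OF J] cJ)
  have ch: "continuous_on \<Omega> (h i)" if "i \<in> K" for i
    unfolding h_def
    by (rule continuous_on_add[OF cont_cutoff(2) cont_cutoff(1)], rule continuous_on_mult)
      (rule continuous_on_D[OF smooth_F] smooth_on_imp_continuous_on[OF JX[OF that]] continuous_on_D[OF JX[OF that]])+
  obtain C where C: "C > 0" "\<And>a t u. a \<in> P \<Longrightarrow> \<bar>t\<bar> \<le> d \<Longrightarrow> norm u \<le> R \<Longrightarrow> \<bar>g' (a, t, u)\<bar> \<le> C"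
    using smooth_bounded[OF cg'] by blast
  have "((\<lambda>t. \<integral>u. indicator (cball 0 R) u * (cutoff n (F (a, t, u)) * J (a, t, u)) \<partial>coord_lborel K) has_field_derivative
      (\<integral>u. indicator (cball 0 R) u * g' (a, t, u) \<partial>coord_lborel K)) (at t within S)"
  proof (rule has_field_derivative_integral[where w="\<lambda>u. C * indicator (cball 0 R) u"])
    show "integrable (coord_lborel K) (\<lambda>u. indicator (cball 0 R) u * (cutoff n (F (a, s, u)) * J (a, s, u)))" if "s \<in> S" for s
      using integrable_cont[OF cont_cutoff(1)[OF cJ] a] that by (auto simp: S_def abs_le_iff)
    show "integrable (coord_lborel K) (\<lambda>u. C * indicator (cball 0 R) u)"
      by (rule integrable_coord_lborel_cball)
    show "((\<lambda>s. indicator (cball 0 R) u * (cutoff n (F (a, s, u)) * J (a, s, u))) has_real_derivative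
        indicator (cball 0 R) u * g' (a, s, u)) (at s within S)" if "s \<in> S" for s u
    proof (cases "norm u \<le> R")
      case True
      then have in_d: "(a, s, u) \<in> \<Omega>" using in_dom a that by (auto simp: S_def)
      have "((\<lambda>s. cutoff n (F (a, s, u)) * J (a, s, u)) has_real_derivative g' (a, s, u)) (at s)"
        unfolding g'_def
        by (rule DERIV_cong[OF DERIV_mult[OF DERIV_chain2[OF DERIV_cutoff partial_t[OF smooth_F in_d]] partial_t[OF J in_d]]])
          (simp add: algebra_simps)
      then show ?thesis using True by (simp add: has_field_derivative_at_within)
    qed simp
    show "norm (indicator (cball 0 R) u * g' (a, s, u)) \<le> C * indicator (cball 0 R) u" if "s \<in> S" for s u
      using C(2)[OF a, of s u] that by (auto simp: S_def indicator_def)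
  qed (use tS t meas_cont[OF cg' a] in \<open>auto simp: S_def\<close>)
  then have der: "(H n J a has_real_derivative (\<integral>u. indicator (cball 0 R) u * g' (a, t, u) \<partial>coord_lborel K)) (at t)"
    using at_within_open[OF tS] by (simp add: H_def[abs_def] S_def)
  have "(\<integral>u. indicator (cball 0 R) u * g' (a, t, u) \<partial>coord_lborel K)
      = (\<integral>u. indicator (cball 0 R) u * g' (a, t, u) \<partial>coord_lborel K) + (\<Sum>i\<in>K. \<integral>u. indicator (cball 0 R) u * h i (a, t, u) \<partial>coord_lborel K)"
    using integral_divergence[OF JX _ a] t unfolding h_def by simp
  also have "\<dots> = (\<integral>u. indicator (cball 0 R) u * g' (a, t, u) + (\<Sum>i\<in>K. indicator (cball 0 R) u * h i (a, t, u)) \<partial>coord_lborel K)"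
  proof -
    have I1: "integrable (coord_lborel K) (\<lambda>u. indicator (cball 0 R) u * g' (a, t, u))"
      using t by (intro integrable_cont cg' a) auto
    have I2: "integrable (coord_lborel K) (\<lambda>u. indicator (cball 0 R) u * h i (a, t, u))" if "i \<in> K" for i
      using t that by (intro integrable_cont ch a) auto
    show ?thesis
      by (simp only: Bochner_Integration.integral_add[OF I1 Bochner_Integration.integrable_sum[OF I2]] Bochner_Integration.integral_sum[OF I2])
  qed
  also have "\<dots> = H n (transp J) a t"
    unfolding H_def
  proof (rule integral_cong_AE)
    show "AE u in coord_lborel K. indicator (cball 0 R) u * g' (a, t, u) + (\<Sum>i\<in>K. indicator (cball 0 R) u * h i (a, t, u))
         = indicator (cball 0 R) u * (cutoff n (F (a, t, u)) * transp J (a, t, u))"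
      using AE_coord_lborel
    proof eventually_elim
      case (elim u)
      show ?case
      proof (cases "norm u \<le> R")
        case True
        let ?p = "(a, t, u)"
        \<comment> \<open>The factor beside \<open>cutoff'\<close> is the left side of
          \<open>transport\<close>. That identity holds on the slice only, which is why the
          integrands agree almost everywhere rather than everywhere.\<close>
        have "g' ?p + (\<Sum>i\<in>K. h i ?p) = cutoff' n (F ?p) * J ?p * (D F ?p (0, 1, 0) + (\<Sum>i\<in>K. X i ?p * D F ?p (0, 0, axis i 1)))
           + cutoff n (F ?p) * transp J ?p"
          by (simp add: g'_def h_def transp_def sum.distrib sum_distrib_left algebra_simps)
        then show ?thesis using transport[OF a _ True elim] t True by simp
      qed simp
    qed
    have "(\<lambda>u. indicator (cball 0 R) u * g' (a, t, u) + (\<Sum>i\<in>K. indicator (cball 0 R) u * h i (a, t, u))) \<in> borel_measurable borel"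
      using t by (intro borel_measurable_add borel_measurable_sum meas_cont cg' ch a) auto
    then show "(\<lambda>u. indicator (cball 0 R) u * g' (a, t, u) + (\<Sum>i\<in>K. indicator (cball 0 R) u * h i (a, t, u))) \<in> borel_measurable (coord_lborel K)"
      by simp
    show "(\<lambda>u. indicator (cball 0 R) u * (cutoff n (F (a, t, u)) * transp J (a, t, u))) \<in> borel_measurable (coord_lborel K)"
      using meas_cont[OF cont_cutoff(1)[OF smooth_on_imp_continuous_on[OF smooth_transp[OF J]]] a] t by simp
  qed
  finally show ?thesis using der by (simp only:)
qed

lemma measure_bound:
  assumes f: "f \<in> borel_measurable borel" "\<And>u. \<bar>f u\<bar> \<le> C * indicator (cball 0 R) u"
  shows "\<bar>\<integral>u. f u \<partial>coord_lborel K\<bar> \<le> C * measure (coord_lborel K) (cball 0 R)"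
proof -
  have "\<bar>\<integral>u. f u \<partial>coord_lborel K\<bar> \<le> (\<integral>u. \<bar>f u\<bar> \<partial>coord_lborel K)" by (rule integral_abs_bound)
  also have "\<dots> \<le> (\<integral>u. C * indicator (cball 0 R) u \<partial>coord_lborel K)"
  proof (rule integral_mono)
    show "integrable (coord_lborel K) (\<lambda>u. C * indicator (cball 0 R) u)"
      by (rule integrable_coord_lborel_cball)
    show "integrable (coord_lborel K) (\<lambda>u. \<bar>f u\<bar>)"
      using assms by (intro integrable_abs integrable_coord_lborel_bounded) auto
  qed (use f in auto)
  finally show ?thesis by simp
qed

lemma H_tendsto:
  assumes J: "smooth_on J \<Omega>" and a: "a \<in> P" and t: "\<bar>t\<bar> \<le> d"
  shows "(\<lambda>n. H n J a t) \<longlonglongrightarrow> G J a t"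
proof -
  note cJ = smooth_on_imp_continuous_on[OF J]
  obtain C where C: "C > 0" "\<And>a t u. a \<in> P \<Longrightarrow> \<bar>t\<bar> \<le> d \<Longrightarrow> norm u \<le> R \<Longrightarrow> \<bar>J (a, t, u)\<bar> \<le> C"
    using smooth_bounded[OF cJ] by blast
  show ?thesis unfolding H_def G_def
  proof (rule integral_dominated_convergence[where w="\<lambda>u. C * indicator (cball 0 R) u"])
    show "integrable (coord_lborel K) (\<lambda>u. C * indicator (cball 0 R) u)"
      by (rule integrable_coord_lborel_cball)
    show "AE u in coord_lborel K. (\<lambda>n. indicator (cball 0 R) u * (cutoff n (F (a, t, u)) * J (a, t, u)))
        \<longlonglongrightarrow> indicator (cball 0 R) u * (indicator {..1} (F (a, t, u)) * J (a, t, u))"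
      by (intro AE_I2 tendsto_mult tendsto_const cutoff_tendsto)
    show "AE u in coord_lborel K. norm (indicator (cball 0 R) u * (cutoff n (F (a, t, u)) * J (a, t, u))) \<le> C * indicator (cball 0 R) u" for n
    proof (rule AE_I2)
      fix u
      have "\<bar>cutoff n (F (a, t, u)) * J (a, t, u)\<bar> \<le> 1 * C" if "norm u \<le> R"
        unfolding abs_mult using cutoff_bounds[of n] C(2)[OF a t that] by (intro mult_mono) auto
      then show "norm (indicator (cball 0 R) u * (cutoff n (F (a, t, u)) * J (a, t, u))) \<le> C * indicator (cball 0 R) u"
        by (auto simp: indicator_def)
    qed
  qed (use meas_G[OF cJ a t] meas_cont[OF cont_cutoff(1)[OF cJ] a t] in auto)
qed

text \<open>Uniformity in \<open>n\<close> feeds the dominated convergence in \<open>G_diff\<close>;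
  uniformity in \<open>a\<close> becomes the common bound in \<open>deriv_chain_G\<close>.\<close>

lemma H_bound:
  assumes "smooth_on J \<Omega>"
  obtains C where "\<And>n a t. a \<in> P \<Longrightarrow> \<bar>t\<bar> \<le> d \<Longrightarrow> \<bar>H n J a t\<bar> \<le> C"
    "\<And>a t. a \<in> P \<Longrightarrow> \<bar>t\<bar> \<le> d \<Longrightarrow> \<bar>G J a t\<bar> \<le> C"
proof -
  note cJ = smooth_on_imp_continuous_on[OF assms]
  obtain C where C: "C > 0" "\<And>a t u. a \<in> P \<Longrightarrow> \<bar>t\<bar> \<le> d \<Longrightarrow> norm u \<le> R \<Longrightarrow> \<bar>J (a, t, u)\<bar> \<le> C"
    using smooth_bounded[OF cJ] by blast
  have H: "\<bar>H n J a t\<bar> \<le> C * measure (coord_lborel K) (cball 0 R)" if a: "a \<in> P" and t: "\<bar>t\<bar> \<le> d" for n a t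
    unfolding H_def
  proof (rule measure_bound[OF meas_cont[OF cont_cutoff(1)[OF cJ] a t]])
    fix u
    have "\<bar>cutoff n (F (a, t, u)) * J (a, t, u)\<bar> \<le> 1 * C" if "norm u \<le> R"
      unfolding abs_mult using cutoff_bounds[of n] C(2)[OF a t that] by (intro mult_mono) auto
    then show "\<bar>indicator (cball 0 R) u * (cutoff n (F (a, t, u)) * J (a, t, u))\<bar> \<le> C * indicator (cball 0 R) u"
      by (auto simp: indicator_def)
  qed
  moreover have "\<bar>G J a t\<bar> \<le> C * measure (coord_lborel K) (cball 0 R)" if "a \<in> P" "\<bar>t\<bar> \<le> d" for a t
    using H_tendsto[OF assms that] H[OF that] by (intro LIMSEQ_le_const2[of "\<lambda>n. \<bar>H n J a t\<bar>"] tendsto_rabs) auto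
  ultimately show thesis by (rule that)
qed

text \<open>Pointwise convergence of \<open>H n\<close> does not pass to derivatives, but the
  integrated identity survives the limit in \<open>n\<close> by dominated convergence.\<close>

lemma G_diff:
  assumes J: "smooth_on J \<Omega>" and a: "a \<in> P" and st: "-d < s" "s \<le> t" "t < d"
  shows "(G (transp J) a has_integral (G J a t - G J a s)) {s..t}"
proof -
  have ftc: "(H n (transp J) a has_integral (H n J a t - H n J a s)) {s..t}" for n
  proof (rule fundamental_theorem_of_calculus[OF st(2)])
    fix x assume "x \<in> {s..t}"
    then have "\<bar>x\<bar> < d" using st by (auto simp: abs_less_iff)
    from has_field_derivative_at_within[OF DERIV_H[OF J a this]]
    show "(H n J a has_vector_derivative H n (transp J) a x) (at x within {s..t})"
      by (simp only: has_real_derivative_iff_has_vector_derivative)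
  qed
  obtain C where C: "\<And>n a t. a \<in> P \<Longrightarrow> \<bar>t\<bar> \<le> d \<Longrightarrow> \<bar>H n (transp J) a t\<bar> \<le> C"
    using H_bound[OF smooth_transp[OF J]] by metis
  have dc: "H n (transp J) a integrable_on {s..t}" "(\<lambda>_. C) integrable_on {s..t}"
    "\<And>x. x \<in> {s..t} \<Longrightarrow> norm (H n (transp J) a x) \<le> C"
    "\<And>x. x \<in> {s..t} \<Longrightarrow> (\<lambda>n. H n (transp J) a x) \<longlonglongrightarrow> G (transp J) a x" for n
    using has_integral_integrable[OF ftc] C[OF a] H_tendsto[OF smooth_transp[OF J] a] st
    by auto
  note lim = dominated_convergence[where f="\<lambda>n. H n (transp J) a" and h="\<lambda>_. C", OF dc]
  moreover have "(\<lambda>n. integral {s..t} (H n (transp J) a)) \<longlonglongrightarrow> G J a t - G J a s"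
    using st by (simp only: integral_unique[OF ftc]) (intro tendsto_diff H_tendsto J a; simp)
  ultimately have "integral {s..t} (G (transp J) a) = G J a t - G J a s"
    using LIMSEQ_unique lim(2) by blast
  then show ?thesis using integrable_integral[OF lim(1)] by simp
qed

text \<open>By \<open>G_diff\<close> the increments are integrals of a bounded function, so
  \<open>G J a\<close> is Lipschitz. Used for \<open>transp J\<close> in place of \<open>J\<close>,
  this is the continuity that turns \<open>G_diff\<close> into a derivative.\<close>

lemma continuous_G:
  assumes J: "smooth_on J \<Omega>" and a: "a \<in> P"
  shows "continuous_on {-d<..<d} (G J a)"
proof -
  obtain C where C: "\<And>a t. a \<in> P \<Longrightarrow> \<bar>t\<bar> \<le> d \<Longrightarrow> \<bar>G (transp J) a t\<bar> \<le> C"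
    using H_bound[OF smooth_transp[OF J]] by metis
  have C0: "0 \<le> C" using C[OF a, of 0] d_pos by auto
  have le: "\<bar>G J a t - G J a s\<bar> \<le> C * \<bar>t - s\<bar>" if "-d < s" "s \<le> t" "t < d" for s t
    using has_integral_bound_real[OF C0 finite.emptyI G_diff[OF J a that]] C[OF a] that by (auto simp: abs_le_iff)
  have "C-lipschitz_on {-d<..<d} (G J a)"
  proof (rule lipschitz_onI[OF _ C0])
    fix s t assume "s \<in> {-d<..<d}" "t \<in> {-d<..<d}"
    then show "dist (G J a s) (G J a t) \<le> C * dist s t"
      using le[of s t] le[of t s] by (cases "s \<le> t") (auto simp: dist_real_def abs_minus_commute)
  qed
  then show ?thesis by (rule lipschitz_on_continuous_on)
qed

lemma DERIV_G:
  assumes J: "smooth_on J \<Omega>" and a: "a \<in> P" and t: "\<bar>t\<bar> < d"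
  shows "(G J a has_real_derivative G (transp J) a t) (at t)"
proof -
  \<comment> \<open>Midway between \<open>\<bar>t\<bar>\<close> and \<open>d\<close>: a compact
    interval inside the open one with \<open>t\<close> in its interior.\<close>
  define r where "r = (\<bar>t\<bar> + d) / 2"
  have r: "\<bar>t\<bar> < r" "r < d" using t by (auto simp: r_def)
  have cont: "continuous_on {-r..r} (G (transp J) a)"
    by (rule continuous_on_subset[OF continuous_G[OF smooth_transp[OF J] a]]) (use r in auto)
  have "((\<lambda>u. integral {-r..u} (G (transp J) a)) has_vector_derivative G (transp J) a t) (at t within {-r..r})"
    by (rule integral_has_vector_derivative[OF cont]) (use r in auto)
  then have *: "((\<lambda>u. integral {-r..u} (G (transp J) a)) has_real_derivative G (transp J) a t) (at t within {-r<..<r})"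
    unfolding has_real_derivative_iff_has_vector_derivative by (rule has_vector_derivative_within_subset) auto
  have "((\<lambda>u. integral {-r..u} (G (transp J) a)) has_real_derivative G (transp J) a t) (at t)"
  proof -
    have "at t within {-r<..<r} = at t" using r by (intro at_within_open) auto
    with * show ?thesis by simp
  qed
  then have "((\<lambda>u. integral {-r..u} (G (transp J) a) + G J a (-r)) has_real_derivative G (transp J) a t) (at t)"
    by (auto intro!: derivative_eq_intros)
  then show ?thesis
  proof (rule has_field_derivative_transform_within_open[of _ _ _ "{-r<..<r}"])
    fix u assume "u \<in> {-r<..<r}"
    then have "integral {-r..u} (G (transp J) a) = G J a u - G J a (-r)"
      using r by (intro integral_unique G_diff J a) auto
    then show "integral {-r..u} (G (transp J) a) + G J a (-r) = G J a u" by simp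
  qed (use r in auto)
qed

end

section \<open>Small balls in a slice chart\<close>

text \<open>\<open>g k\<close> is the \<open>k\<close>-th derivative of \<open>g 0\<close>, which behaves like \<open>t^m\<close> times an even function. The
  bounds \<open>C\<close> are an argument because they have to be uniform in the base point.\<close>

definition deriv_chain :: "real \<Rightarrow> (nat \<Rightarrow> real) \<Rightarrow> nat \<Rightarrow> (nat \<Rightarrow> real \<Rightarrow> real) \<Rightarrow> bool" where
  "deriv_chain d C m g \<longleftrightarrow>
     (\<forall>k t. \<bar>t\<bar> < d \<longrightarrow> (g k has_real_derivative g (Suc k) t) (at t) \<and> \<bar>g k t\<bar> \<le> C k \<and>
        g k (- t) = (-1) ^ (m + k) * g k t) \<and>
     (\<forall>k<m. g k 0 = 0)"

text \<open>Each differentiation of \<open>g k (- t)\<close> brings out one sign, so evenness of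
  \<open>g 0\<close> alternates with oddness along the chain.\<close>

lemma deriv_chain_even:
  assumes D: "\<And>k t. \<bar>t\<bar> < d \<Longrightarrow> (g k has_real_derivative g (Suc k) t) (at t)"
    and C: "\<And>k t. \<bar>t\<bar> < d \<Longrightarrow> \<bar>g k t\<bar> \<le> C k"
    and even: "\<And>t. \<bar>t\<bar> < d \<Longrightarrow> g 0 (- t) = g 0 t"
  shows "deriv_chain d C 0 g"
proof -
  have "g k (- t) = (-1) ^ k * g k t" if "\<bar>t\<bar> < d" for k t
    using that
  proof (induction k arbitrary: t)
    case 0
    then show ?case using even by simp
  next
    case (Suc k)
    have "((\<lambda>t. g k (- t)) has_real_derivative - g (Suc k) (- t)) (at t)"
      using DERIV_chain2[OF D[of "-t" k] DERIV_minus[OF DERIV_ident]] Suc.prems by simp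
    moreover have "((\<lambda>t. g k (- t)) has_real_derivative (-1) ^ k * g (Suc k) t) (at t)"
    proof (rule has_field_derivative_transform_within_open[of "\<lambda>t. (-1) ^ k * g k t" _ _ "{-d<..<d}"])
      show "((\<lambda>t. (-1) ^ k * g k t) has_real_derivative (-1) ^ k * g (Suc k) t) (at t)"
        by (rule DERIV_cmult[OF D[OF Suc.prems]])
      show "(-1) ^ k * g k s = g k (- s)" if "s \<in> {-d<..<d}" for s
        using Suc.IH[of s] that by (auto simp: abs_less_iff)
    qed (use Suc.prems in auto)
    ultimately have "- g (Suc k) (- t) = (-1) ^ k * g (Suc k) t" by (rule DERIV_unique)
    then show ?case by (simp add: minus_equation_iff)
  qed
  then show ?thesis unfolding deriv_chain_def using D C by simp
qed

text \<open>Leibniz rule for the product of \<open>t\<close> with \<open>g 0\<close>. At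
  \<open>k = 0\<close> the truncated index \<open>k - 1\<close> is harmless because its factor is
  0.\<close>

lemma deriv_chain_Suc:
  assumes "deriv_chain d C m g"
  shows "deriv_chain d (\<lambda>k. d * C k + real k * C (k - 1)) (Suc m) (\<lambda>k t. t * g k t + real k * g (k - 1) t)"
  unfolding deriv_chain_def
proof (intro conjI allI impI)
  fix k t assume t: "\<bar>t\<bar> < d"
  have D: "(g k has_real_derivative g (Suc k) t) (at t)" for k
    using assms t by (auto simp: deriv_chain_def)
  have C: "\<bar>g k t\<bar> \<le> C k" for k using assms t by (auto simp: deriv_chain_def)
  have P: "g k (- t) = (-1) ^ (m + k) * g k t" for k using assms t by (auto simp: deriv_chain_def)
  show "((\<lambda>t. t * g k t + real k * g (k - 1) t) has_real_derivative
     t * g (Suc k) t + real (Suc k) * g (Suc k - 1) t) (at t)"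
  proof (cases k)
    case 0
    then show ?thesis by (auto intro!: derivative_eq_intros D)
  next
    case (Suc l)
    then show ?thesis using D[of l] D[of k] by (auto intro!: derivative_eq_intros simp: algebra_simps)
  qed
  have "\<bar>t * g k t\<bar> \<le> d * C k" unfolding abs_mult using t C by (intro mult_mono) auto
  moreover have "\<bar>real k * g (k - 1) t\<bar> \<le> real k * C (k - 1)"
    unfolding abs_mult using C by (simp add: mult_left_mono)
  ultimately show "\<bar>t * g k t + real k * g (k - 1) t\<bar> \<le> d * C k + real k * C (k - 1)" by linarith
  show "- t * g k (- t) + real k * g (k - 1) (- t) = (-1) ^ (Suc m + k) * (t * g k t + real k * g (k - 1) t)"
    by (cases k) (simp_all add: P algebra_simps)
next
  fix k assume "k < Suc m"
  then show "0 * g k 0 + real k * g (k - 1) 0 = 0"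
    using assms by (cases k) (auto simp: deriv_chain_def)
qed

text \<open>The new bounds \<open>C'\<close> are chosen before \<open>g\<close>, so one choice
  serves all base points.\<close>

lemma deriv_chain_power:
  "\<exists>C'. \<forall>g. deriv_chain d C 0 g \<longrightarrow> (\<exists>g'. deriv_chain d C' m g' \<and> (\<forall>t. g' 0 t = t ^ m * g 0 t))"
proof (induction m)
  case 0
  show ?case by (intro exI[of _ C]) auto
next
  case (Suc m)
  then obtain C' where C': "\<And>g. deriv_chain d C 0 g \<Longrightarrow> \<exists>g'. deriv_chain d C' m g' \<and> (\<forall>t. g' 0 t = t ^ m * g 0 t)"
    by blast
  show ?case
  proof (intro exI[of _ "\<lambda>k. d * C' k + real k * C' (k - 1)"] allI impI)
    fix g assume "deriv_chain d C 0 g"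
    from C'[OF this] obtain g' where g': "deriv_chain d C' m g'" "\<And>t. g' 0 t = t ^ m * g 0 t" by blast
    show "\<exists>g'. deriv_chain d (\<lambda>k. d * C' k + real k * C' (k - 1)) (Suc m) g' \<and> (\<forall>t. g' 0 t = t ^ Suc m * g 0 t)"
      by (intro exI conjI allI) (rule deriv_chain_Suc[OF g'(1)], simp add: g'(2))
  qed
qed

lemma deriv_chain_subset: "deriv_chain d C m g \<Longrightarrow> d' \<le> d \<Longrightarrow> (\<And>k. C k \<le> C' k) \<Longrightarrow> deriv_chain d' C' m g"
  unfolding deriv_chain_def by (meson dual_order.trans order_less_le_trans)

text \<open>An odd derivative vanishes at 0, so \<open>m + k\<close> is even; the zeros of order
  below \<open>m\<close> give \<open>k \<ge> m\<close>.\<close>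

lemma deriv_chain_zero:
  assumes "deriv_chain d C m g" "0 < d" "g k 0 \<noteq> 0"
  obtains i where "k = m + 2 * i"
proof -
  have "k \<ge> m" using assms unfolding deriv_chain_def by (meson not_le)
  moreover have "g k 0 = (-1) ^ (m + k) * g k 0"
    using assms(1,2) unfolding deriv_chain_def by (metis abs_zero minus_zero)
  then have "even (m + k)" using assms(3) by (cases "even (m + k)") auto
  ultimately have "even (k - m)" by simp
  then show thesis using that \<open>k \<ge> m\<close> by (metis evenE le_add_diff_inverse)
qed

section \<open>Derivatives and Gram determinants of slice charts\<close>

lemma smooth_on_lipschitz:
  fixes f :: "'a::euclidean_space \<Rightarrow> 'b::real_normed_vector"
  assumes f: "smooth_on f S" and C: "compact C" "convex C" "C \<subseteq> S"
  obtains B where "B > 0" "\<And>x y. x \<in> C \<Longrightarrow> y \<in> C \<Longrightarrow> norm (f x - f y) \<le> B * norm (x - y)"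
proof -
  define h where "h = (\<lambda>x. \<Sum>b\<in>Basis. norm (frechet_derivative f (at x) b))"
  have "continuous_on C h"
    unfolding h_def
    by (intro continuous_intros continuous_on_subset[OF smooth_on_imp_continuous_on[OF smooth_on_frechet_derivative[OF f]] C(3)])
  then have "compact (h ` C)" by (rule compact_continuous_image[OF _ C(1)])
  then obtain B where B: "B > 0" "\<And>x. x \<in> C \<Longrightarrow> norm (h x) \<le> B"
    using compact_imp_bounded bounded_pos by (metis imageI)
  have d: "(f has_derivative frechet_derivative f (at x)) (at x)" if "x \<in> C" for x
    using smooth_on_has_derivative[OF f] C(3) that by blast
  have on: "onorm (frechet_derivative f (at x)) \<le> B" if x: "x \<in> C" for x
  proof (rule onorm_le)
    fix v :: 'a
    have "norm (frechet_derivative f (at x) v) = norm (\<Sum>b\<in>Basis. (v \<bullet> b) *\<^sub>R frechet_derivative f (at x) b)"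
      by (subst linear_basis_expansion[OF has_derivative_bounded_linear[OF d[OF x]]]) simp
    also have "\<dots> \<le> (\<Sum>b\<in>Basis. norm v * norm (frechet_derivative f (at x) b))"
      by (rule sum_norm_le) (simp add: mult_right_mono Basis_le_norm)
    also have "\<dots> = norm v * h x" by (simp add: h_def sum_distrib_left)
    also have "\<dots> \<le> norm v * B" using B(2)[OF x] by (intro mult_left_mono) auto
    also have "\<dots> = B * norm v" by simp
    finally show "norm (frechet_derivative f (at x) v) \<le> B * norm v" .
  qed
  have "norm (f x - f y) \<le> B * norm (x - y)" if "x \<in> C" "y \<in> C" for x y
    by (rule differentiable_bound[OF C(2) _ on that]) (use d has_derivative_at_withinI in blast)
  then show thesis using B(1) that by blast
qed

text \<open>The segment from the identity to \<open>A\<close> consists of positive definite, hence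
  invertible, matrices, so the determinant cannot change sign on it.\<close>

lemma det_pos_definite:
  fixes A :: "real^'n^'n"
  assumes "\<And>x. x \<noteq> 0 \<Longrightarrow> x \<bullet> (A *v x) > 0"
  shows "det A > 0"
proof (rule ccontr)
  assume neg: "\<not> det A > 0"
  define B where "B = (\<lambda>t::real. (\<chi> i j. (1 - t) * (if i = j then 1 else 0) + t * A $ i $ j) :: real^'n^'n)"
  have Bv: "B t *v x = (1 - t) *\<^sub>R x + t *\<^sub>R (A *v x)" for t x
  proof -
    have "B t = (1 - t) *\<^sub>R mat 1 + t *\<^sub>R A" by (simp add: B_def vec_eq_iff mat_def)
    then show ?thesis by (simp add: matrix_vector_mult_add_rdistrib flip: scaleR_matrix_vector_assoc)
  qed
  have nz: "det (B t) \<noteq> 0" if "0 \<le> t" "t \<le> 1" for t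
  proof
    assume "det (B t) = 0"
    then have "\<not> invertible (B t)" by (simp add: invertible_det_nz)
    then obtain x where x: "x \<noteq> 0" "B t *v x = 0"
      unfolding invertible_left_inverse matrix_left_invertible_ker by blast
    have "x \<bullet> (B t *v x) = (1 - t) * (x \<bullet> x) + t * (x \<bullet> (A *v x))"
      by (simp add: Bv inner_add_right)
    moreover have "x \<bullet> x > 0" "x \<bullet> (A *v x) > 0" using x assms by auto
    ultimately have "x \<bullet> (B t *v x) > 0"
      using that by (cases "t = 0") (auto intro: add_nonneg_pos)
    then show False using x by simp
  qed
  have "continuous_on {0..1} (\<lambda>t. det (B t))"
    unfolding det_def B_def by (auto intro!: continuous_intros)
  moreover have "det (B 1) = det A" "det (B 0) = 1"
  proof -
    have "B 1 = A" "B 0 = mat 1" by (simp_all add: B_def vec_eq_iff mat_def)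
    then show "det (B 1) = det A" "det (B 0) = 1" by simp_all
  qed
  ultimately obtain t where "0 \<le> t" "t \<le> 1" "det (B t) = 0"
    using IVT2'[of "\<lambda>t. det (B t)" 1 0 0] neg by auto
  then show False using nz by blast
qed

lemma slice_chart_left_inverse:
  assumes "slice_chart m M K V \<phi>" "x \<in> V"
  shows "inv_into V \<phi> (\<phi> x) = x"
  using assms by (simp add: slice_chart_def)

text \<open>Differentiating the identity \<open>inv_into V \<phi> (\<phi> y) = y\<close> exhibits a
  left inverse of the derivative.\<close>

lemma slice_chart_injective_derivative:
  assumes c: "slice_chart m M K V \<phi>" and x: "x \<in> V" and "frechet_derivative \<phi> (at x) v = 0"
  shows "v = 0"
proof -
  have 1: "(\<phi> has_derivative frechet_derivative \<phi> (at x)) (at x)"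
    using c x by (auto simp: slice_chart_def intro: smooth_on_has_derivative)
  have 2: "(inv_into V \<phi> has_derivative frechet_derivative (inv_into V \<phi>) (at (\<phi> x))) (at (\<phi> x))"
    using c x by (auto simp: slice_chart_def intro!: smooth_on_has_derivative)
  have A: "((\<lambda>y. inv_into V \<phi> (\<phi> y)) has_derivative (\<lambda>v. frechet_derivative (inv_into V \<phi>) (at (\<phi> x)) (frechet_derivative \<phi> (at x) v))) (at x)"
    by (rule has_derivative_compose[OF 1 2])
  have B: "((\<lambda>y. inv_into V \<phi> (\<phi> y)) has_derivative (\<lambda>v. v)) (at x)"
  proof (rule has_derivative_transform_within_open[OF has_derivative_ident])
    show "open V" "x \<in> V" using c x by (auto simp: slice_chart_def)
  qed (simp add: slice_chart_left_inverse[OF c])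
  have "frechet_derivative (inv_into V \<phi>) (at (\<phi> x)) (frechet_derivative \<phi> (at x) v) = v"
    by (rule fun_cong[OF has_derivative_unique[OF A B]])
  then show ?thesis
    using assms(3) linear_0[OF has_derivative_linear[OF 2]] by simp
qed

text \<open>The quadratic form of the completed matrix at \<open>v\<close> is the squared length of
  the derivative at \<open>coord_proj K v\<close> plus the squares of the remaining coordinates. By
  injectivity of the derivative both parts vanish only for \<open>v = 0\<close>.\<close>

lemma gram_det_pos:
  fixes \<phi> :: "real^'n::finite \<Rightarrow> real^'n"
  assumes c: "slice_chart m M K V \<phi>" and x: "x \<in> V"
  shows "gram_det K \<phi> x > 0"
  unfolding gram_det_def
proof (rule det_pos_definite)
  fix v :: "real^'n" assume v: "v \<noteq> 0"
  define D where "D = frechet_derivative \<phi> (at x)"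
  have lin: "linear D"
    using c x unfolding D_def by (auto simp: slice_chart_def intro: has_derivative_linear smooth_on_has_derivative)
  let ?A = "(\<chi> i j. if i \<in> K \<and> j \<in> K then D (axis i 1) \<bullet> D (axis j 1) else if i = j then 1 else 0) :: real^'n^'n"
  define w where "w = (\<Sum>i\<in>K. v $ i *\<^sub>R D (axis i 1))"
  have w: "w = D (coord_proj K v)"
  proof -
    have "coord_proj K v = (\<Sum>i\<in>K. v $ i *\<^sub>R axis i 1)"
      by (auto simp: vec_eq_iff axis_def if_distrib cong: if_cong)
    then show ?thesis using lin by (simp add: w_def linear_sum linear_cmul)
  qed
  have Av: "(?A *v v) $ i = (if i \<in> K then D (axis i 1) \<bullet> w else v $ i)" for i
  proof (cases "i \<in> K")
    case True
    have "(?A *v v) $ i = (\<Sum>j\<in>UNIV. if j \<in> K then (D (axis i 1) \<bullet> D (axis j 1)) * v $ j else 0)"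
      unfolding matrix_vector_mult_def using True by (auto intro!: sum.cong)
    also have "\<dots> = (\<Sum>j\<in>K. (D (axis i 1) \<bullet> D (axis j 1)) * v $ j)" by (simp add: sum.If_cases)
    also have "\<dots> = D (axis i 1) \<bullet> w" by (simp add: w_def inner_sum_right mult.commute)
    finally show ?thesis using True by simp
  next
    case False
    then show ?thesis by (simp add: matrix_vector_mult_def if_distrib[of "\<lambda>y. y * _"] cong: if_cong)
  qed
  have "v \<bullet> (?A *v v) = (\<Sum>i\<in>UNIV. if i \<in> K then v $ i * (D (axis i 1) \<bullet> w) else v $ i * v $ i)"
    by (auto simp: inner_vec_def Av intro!: sum.cong)
  also have "\<dots> = w \<bullet> w + (\<Sum>i\<in>-K. v $ i * v $ i)"
  proof -
    have "w \<bullet> w = (\<Sum>i\<in>K. v $ i * (D (axis i 1) \<bullet> w))"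
      by (subst (1) w_def) (simp add: inner_sum_left)
    then show ?thesis by (simp add: sum.If_cases Compl_eq)
  qed
  finally have eq: "v \<bullet> (?A *v v) = w \<bullet> w + (\<Sum>i\<in>-K. v $ i * v $ i)" .
  have "v \<bullet> (?A *v v) > 0"
  proof (cases "w = 0")
    case True
    then have "coord_proj K v = 0"
      using slice_chart_injective_derivative[OF c x, of "coord_proj K v"] w unfolding D_def by simp
    then have "\<And>i. i \<in> K \<Longrightarrow> v $ i = 0" by (metis coord_proj_nth zero_index)
    then obtain i where i: "i \<in> -K" "v $ i \<noteq> 0" using v by (auto simp: vec_eq_iff)
    then have "(\<Sum>i\<in>-K. v $ i * v $ i) > 0"
      by (intro sum_pos2[of _ i]) (auto simp: zero_less_mult_iff linorder_neq_iff)
    then show ?thesis using eq True by simp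
  next
    case False
    then have "w \<bullet> w > 0" by simp
    moreover have "(\<Sum>i\<in>-K. v $ i * v $ i) \<ge> 0" by (intro sum_nonneg) auto
    ultimately show ?thesis using eq by linarith
  qed
  then show "v \<bullet> ((\<chi> i j. if i \<in> K \<and> j \<in> K then frechet_derivative \<phi> (at x) (axis i 1) \<bullet> frechet_derivative \<phi> (at x) (axis j 1) else if i = j then 1 else 0) *v v) > 0"
    unfolding D_def .
qed

lemma smooth_on_gram_det:
  fixes \<phi> :: "real^'n::finite \<Rightarrow> real^'n"
  assumes "open V" "smooth_on \<phi> V"
  shows "smooth_on (gram_det K \<phi>) V"
  unfolding gram_det_def[abs_def]
proof (rule smooth_on_det[OF assms(1)])
  fix i j
  show "smooth_on (\<lambda>x. (\<chi> i j. if i \<in> K \<and> j \<in> K then frechet_derivative \<phi> (at x) (axis i 1) \<bullet> frechet_derivative \<phi> (at x) (axis j 1)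
      else if i = j then 1 else 0) $ i $ j) V"
    using smooth_on_inner[OF assms(1) smooth_on_frechet_derivative[OF assms(2)] smooth_on_frechet_derivative[OF assms(2)]]
      smooth_on_const[OF assms(1)]
    by (cases "i \<in> K \<and> j \<in> K") auto
qed

lemma linear_axis_expansion:
  fixes h :: "real^'n::finite \<Rightarrow> 'b::real_normed_vector"
  assumes "bounded_linear h"
  shows "h v = (\<Sum>j\<in>UNIV. v $ j *\<^sub>R h (axis j 1))"
proof -
  have "h v = h (\<Sum>j\<in>UNIV. v $ j *\<^sub>R axis j 1)"
    using basis_expansion[of v] by (simp add: scalar_mult_eq_scaleR)
  also have "\<dots> = (\<Sum>j\<in>UNIV. v $ j *\<^sub>R h (axis j 1))"
    using bounded_linear.linear[OF assms] by (simp add: linear_sum linear_cmul)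
  finally show ?thesis .
qed

text \<open>Hadamard's lemma: the increments of \<open>\<phi>\<close> factor smoothly through these averages, which is what
  makes the rescaled chart smooth at \<open>t = 0\<close>.\<close>

definition avg_deriv :: "(real^'n::finite \<Rightarrow> real^'n) \<Rightarrow> 'n \<Rightarrow> real^'n \<Rightarrow> real^'n \<Rightarrow> real^'n" where
  "avg_deriv \<phi> j a v = integral {0..1} (\<lambda>s. frechet_derivative \<phi> (at (a + s *\<^sub>R v)) (axis j 1))"

text \<open>For \<open>v = 0\<close> the averages are the partial derivatives and this is the matrix
  of \<open>gram_det\<close>; for small \<open>v\<close> it therefore stays invertible. It is not
  symmetric in general.\<close>

definition mixed_gram :: "'n::finite set \<Rightarrow> (real^'n \<Rightarrow> real^'n) \<Rightarrow> real^'n \<Rightarrow> real^'n \<Rightarrow> real^'n^'n" where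
  "mixed_gram K \<phi> a v = (\<chi> i j. if i \<in> K \<and> j \<in> K then avg_deriv \<phi> i a v \<bullet> frechet_derivative \<phi> (at (a + v)) (axis j 1)
     else if i = j then 1 else 0)"

lemma smooth_on_avg_deriv:
  fixes \<phi> :: "real^'n::finite \<Rightarrow> real^'n"
  assumes "open V" "smooth_on \<phi> V" "ball a0 (3 * \<rho>) \<subseteq> V"
  shows "smooth_on (\<lambda>p. avg_deriv \<phi> j (fst p) (snd p)) (ball a0 \<rho> \<times> ball 0 \<rho>)"
  unfolding avg_deriv_def
proof (rule smooth_on_integral)
  \<comment> \<open>With \<open>s\<close> between -2 and 2, an open neighbourhood of
    \<open>{0..1}\<close>, the point \<open>a + s v\<close> lies within
    \<open>\<rho> + 2 * \<rho>\<close> of \<open>a0\<close>; this is the origin of the radius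
    \<open>3 * \<rho>\<close>.\<close>
  show "open (ball a0 \<rho> \<times> ball 0 \<rho>)" "open {-2<..<2::real}" by (auto intro: open_Times)
  then have o: "open ({-2<..<2::real} \<times> ball a0 \<rho> \<times> ball 0 \<rho>)" by (intro open_Times) auto
  show "smooth_on (\<lambda>p. frechet_derivative \<phi> (at (fst (snd p) + fst p *\<^sub>R snd (snd p))) (axis j 1)) ({-2<..<2} \<times> ball a0 \<rho> \<times> ball 0 \<rho>)"
  proof (rule smooth_on_compose[OF o assms(1) _ smooth_on_frechet_derivative[OF assms(2)]])
    show "smooth_on (\<lambda>p. fst (snd p) + fst p *\<^sub>R snd (snd p)) ({-2<..<2} \<times> ball a0 \<rho> \<times> ball 0 \<rho>)"
      by (intro smooth_on_add smooth_on_scaleR o smooth_on_linear)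
        (auto intro!: bounded_linear_fst bounded_linear_snd bounded_linear_compose[OF bounded_linear_fst bounded_linear_snd]
           bounded_linear_compose[OF bounded_linear_snd bounded_linear_snd])
    show "(\<lambda>p. fst (snd p) + fst p *\<^sub>R snd (snd p)) ` ({-2<..<2} \<times> ball a0 \<rho> \<times> ball 0 \<rho>) \<subseteq> V"
    proof (clarsimp)
      fix s :: real and a v :: "real^'n" assume *: "- 2 < s" "s < 2" "dist a0 a < \<rho>" "norm v < \<rho>"
      have "dist a0 (a + s *\<^sub>R v) \<le> dist a0 a + \<bar>s\<bar> * norm v"
        by (metis add_diff_cancel_left' dist_norm dist_commute dist_triangle norm_scaleR)
      also have "\<bar>s\<bar> * norm v \<le> 2 * norm v" using * by (intro mult_right_mono) auto
      finally have "a + s *\<^sub>R v \<in> ball a0 (3 * \<rho>)" using * by auto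
      then show "a + s *\<^sub>R v \<in> V" using assms(3) by blast
    qed
  qed
qed auto

lemma avg_deriv_expansion:
  fixes \<phi> :: "real^'n::finite \<Rightarrow> real^'n"
  assumes V: "open V" "smooth_on \<phi> V" and seg: "\<And>s. s \<in> {0..1} \<Longrightarrow> a + s *\<^sub>R v \<in> V"
  shows "\<phi> (a + v) - \<phi> a = (\<Sum>j\<in>UNIV. v $ j *\<^sub>R avg_deriv \<phi> j a v)"
proof -
  define D where "D = (\<lambda>s w. frechet_derivative \<phi> (at (a + s *\<^sub>R v)) w)"
  have d: "(\<phi> has_derivative D s) (at (a + s *\<^sub>R v))" if "s \<in> {0..1}" for s
    unfolding D_def by (rule smooth_on_has_derivative[OF V(2) seg[OF that]])
  have "((\<lambda>s. \<phi> (a + s *\<^sub>R v)) has_vector_derivative D s v) (at s within {0..1})" if s: "s \<in> {0..1}" for s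
  proof -
    have "((\<lambda>s. \<phi> (a + s *\<^sub>R v)) has_derivative (\<lambda>r. D s (r *\<^sub>R v))) (at s)"
      by (rule has_derivative_compose[of "\<lambda>s. a + s *\<^sub>R v" "\<lambda>r. r *\<^sub>R v" s UNIV \<phi>, OF _ d[OF s]])
        (auto intro!: derivative_eq_intros)
    moreover have "D s (r *\<^sub>R v) = r *\<^sub>R D s v" for r
      using linear_cmul[OF has_derivative_linear[OF d[OF s]]] .
    ultimately show ?thesis
      unfolding has_vector_derivative_def by (metis (no_types, lifting) ext has_derivative_at_withinI)
  qed
  then have "((\<lambda>s. D s v) has_integral (\<phi> (a + 1 *\<^sub>R v) - \<phi> (a + 0 *\<^sub>R v))) {0..1}"
    by (intro fundamental_theorem_of_calculus) auto
  then have 1: "integral {0..1} (\<lambda>s. D s v) = \<phi> (a + v) - \<phi> a" by (simp add: integral_unique)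
  have cont: "continuous_on {0..1} (\<lambda>s. D s (axis j 1))" for j
    unfolding D_def
    by (rule continuous_on_compose2[OF smooth_on_imp_continuous_on[OF smooth_on_frechet_derivative[OF V(2)]]])
      (use seg in \<open>auto intro!: continuous_intros\<close>)
  have "integral {0..1} (\<lambda>s. D s v) = integral {0..1} (\<lambda>s. \<Sum>j\<in>UNIV. v $ j *\<^sub>R D s (axis j 1))"
    by (intro integral_cong linear_axis_expansion has_derivative_bounded_linear[OF d])
  also have "\<dots> = (\<Sum>j\<in>UNIV. integral {0..1} (\<lambda>s. v $ j *\<^sub>R D s (axis j 1)))"
    by (rule integral_sum) (auto intro!: integrable_continuous_real continuous_intros cont)
  also have "\<dots> = (\<Sum>j\<in>UNIV. v $ j *\<^sub>R avg_deriv \<phi> j a v)"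
    by (simp add: avg_deriv_def D_def)
  finally show ?thesis using 1 by simp
qed

lemma avg_deriv_zero: "avg_deriv \<phi> j a 0 = frechet_derivative \<phi> (at a) (axis j 1)"
  by (simp add: avg_deriv_def)

text \<open>On the ball of radius \<open>r\<close> the inverse chart is defined and
  \<Lambda>-Lipschitz, which bounds \<open>u\<close> by \<Lambda> times the length of the rescaled
  chart and so confines the sublevel sets. The radius \<rho> is small enough for
  \<open>a + t u\<close> to stay in \<open>V\<close> and, by \<open>nondeg\<close>, for the linear
  system defining the field to be solvable.\<close>

locale local_chart =
  fixes m :: nat and M :: "(real^'n::finite) set" and K V \<phi> a0 and \<rho> r \<Lambda> :: real
  assumes chart: "slice_chart m M K V \<phi>"
    and a0: "a0 \<in> coord_subspace K" and \<rho>: "\<rho> > 0" and ball_V: "ball a0 (3 * \<rho>) \<subseteq> V"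
    and r: "r > 0" and image_ball: "\<phi> ` ball a0 (3 * \<rho>) \<subseteq> cball (\<phi> a0) r" and cball_image: "cball (\<phi> a0) r \<subseteq> \<phi> ` V"
    and \<Lambda>: "\<Lambda> > 0"
    and lip: "\<And>y y'. y \<in> cball (\<phi> a0) r \<Longrightarrow> y' \<in> cball (\<phi> a0) r \<Longrightarrow>
       norm (inv_into V \<phi> y - inv_into V \<phi> y') \<le> \<Lambda> * norm (y - y')"
    and nondeg: "\<And>a v. a \<in> ball a0 \<rho> \<Longrightarrow> norm v < \<rho> \<Longrightarrow> det (mixed_gram K \<phi> a v) \<noteq> 0"
begin

lemma V: "open V" "smooth_on \<phi> V" using chart by (auto simp: slice_chart_def)

text \<open>For \<open>t \<noteq> 0\<close> this equals
  \<open>(\<phi> (a + t u) - \<phi> a) / t\<close> on \<open>dom\<close>; the formula avoids the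
  division, and at \<open>t = 0\<close> it is the derivative of \<phi> at \<open>a\<close> applied
  to \<open>u\<close>.\<close>

definition f :: "(real^'n) \<times> real \<times> (real^'n) \<Rightarrow> real^'n" where
  "f p = (\<Sum>j\<in>UNIV. snd (snd p) $ j *\<^sub>R avg_deriv \<phi> j (fst p) (fst (snd p) *\<^sub>R snd (snd p)))"

definition F where "F p = f p \<bullet> f p"

definition dom :: "((real^'n) \<times> real \<times> (real^'n)) set" where
  "dom = {p. fst p \<in> ball a0 \<rho> \<and> fst (snd p) *\<^sub>R snd (snd p) \<in> ball 0 \<rho>}"

definition rhs where
  "rhs i p = (if i \<in> K then avg_deriv \<phi> i (fst p) (fst (snd p) *\<^sub>R snd (snd p)) \<bullet> frechet_derivative f (at p) (0, 1, 0) else 0)"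

abbreviation "N p \<equiv> mixed_gram K \<phi> (fst p) (fst (snd p) *\<^sub>R snd (snd p))"

text \<open>Cramer's rule for the system \<open>N Y = rhs\<close>, with \<open>X = - Y\<close>. Since \<open>f\<close> is a combination of the vectors
  \<open>avg_deriv \<phi> i\<close> with \<open>i \<in> K\<close>, this system forces the derivative of \<open>|f|^2\<close> along \<open>(1, X)\<close> to vanish.\<close>

definition X :: "'n \<Rightarrow> (real^'n) \<times> real \<times> (real^'n) \<Rightarrow> real" where
  "X k p = - (det (\<chi> i j. if j = k then rhs i p else N p $ i $ j) * inverse (det (N p)))"

definition J0 :: "(real^'n) \<times> real \<times> (real^'n) \<Rightarrow> real" where
  "J0 p = sqrt (gram_det K \<phi> (fst p + fst (snd p) *\<^sub>R snd (snd p)))"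

lemma open_dom: "open dom"
proof -
  have "dom = (\<lambda>p. (fst p, fst (snd p) *\<^sub>R snd (snd p))) -` (ball a0 \<rho> \<times> ball 0 \<rho>)"
    by (auto simp: dom_def)
  then show ?thesis by (auto intro!: open_vimage open_Times continuous_intros)
qed

lemma smooth_tu: "smooth_on (\<lambda>p. fst (snd p) *\<^sub>R snd (snd p)) dom"
  by (intro smooth_on_scaleR open_dom smooth_on_linear bounded_linear_compose[OF bounded_linear_fst bounded_linear_snd]
      bounded_linear_compose[OF bounded_linear_snd bounded_linear_snd])

lemma smooth_L: "smooth_on (\<lambda>p. avg_deriv \<phi> j (fst p) (fst (snd p) *\<^sub>R snd (snd p))) dom"
proof -
  have "smooth_on (\<lambda>p. (\<lambda>q. avg_deriv \<phi> j (fst q) (snd q)) (fst p, fst (snd p) *\<^sub>R snd (snd p))) dom"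
  proof (rule smooth_on_compose[OF open_dom _ _ smooth_on_avg_deriv[OF V ball_V]])
    show "smooth_on (\<lambda>p. (fst p, fst (snd p) *\<^sub>R snd (snd p))) dom"
      by (intro smooth_on_Pair open_dom smooth_tu smooth_on_linear bounded_linear_fst)
  qed (auto intro!: open_Times simp: dom_def)
  then show ?thesis by simp
qed

lemma smooth_f: "smooth_on f dom"
  unfolding f_def
  by (intro smooth_on_sum smooth_on_scaleR smooth_L open_dom smooth_on_linear)
    (rule bounded_linear_compose[OF bounded_linear_vec_nth bounded_linear_compose[OF bounded_linear_snd bounded_linear_snd]])

lemma smooth_F: "smooth_on F dom"
  unfolding F_def[abs_def] by (intro smooth_on_inner smooth_f open_dom)

lemma av_in_V: "a \<in> ball a0 \<rho> \<Longrightarrow> norm v < \<rho> \<Longrightarrow> s \<in> {0..1} \<Longrightarrow> a + s *\<^sub>R v \<in> ball a0 (3 * \<rho>)"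
proof -
  assume *: "a \<in> ball a0 \<rho>" "norm v < \<rho>" "s \<in> {0..1}"
  have "dist a0 (a + s *\<^sub>R v) \<le> dist a0 a + \<bar>s\<bar> * norm v"
    by (metis add_diff_cancel_left' dist_norm dist_commute dist_triangle norm_scaleR)
  also have "\<bar>s\<bar> * norm v \<le> 1 * norm v" using * by (intro mult_right_mono) auto
  finally show ?thesis using * \<rho> by auto
qed

lemma av_in_V1: "a \<in> ball a0 \<rho> \<Longrightarrow> norm v < \<rho> \<Longrightarrow> a + v \<in> ball a0 (3 * \<rho>)"
  using av_in_V[of a v 1] by simp

lemma smooth_shift:
  assumes "smooth_on h V" shows "smooth_on (\<lambda>p. h (fst p + fst (snd p) *\<^sub>R snd (snd p))) dom"
proof (rule smooth_on_compose[OF open_dom V(1) _ assms])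
  show "(\<lambda>p. fst p + fst (snd p) *\<^sub>R snd (snd p)) ` dom \<subseteq> V"
    using av_in_V1 ball_V by (auto simp: dom_def)
qed (intro smooth_on_add smooth_tu smooth_on_linear open_dom bounded_linear_fst)

lemma smooth_N: "smooth_on (\<lambda>p. N p $ i $ j) dom"
  using smooth_on_inner[OF open_dom smooth_L[of i] smooth_shift[OF smooth_on_frechet_derivative[OF V(2)]], of "axis j 1"]
    smooth_on_const[OF open_dom]
  by (cases "i \<in> K \<and> j \<in> K") (auto simp: mixed_gram_def)

lemma smooth_rhs: "smooth_on (rhs i) dom"
  using smooth_on_inner[OF open_dom smooth_L[of i] smooth_on_frechet_derivative[OF smooth_f]]
    smooth_on_const[OF open_dom]
  by (cases "i \<in> K") (auto simp: rhs_def[abs_def])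

lemma smooth_X: "smooth_on (X k) dom"
  unfolding X_def[abs_def]
proof (intro smooth_on_minus smooth_on_mult smooth_on_inverse smooth_on_det open_dom smooth_N)
  show "smooth_on (\<lambda>p. (\<chi> i j. if j = k then rhs i p else N p $ i $ j) $ i $ j) dom" for i j
    using smooth_rhs smooth_N by (cases "j = k") auto
  show "\<And>p. p \<in> dom \<Longrightarrow> det (N p) \<noteq> 0" using nondeg by (auto simp: dom_def)
qed

lemma smooth_J0: "smooth_on J0 dom"
  unfolding J0_def[abs_def]
proof (rule smooth_on_sqrt[OF open_dom _ smooth_shift[OF smooth_on_gram_det[OF V]]])
  fix p assume "p \<in> dom"
  then show "gram_det K \<phi> (fst p + fst (snd p) *\<^sub>R snd (snd p)) > 0"
    using av_in_V1 ball_V by (intro gram_det_pos[OF chart]) (auto simp: dom_def)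
qed

lemma f_eq:
  assumes "(a, t, u) \<in> dom" shows "t *\<^sub>R f (a, t, u) = \<phi> (a + t *\<^sub>R u) - \<phi> a"
proof -
  have "\<phi> (a + t *\<^sub>R u) - \<phi> a = (\<Sum>j\<in>UNIV. (t *\<^sub>R u) $ j *\<^sub>R avg_deriv \<phi> j a (t *\<^sub>R u))"
    by (rule avg_deriv_expansion[OF V]) (use assms ball_V av_in_V[of a "t *\<^sub>R u"] in \<open>auto simp: dom_def\<close>)
  then show ?thesis by (simp add: f_def scaleR_sum_right)
qed

lemma f_vector_derivative:
  assumes "(a, t, u) \<in> dom"
  shows "((\<lambda>s. f (a, t, u + s *\<^sub>R e)) has_vector_derivative frechet_derivative f (at (a, t, u)) (0, 0, e)) (at 0)"
proof -
  have dJ: "(f has_derivative frechet_derivative f (at (a, t, u))) (at (a, t, u + 0 *\<^sub>R e))"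
    using smooth_on_has_derivative[OF smooth_f assms] by simp
  have "((\<lambda>s. f (a, t, u + s *\<^sub>R e)) has_derivative (\<lambda>s. frechet_derivative f (at (a, t, u)) (0, 0, s *\<^sub>R e))) (at 0)"
    by (rule has_derivative_compose[of "\<lambda>s. (a, t, u + s *\<^sub>R e)" "\<lambda>s. (0, 0, s *\<^sub>R e)" 0 UNIV f, OF _ dJ])
      (auto intro!: has_derivative_Pair derivative_eq_intros)
  moreover have eq: "frechet_derivative f (at (a, t, u)) (0, 0, s *\<^sub>R e) = s *\<^sub>R frechet_derivative f (at (a, t, u)) (0, 0, e)" for s
    using linear_cmul[OF has_derivative_linear[OF dJ], of s "(0, 0, e)"] by simp
  ultimately show ?thesis
    by (subst has_vector_derivative_def) (rule has_derivative_eq_rhs[OF _ ext[OF eq]])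
qed

text \<open>For \<open>t \<noteq> 0\<close> the factor \<open>t\<close> from the chain rule cancels
  the division by \<open>t\<close>; at \<open>t = 0\<close> the map is linear in \<open>u\<close>,
  so its increments can be read off.\<close>

lemma f_deriv_u:
  assumes dom: "(a, t, u) \<in> dom"
  shows "frechet_derivative f (at (a, t, u)) (0, 0, axis i 1) = frechet_derivative \<phi> (at (a + t *\<^sub>R u)) (axis i 1)"
proof (cases "t = 0")
  case True
  have "f (a, 0, u + s *\<^sub>R axis i 1) = f (a, 0, u) + s *\<^sub>R frechet_derivative \<phi> (at a) (axis i 1)" for s
    by (simp add: f_def avg_deriv_zero scaleR_left_distrib sum.distrib axis_def if_distrib[of "\<lambda>x. x *\<^sub>R _"]
        if_distrib[of "\<lambda>x. _ * x"] cong: if_cong)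
  then have "((\<lambda>s. f (a, 0, u + s *\<^sub>R axis i 1)) has_vector_derivative frechet_derivative \<phi> (at a) (axis i 1)) (at 0)"
    by (auto intro!: derivative_eq_intros simp: has_vector_derivative_def)
  then show ?thesis
    using vector_derivative_unique_at[OF f_vector_derivative[OF dom]] True by simp
next
  case False
  let ?e = "axis i 1"
  have d\<phi>: "(\<phi> has_derivative frechet_derivative \<phi> (at (a + t *\<^sub>R u))) (at (a + t *\<^sub>R (u + 0 *\<^sub>R ?e)))"
    using smooth_on_has_derivative[OF V(2), of "a + t *\<^sub>R u"] av_in_V1[of a "t *\<^sub>R u"] ball_V dom by (auto simp: dom_def)
  have 1: "((\<lambda>s. \<phi> (a + t *\<^sub>R (u + s *\<^sub>R ?e))) has_derivative (\<lambda>s. frechet_derivative \<phi> (at (a + t *\<^sub>R u)) (t *\<^sub>R (s *\<^sub>R ?e)))) (at 0)"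
    by (rule has_derivative_compose[of "\<lambda>s. a + t *\<^sub>R (u + s *\<^sub>R ?e)" "\<lambda>s. t *\<^sub>R (s *\<^sub>R ?e)" 0 UNIV \<phi>, OF _ d\<phi>])
      (auto intro!: derivative_eq_intros)
  have eq: "(1 / t) *\<^sub>R (frechet_derivative \<phi> (at (a + t *\<^sub>R u)) (t *\<^sub>R (s *\<^sub>R ?e)) - 0) = s *\<^sub>R frechet_derivative \<phi> (at (a + t *\<^sub>R u)) ?e" for s
    using linear_cmul[OF has_derivative_linear[OF d\<phi>], of "t * s" ?e] False by simp
  have 2: "((\<lambda>s. (1 / t) *\<^sub>R (\<phi> (a + t *\<^sub>R (u + s *\<^sub>R ?e)) - \<phi> a)) has_vector_derivative frechet_derivative \<phi> (at (a + t *\<^sub>R u)) ?e) (at 0)"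
    unfolding has_vector_derivative_def
    by (rule has_derivative_eq_rhs[OF has_derivative_scaleR_right[OF has_derivative_diff[OF 1 has_derivative_const]] ext[OF eq]])
  define S where "S = (\<lambda>s. (a, t, u + s *\<^sub>R ?e)) -` dom"
  have S: "open S" "0 \<in> S"
    unfolding S_def using dom by (auto intro!: open_vimage open_dom continuous_intros)
  have "((\<lambda>s. f (a, t, u + s *\<^sub>R ?e)) has_vector_derivative frechet_derivative \<phi> (at (a + t *\<^sub>R u)) ?e) (at 0)"
  proof (rule has_vector_derivative_transform_within_open[OF 2 S])
    fix s assume "s \<in> S"
    then have "\<phi> (a + t *\<^sub>R (u + s *\<^sub>R ?e)) - \<phi> a = t *\<^sub>R f (a, t, u + s *\<^sub>R ?e)"
      by (simp add: f_eq S_def)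
    then show "(1 / t) *\<^sub>R (\<phi> (a + t *\<^sub>R (u + s *\<^sub>R ?e)) - \<phi> a) = f (a, t, u + s *\<^sub>R ?e)"
      using False by simp
  qed
  then show ?thesis
    using vector_derivative_unique_at[OF f_vector_derivative[OF dom]] by simp
qed

lemma F_deriv:
  assumes "p \<in> dom" shows "frechet_derivative F (at p) v = 2 * (f p \<bullet> frechet_derivative f (at p) v)"
proof -
  have d: "(f has_derivative frechet_derivative f (at p)) (at p)" by (rule smooth_on_has_derivative[OF smooth_f assms])
  have "(F has_derivative (\<lambda>v. f p \<bullet> frechet_derivative f (at p) v + frechet_derivative f (at p) v \<bullet> f p)) (at p)"
    unfolding F_def[abs_def] by (rule has_derivative_inner[OF d d])
  from fun_cong[OF frechet_derivative_at[OF this, symmetric], of v]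
  show ?thesis by (simp add: inner_commute)
qed

lemma transport_identity:
  assumes p: "(a, t, u) \<in> dom" and u: "u \<in> coord_subspace K"
  shows "frechet_derivative F (at (a, t, u)) (0, 1, 0)
        + (\<Sum>i\<in>K. X i (a, t, u) * frechet_derivative F (at (a, t, u)) (0, 0, axis i 1)) = 0"
proof -
  let ?p = "(a, t, u)"
  define Y where "Y = (\<chi> k. - X k ?p)"
  define L where "L = (\<lambda>i. avg_deriv \<phi> i a (t *\<^sub>R u))"
  define ft where "ft = frechet_derivative f (at ?p) (0, 1, 0)"
  define E where "E = (\<lambda>j. frechet_derivative \<phi> (at (a + t *\<^sub>R u)) (axis j 1))"
  define W where "W = (\<Sum>j\<in>K. Y $ j *\<^sub>R E j)"
  have "det (N ?p) \<noteq> 0" using nondeg p by (auto simp: dom_def)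
  then have NY: "N ?p *v Y = (\<chi> i. rhs i ?p)"
    by (subst cramer) (auto simp: Y_def X_def divide_inverse vec_eq_iff intro!: arg_cong[where f=det])
  \<comment> \<open>Row \<open>i\<close> of the Cramer system says that \<open>W - ft\<close> is
    orthogonal to \<open>L i\<close>.\<close>
  have LW: "L i \<bullet> W = L i \<bullet> ft" if i: "i \<in> K" for i
  proof -
    have "(N ?p *v Y) $ i = (\<Sum>j\<in>UNIV. if j \<in> K then (L i \<bullet> E j) * Y $ j else 0)"
      unfolding matrix_vector_mult_def using i by (auto simp: mixed_gram_def L_def E_def intro!: sum.cong)
    also have "\<dots> = (\<Sum>j\<in>K. (L i \<bullet> E j) * Y $ j)" by (simp add: sum.If_cases)
    also have "\<dots> = L i \<bullet> W" by (simp add: W_def inner_sum_right mult.commute)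
    finally show ?thesis using NY i by (simp add: rhs_def L_def ft_def)
  qed
  \<comment> \<open>Here \<open>u\<close> has to lie in the slice: its coordinates outside
    \<open>K\<close> vanish, and \<open>f\<close> combines exactly the vectors that the system
    controls.\<close>
  have fp: "f ?p = (\<Sum>i\<in>K. u $ i *\<^sub>R L i)"
    unfolding f_def L_def using u
    by (simp, intro sum.mono_neutral_right) (auto simp: coord_subspace_def)
  have "f ?p \<bullet> W = f ?p \<bullet> ft"
    unfolding fp by (simp add: inner_sum_left LW)
  moreover have "frechet_derivative F (at ?p) (0, 1, 0) = 2 * (f ?p \<bullet> ft)"
    by (simp add: F_deriv[OF p] ft_def)
  moreover have "(\<Sum>i\<in>K. X i ?p * frechet_derivative F (at ?p) (0, 0, axis i 1)) = - 2 * (f ?p \<bullet> W)"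
    by (simp add: F_deriv[OF p] f_deriv_u[OF p] W_def E_def Y_def inner_sum_right sum_distrib_left sum_negf mult_ac)
  ultimately show ?thesis by simp
qed

text \<open>For \<open>norm u \<ge> R / 2 = 2 * \<Lambda>\<close> the bound \<open>F_lower\<close>
  yields \<open>F \<ge> 4\<close>, more than \<open>large\<close> asks for. The value of
  \<open>d\<close> makes \<open>t u\<close> at most \<open>\<rho> / 2\<close> long, and the base
  points in \<open>P\<close> keep the same distance from \<open>a0\<close>.\<close>

definition R where "R = 4 * \<Lambda>"
definition d where "d = \<rho> / (2 * R)"
definition P where "P = coord_subspace K \<inter> cball a0 (\<rho> / 2)"

lemma R_pos: "R > 0" and d_pos: "d > 0" using \<Lambda> \<rho> by (auto simp: R_def d_def)

lemma tu_bound: "\<bar>t\<bar> \<le> d \<Longrightarrow> norm u \<le> R \<Longrightarrow> norm (t *\<^sub>R u) \<le> \<rho> / 2"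
proof -
  assume "\<bar>t\<bar> \<le> d" "norm u \<le> R"
  then have "\<bar>t\<bar> * norm u \<le> d * R" using d_pos by (intro mult_mono) auto
  also have "\<dots> = \<rho> / 2" using R_pos by (simp add: d_def)
  finally show ?thesis by simp
qed

lemma in_dom': "a \<in> P \<Longrightarrow> \<bar>t\<bar> \<le> d \<Longrightarrow> norm u \<le> R \<Longrightarrow> (a, t, u) \<in> dom"
  using tu_bound[of t u] \<rho> by (auto simp: dom_def P_def)

text \<open>The Lipschitz bound of the inverse chart between the images of \<open>a + t u\<close>
  and \<open>a\<close>, divided by \<open>\<bar>t\<bar>\<close>.\<close>

lemma F_lower_nonzero:
  assumes p: "(a, t, u) \<in> dom" and t: "t \<noteq> 0"
  shows "(norm u)\<^sup>2 \<le> \<Lambda>\<^sup>2 * F (a, t, u)"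
proof -
  have a: "a \<in> ball a0 \<rho>" "norm (t *\<^sub>R u) < \<rho>" using p by (auto simp: dom_def)
  have b: "a + t *\<^sub>R u \<in> ball a0 (3 * \<rho>)" "a \<in> ball a0 (3 * \<rho>)"
    using av_in_V1[OF a] av_in_V1[OF a(1), of 0] \<rho> by auto
  have bV: "a + t *\<^sub>R u \<in> V" "a \<in> V" using b ball_V by blast+
  have "norm ((a + t *\<^sub>R u) - a) \<le> \<Lambda> * norm (\<phi> (a + t *\<^sub>R u) - \<phi> a)"
    using lip[of "\<phi> (a + t *\<^sub>R u)" "\<phi> a"] image_ball b
      slice_chart_left_inverse[OF chart bV(1)] slice_chart_left_inverse[OF chart bV(2)]
    by (auto simp: image_subset_iff)
  then have "\<bar>t\<bar> * norm u \<le> \<bar>t\<bar> * (\<Lambda> * norm (f (a, t, u)))"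
    by (simp add: f_eq[OF p, symmetric] mult_ac)
  then have "norm u \<le> \<Lambda> * norm (f (a, t, u))" using t by simp
  then have "(norm u)\<^sup>2 \<le> (\<Lambda> * norm (f (a, t, u)))\<^sup>2" by (intro power_mono) auto
  then show ?thesis by (simp add: F_def power_mult_distrib dot_square_norm)
qed

text \<open>The estimate just obtained says nothing at \<open>t = 0\<close>, where it is recovered
  as a limit by continuity of \<open>F\<close>.\<close>

lemma F_lower:
  assumes a: "a \<in> P" and t: "\<bar>t\<bar> \<le> d" and u: "norm u \<le> R"
  shows "(norm u)\<^sup>2 \<le> \<Lambda>\<^sup>2 * F (a, t, u)"
proof (cases "t = 0")
  case True
  have c: "isCont (\<lambda>t. F (a, t, u)) 0"
  proof -
    have "continuous_on {-d<..<d} (\<lambda>t. F (a, t, u))"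
      by (rule continuous_on_compose2[OF smooth_on_imp_continuous_on[OF smooth_F]])
        (use in_dom'[OF a _ u] in \<open>auto intro!: continuous_intros simp: abs_le_iff\<close>)
    then show ?thesis using d_pos by (simp add: continuous_on_eq_continuous_at)
  qed
  have "((\<lambda>t. \<Lambda>\<^sup>2 * F (a, t, u)) \<longlongrightarrow> \<Lambda>\<^sup>2 * F (a, 0, u)) (at 0)"
    using c by (intro tendsto_mult tendsto_const) (simp add: isCont_def)
  moreover have "\<forall>\<^sub>F t in at 0. (norm u)\<^sup>2 \<le> \<Lambda>\<^sup>2 * F (a, t, u)"
    unfolding eventually_at
    using F_lower_nonzero in_dom'[OF a _ u] d_pos by (intro exI[of _ d]) (auto simp: dist_real_def)
  ultimately show ?thesis
    using True by (metis tendsto_lowerbound trivial_limit_at)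
next
  case False
  then show ?thesis using F_lower_nonzero in_dom' assms by blast
qed

sublocale reynolds K P F X dom d R
proof
  show "open dom" by (rule open_dom)
  show "compact P" unfolding P_def by (intro closed_Int_compact closed_coord_subspace) auto
  show "P \<times> {- d..d} \<times> cball 0 R \<subseteq> dom" using in_dom' by (auto simp: abs_le_iff)
  show "smooth_on F dom" by (rule smooth_F)
  show "smooth_on (X i) dom" for i by (rule smooth_X)
  show "0 < R" "0 < d" by (rule R_pos d_pos)+
next
  fix a t u assume "a \<in> P" "\<bar>t\<bar> \<le> d" "norm u \<le> R" "u \<in> coord_subspace K"
  then show "frechet_derivative F (at (a, t, u)) (0, 1, 0)
        + (\<Sum>i\<in>K. X i (a, t, u) * frechet_derivative F (at (a, t, u)) (0, 0, axis i 1)) = 0"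
    using transport_identity in_dom' by blast
next
  fix a t and u :: "real^'n" assume *: "a \<in> P" "\<bar>t\<bar> \<le> d" "norm u \<le> R" "R / 2 \<le> norm u"
  have "(R / 2)\<^sup>2 \<le> (norm u)\<^sup>2" using * R_pos by (intro power_mono) auto
  with F_lower[OF *(1-3)] have "4 * \<Lambda>\<^sup>2 \<le> \<Lambda>\<^sup>2 * F (a, t, u)" by (simp add: R_def power2_eq_square)
  then have "4 \<le> F (a, t, u)" using \<Lambda> by (simp add: mult.commute)
  then show "2 \<le> F (a, t, u)" by simp
qed

end

section \<open>Volume of small balls and its derivatives in the radius\<close>

context local_chart
begin

lemma G_even:
  assumes a: "a \<in> P" and t: "\<bar>t\<bar> \<le> d"
  shows "G J0 a (- t) = G J0 a t"
proof -
  have ev: "F (a, - t, u) = F (a, t, - u)" "J0 (a, - t, u) = J0 (a, t, - u)" for u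
    by (simp_all add: F_def f_def J0_def sum_negf)
  let ?h = "\<lambda>u. indicator (cball 0 R) u * (indicator {..1} (F (a, t, u)) * J0 (a, t, u))"
  have "(\<integral>u. ?h u \<partial>coord_lborel K) = \<bar>-1\<bar> ^ card K * (\<integral>u. ?h (0 + (-1) *\<^sub>R u) \<partial>coord_lborel K)"
    by (rule integral_coord_lborel_affine) (use meas_G[OF smooth_on_imp_continuous_on[OF smooth_J0] a t] in \<open>auto simp: coord_subspace_def\<close>)
  then show ?thesis by (simp add: G_def ev indicator_def)
qed

lemma smooth_transp_power: "smooth_on ((transp ^^ k) J0) dom"
  by (induction k) (auto intro: smooth_J0 smooth_transp)

lemma deriv_chain_G: "\<exists>C. \<forall>a\<in>P. deriv_chain d C 0 (\<lambda>k. G ((transp ^^ k) J0) a)"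
proof -
  have "\<forall>k. \<exists>C. \<forall>a t. a \<in> P \<longrightarrow> \<bar>t\<bar> \<le> d \<longrightarrow> \<bar>G ((transp ^^ k) J0) a t\<bar> \<le> C"
    using H_bound[OF smooth_transp_power] by metis
  then obtain C where C: "\<And>k a t. a \<in> P \<Longrightarrow> \<bar>t\<bar> \<le> d \<Longrightarrow> \<bar>G ((transp ^^ k) J0) a t\<bar> \<le> C k" by metis
  have "deriv_chain d C 0 (\<lambda>k. G ((transp ^^ k) J0) a)" if a: "a \<in> P" for a
  proof (rule deriv_chain_even)
    fix k t assume t: "\<bar>t\<bar> < d"
    show "(G ((transp ^^ k) J0) a has_real_derivative G ((transp ^^ Suc k) J0) a t) (at t)"
      using DERIV_G[OF smooth_transp_power a t] by simp
    show "\<bar>G ((transp ^^ k) J0) a t\<bar> \<le> C k" using C a t by simp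
  next
    fix t assume "\<bar>t\<bar> < d"
    then show "G ((transp ^^ 0) J0) a (- t) = G ((transp ^^ 0) J0) a t" using G_even a by simp
  qed
  then show ?thesis by blast
qed

text \<open>Substituting \<open>v = a + t u\<close> on the slice contributes the factor
  \<open>t ^ m\<close>. Since \<open>x\<close> is within \<open>r / 2\<close> of the centre and
  \<open>t \<le> r / 2\<close>, the ball lies in \<open>cball (\<phi> a0) r\<close>, so this single
  chart sees all of \<open>M \<inter> cball x t\<close>.\<close>

lemma ball_measure:
  assumes vol: "is_riemannian_volume m M \<mu>" and a: "a \<in> P" and x: "x = \<phi> a" "dist (\<phi> a0) x \<le> r / 2"
    and t: "0 < t" "t \<le> d" "t \<le> r / 2"
  shows "emeasure \<mu> (M \<inter> cball x t) = ennreal (t ^ m * G J0 a t)" "measure \<mu> (M \<inter> cball x t) = t ^ m * G J0 a t"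
proof -
  note ch = chart[unfolded slice_chart_def]
  have aV: "a \<in> V" "a \<in> coord_subspace K" "a \<in> ball a0 \<rho>"
    using a ball_V \<rho> by (auto simp: P_def subset_iff)
  define A where "A = {v \<in> V \<inter> coord_subspace K. \<phi> v \<in> cball x t}"
  have A_borel: "A \<in> sets borel"
  proof -
    have "open (V \<inter> \<phi> -` (- cball x t))"
      using smooth_on_imp_continuous_on[OF V(2)] V(1) by (intro continuous_open_preimage) auto
    moreover have "A = (V - (V \<inter> \<phi> -` (- cball x t))) \<inter> coord_subspace K"
      by (auto simp: A_def)
    ultimately show ?thesis using V(1) closed_coord_subspace[of K] by (auto intro!: sets.Int borel_closed)
  qed
  have image: "M \<inter> cball x t = \<phi> ` A"
  proof
    show "\<phi> ` A \<subseteq> M \<inter> cball x t" using ch by (auto simp: A_def)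
    show "M \<inter> cball x t \<subseteq> \<phi> ` A"
    proof
      fix y assume y: "y \<in> M \<inter> cball x t"
      have "dist (\<phi> a0) y \<le> r" using y x(2) t(3) dist_triangle[of "\<phi> a0" y x] by auto
      then have "y \<in> \<phi> ` V \<inter> M" using cball_image y by auto
      then have "y \<in> \<phi> ` (V \<inter> coord_subspace K)" using ch by blast
      then show "y \<in> \<phi> ` A" using y by (auto simp: A_def)
    qed
  qed
  \<comment> \<open>Membership in \<open>A\<close> already forces
    \<open>norm u \<le> \<Lambda>\<close>, hence \<open>norm u \<le> R\<close>, by the Lipschitz
    bound: the ball of radius \<open>R\<close> in the definition of \<open>G\<close> discards
    nothing.\<close>
  have char: "a + t *\<^sub>R u \<in> A \<longleftrightarrow> norm u \<le> R \<and> F (a, t, u) \<le> 1" if u: "u \<in> coord_subspace K" for u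
  proof
    assume *: "a + t *\<^sub>R u \<in> A"
    have 1: "norm (\<phi> (a + t *\<^sub>R u) - \<phi> a) \<le> t" "a + t *\<^sub>R u \<in> V"
      using * by (auto simp: A_def x dist_norm norm_minus_commute)
    have "dist (\<phi> a0) (\<phi> (a + t *\<^sub>R u)) \<le> r"
      using 1 x t(3) dist_triangle[of "\<phi> a0" "\<phi> (a + t *\<^sub>R u)" x] by (auto simp: dist_norm norm_minus_commute)
    moreover have "dist (\<phi> a0) (\<phi> a) \<le> r" using x r by simp
    ultimately have "norm ((a + t *\<^sub>R u) - a) \<le> \<Lambda> * norm (\<phi> (a + t *\<^sub>R u) - \<phi> a)"
      using lip[of "\<phi> (a + t *\<^sub>R u)" "\<phi> a"] slice_chart_left_inverse[OF chart 1(2)] slice_chart_left_inverse[OF chart aV(1)]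
      by simp
    also have "\<dots> \<le> \<Lambda> * t" using 1 \<Lambda> by (intro mult_left_mono) auto
    finally have "t * norm u \<le> t * \<Lambda>" using t by (simp add: mult.commute)
    then have "norm u \<le> \<Lambda>" using t by simp
    then have nR: "norm u \<le> R" using \<Lambda> by (simp add: R_def)
    have "norm (t *\<^sub>R f (a, t, u)) \<le> t"
      using f_eq[OF in_dom'[OF a _ nR]] 1 t by simp
    then have "norm (f (a, t, u)) \<le> 1" using t by simp
    then have "(norm (f (a, t, u)))\<^sup>2 \<le> 1" by (rule power_le_one[OF norm_ge_zero])
    then show "norm u \<le> R \<and> F (a, t, u) \<le> 1" using nR by (simp add: F_def dot_square_norm)
  next
    assume *: "norm u \<le> R \<and> F (a, t, u) \<le> 1"
    then have dom: "(a, t, u) \<in> dom" using in_dom' a t by auto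
    have "(norm (f (a, t, u)))\<^sup>2 \<le> 1\<^sup>2" using * by (simp add: F_def dot_square_norm)
    then have "norm (f (a, t, u)) \<le> 1" by (rule power2_le_imp_le) simp
    then have "norm (t *\<^sub>R f (a, t, u)) \<le> t" using t by simp
    then have "\<phi> (a + t *\<^sub>R u) \<in> cball x t"
      using f_eq[OF dom] by (simp add: x dist_norm norm_minus_commute)
    moreover have "a + t *\<^sub>R u \<in> V"
      using av_in_V1[of a "t *\<^sub>R u"] dom ball_V by (auto simp: dom_def)
    moreover have "a + t *\<^sub>R u \<in> coord_subspace K" using aV(2) u by (simp add: coord_subspace_def)
    ultimately show "a + t *\<^sub>R u \<in> A" by (simp add: A_def)
  qed
  have card: "card K = m" using ch by simp
  let ?h = "\<lambda>u. indicator (cball 0 R) u * (indicator {..1} (F (a, t, u)) * J0 (a, t, u))"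
  have tt: "\<bar>t\<bar> \<le> d" using t by simp
  note mh = meas_G[OF smooth_on_imp_continuous_on[OF smooth_J0] a tt]
  obtain C where C: "C > 0" "\<And>a t u. a \<in> P \<Longrightarrow> \<bar>t\<bar> \<le> d \<Longrightarrow> norm u \<le> R \<Longrightarrow> \<bar>J0 (a, t, u)\<bar> \<le> C"
    using smooth_bounded[OF smooth_on_imp_continuous_on[OF smooth_J0]] by blast
  have ih: "integrable (coord_lborel K) ?h"
    by (rule integrable_coord_lborel_bounded[of _ C R, OF mh])
      (use C a tt in \<open>auto simp: indicator_def\<close>)
  have J0_nonneg: "0 \<le> J0 (a, t, u)" if "norm u \<le> R" for u
  proof -
    have "a + t *\<^sub>R u \<in> V"
      using av_in_V1[of a "t *\<^sub>R u"] in_dom'[OF a tt that] ball_V by (auto simp: dom_def)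
    then show ?thesis using gram_det_pos[OF chart] by (simp add: J0_def less_imp_le)
  qed
  have h_nonneg: "0 \<le> ?h u" for u using J0_nonneg[of u] by (auto simp: indicator_def)
  have smV: "(\<lambda>v. indicator A v * ennreal (sqrt (gram_det K \<phi> v))) \<in> borel_measurable borel"
  proof -
    have c: "continuous_on V (\<lambda>v. sqrt (gram_det K \<phi> v))"
      by (intro continuous_intros smooth_on_imp_continuous_on smooth_on_gram_det V)
    have [measurable]: "A \<in> sets borel" by (rule A_borel)
    have [measurable]: "(\<lambda>v. indicator V v *\<^sub>R sqrt (gram_det K \<phi> v)) \<in> borel_measurable borel"
      using V(1) by (intro borel_measurable_continuous_on_indicator[OF _ c]) auto
    have "(\<lambda>v. indicator A v * ennreal (indicator V v *\<^sub>R sqrt (gram_det K \<phi> v))) \<in> borel_measurable borel"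
      by measurable
    moreover have "(\<lambda>v. indicator A v * ennreal (indicator V v *\<^sub>R sqrt (gram_det K \<phi> v)))
        = (\<lambda>v. indicator A v * ennreal (sqrt (gram_det K \<phi> v)))"
      by (auto simp: indicator_def A_def fun_eq_iff)
    ultimately show ?thesis by simp
  qed
  have "emeasure \<mu> (M \<inter> cball x t) = (\<integral>\<^sup>+v\<in>A. ennreal (sqrt (gram_det K \<phi> v)) \<partial>coord_lborel K)"
  proof -
    have "A \<subseteq> V \<inter> coord_subspace K" by (auto simp: A_def)
    then show ?thesis
      unfolding image using vol chart A_borel unfolding is_riemannian_volume_def by blast
  qed
  also have "\<dots> = (\<integral>\<^sup>+v. indicator A v * ennreal (sqrt (gram_det K \<phi> v)) \<partial>coord_lborel K)"
    by (simp add: mult.commute)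
  also have "\<dots> = ennreal (\<bar>t\<bar> ^ card K) * (\<integral>\<^sup>+u. indicator A (a + t *\<^sub>R u) * ennreal (sqrt (gram_det K \<phi> (a + t *\<^sub>R u))) \<partial>coord_lborel K)"
    by (rule nn_integral_coord_lborel_affine[OF smV]) (use t aV in auto)
  also have "(\<integral>\<^sup>+u. indicator A (a + t *\<^sub>R u) * ennreal (sqrt (gram_det K \<phi> (a + t *\<^sub>R u))) \<partial>coord_lborel K)
      = (\<integral>\<^sup>+u. ennreal (?h u) \<partial>coord_lborel K)"
  proof (rule nn_integral_cong_AE)
    show "AE u in coord_lborel K. indicator A (a + t *\<^sub>R u) * ennreal (sqrt (gram_det K \<phi> (a + t *\<^sub>R u))) = ennreal (?h u)"
      using AE_coord_lborel[of K]
    proof eventually_elim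
      case (elim u)
      then show ?case using char[OF elim] by (auto simp: indicator_def J0_def)
    qed
  qed
  also have "\<dots> = ennreal (G J0 a t)"
    unfolding G_def by (rule nn_integral_eq_integral[OF ih]) (use h_nonneg in auto)
  finally show em: "emeasure \<mu> (M \<inter> cball x t) = ennreal (t ^ m * G J0 a t)"
    using t card G_def h_nonneg by (simp add: ennreal_mult)
  have "0 \<le> G J0 a t" unfolding G_def using h_nonneg by (intro integral_nonneg_AE) auto
  then show "measure \<mu> (M \<inter> cball x t) = t ^ m * G J0 a t" using t em by (simp add: measure_def)
qed

end

text \<open>At \<open>(a0, 0)\<close> the determinant of \<open>mixed_gram\<close> is the positive
  Gram determinant, and continuity keeps it nonzero on a product of small balls.\<close>

lemma local_chart_exists:
  fixes M :: "(real^'n::finite) set"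
  assumes chart: "slice_chart m M K V \<phi>" and a0: "a0 \<in> V" "a0 \<in> coord_subspace K"
  obtains \<rho> r \<Lambda> where "local_chart m M K V \<phi> a0 \<rho> r \<Lambda>"
proof -
  note ch = chart[unfolded slice_chart_def]
  have V: "open V" "smooth_on \<phi> V" using ch by auto
  obtain r where r: "r > 0" "cball (\<phi> a0) r \<subseteq> \<phi> ` V"
    using ch a0 by (meson open_contains_cball image_eqI)
  obtain \<Lambda> where \<Lambda>: "\<Lambda> > 0" "\<And>y y'. y \<in> cball (\<phi> a0) r \<Longrightarrow> y' \<in> cball (\<phi> a0) r \<Longrightarrow>
       norm (inv_into V \<phi> y - inv_into V \<phi> y') \<le> \<Lambda> * norm (y - y')"
    using smooth_on_lipschitz[of "inv_into V \<phi>" "\<phi> ` V" "cball (\<phi> a0) r"] ch r by auto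
  have "open (V \<inter> \<phi> -` ball (\<phi> a0) r)"
    using smooth_on_imp_continuous_on[OF V(2)] V(1) by (intro continuous_open_preimage) auto
  moreover have "a0 \<in> V \<inter> \<phi> -` ball (\<phi> a0) r" using a0 r by auto
  ultimately obtain \<rho>1 where \<rho>1: "\<rho>1 > 0" "ball a0 \<rho>1 \<subseteq> V \<inter> \<phi> -` ball (\<phi> a0) r"
    by (meson open_contains_ball)
  define \<rho>0 where "\<rho>0 = \<rho>1 / 3"
  have \<rho>0: "\<rho>0 > 0" "ball a0 (3 * \<rho>0) \<subseteq> V" "\<phi> ` ball a0 (3 * \<rho>0) \<subseteq> ball (\<phi> a0) r"
    using \<rho>1 by (auto simp: \<rho>0_def)
  define W where "W = ball a0 \<rho>0 \<times> ball (0::real^'n) \<rho>0"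
  define h where "h = (\<lambda>p. det (mixed_gram K \<phi> (fst p) (snd p)))"
  have W: "open W" by (auto simp: W_def intro!: open_Times)
  have sub: "(\<lambda>p. fst p + snd p) ` W \<subseteq> V"
  proof
    fix y assume "y \<in> (\<lambda>p. fst p + snd p) ` W"
    then obtain a v where *: "y = a + v" "dist a0 a < \<rho>0" "norm v < \<rho>0" by (auto simp: W_def)
    then have "dist a0 y \<le> dist a0 a + norm v" by (metis dist_triangle dist_norm add_diff_cancel_left' dist_commute)
    then show "y \<in> V" using * \<rho>0 by (intro subsetD[OF \<rho>0(2)]) auto
  qed
  have "smooth_on h W"
    unfolding h_def
  proof (rule smooth_on_det[OF W])
    fix i j
    have s1: "smooth_on (\<lambda>p. avg_deriv \<phi> i (fst p) (snd p)) W"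
      unfolding W_def by (rule smooth_on_avg_deriv[OF V \<rho>0(2)])
    have s2: "smooth_on (\<lambda>p. frechet_derivative \<phi> (at (fst p + snd p)) (axis j 1)) W"
      by (rule smooth_on_compose[OF W V(1) sub smooth_on_frechet_derivative[OF V(2)]])
        (intro smooth_on_linear W bounded_linear_add bounded_linear_fst bounded_linear_snd)
    show "smooth_on (\<lambda>p. mixed_gram K \<phi> (fst p) (snd p) $ i $ j) W"
      using smooth_on_inner[OF W s1 s2] smooth_on_const[OF W]
      by (cases "i \<in> K \<and> j \<in> K") (auto simp: mixed_gram_def)
  qed
  then have "open (W \<inter> h -` (- {0}))"
    using W smooth_on_imp_continuous_on by (intro continuous_open_preimage) (auto intro: open_Compl)
  moreover have "(a0, 0) \<in> W \<inter> h -` (- {0})"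
  proof -
    have "h (a0, 0) = gram_det K \<phi> a0"
      unfolding h_def gram_det_def mixed_gram_def
      by (simp add: avg_deriv_zero cong: if_cong)
    then show ?thesis using gram_det_pos[OF chart a0(1)] \<rho>0 by (simp add: W_def)
  qed
  ultimately obtain A B where AB: "open A" "open B" "(a0, 0) \<in> A \<times> B" "A \<times> B \<subseteq> W \<inter> h -` (- {0})"
    by (rule open_prod_elim)
  obtain \<rho>2 where \<rho>2: "\<rho>2 > 0" "ball a0 \<rho>2 \<subseteq> A" using AB by (auto simp: open_contains_ball)
  obtain \<rho>3 where \<rho>3: "\<rho>3 > 0" "ball 0 \<rho>3 \<subseteq> B" using AB by (auto simp: open_contains_ball)
  define \<rho> where "\<rho> = min \<rho>0 (min \<rho>2 \<rho>3)"
  have \<rho>: "\<rho> > 0" "\<rho> \<le> \<rho>0" "\<rho> \<le> \<rho>2" "\<rho> \<le> \<rho>3" using \<rho>0 \<rho>2 \<rho>3 by (auto simp: \<rho>_def)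
  have b: "ball a0 (3 * \<rho>) \<subseteq> ball a0 (3 * \<rho>0)" using \<rho> by (intro subset_ball) auto
  have "local_chart m M K V \<phi> a0 \<rho> r \<Lambda>"
  proof
    show "ball a0 (3 * \<rho>) \<subseteq> V" using b \<rho>0 by blast
    show "\<phi> ` ball a0 (3 * \<rho>) \<subseteq> cball (\<phi> a0) r"
      using image_mono[OF b, of \<phi>] \<rho>0(3) ball_subset_cball by blast
    fix a v :: "real^'n" assume "a \<in> ball a0 \<rho>" "norm v < \<rho>"
    then have "(a, v) \<in> A \<times> B" using \<rho> \<rho>2 \<rho>3 by (auto simp: subset_iff)
    then show "det (mixed_gram K \<phi> a v) \<noteq> 0" using AB(4) by (auto simp: h_def)
  qed (use chart a0 \<rho> r \<Lambda> in auto)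
  then show thesis by (rule that)
qed

text \<open>Finiteness of \<open>emeasure\<close> is carried along because \<open>measure\<close> is
  0 on sets of infinite volume, and finiteness of the volume of \<open>M\<close> is itself deduced
  from these balls.\<close>

lemma local_deriv_chain:
  fixes M :: "(real^'n::finite) set"
  assumes M: "closed_submanifold m M" and vol: "is_riemannian_volume m M \<mu>" and p: "p \<in> M"
  obtains U d C where "open U" "p \<in> U" "d > 0"
    "\<And>x. x \<in> M \<inter> U \<Longrightarrow> \<exists>g. deriv_chain d C m g \<and> (\<forall>t. 0 < t \<and> t < d \<longrightarrow> emeasure \<mu> (M \<inter> cball x t) < \<infinity> \<and> measure \<mu> (M \<inter> cball x t) = g 0 t)"
proof -
  obtain K V \<phi> where chart: "slice_chart m M K V \<phi>" and "p \<in> \<phi> ` V"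
    using M p unfolding closed_submanifold_def by blast
  then have "p \<in> \<phi> ` (V \<inter> coord_subspace K)" using p by (auto simp: slice_chart_def)
  then obtain a0 where a0p: "a0 \<in> V" "a0 \<in> coord_subspace K" "p = \<phi> a0" by auto
  obtain \<rho> r \<Lambda> where "local_chart m M K V \<phi> a0 \<rho> r \<Lambda>"
    by (rule local_chart_exists[OF chart a0p(1,2)])
  then interpret local_chart m M K V \<phi> a0 \<rho> r \<Lambda> .
  let ?\<theta> = "inv_into V \<phi>"
  have \<theta>: "open (\<phi> ` V)" "continuous_on (\<phi> ` V) ?\<theta>"
    using chart by (auto simp: slice_chart_def smooth_on_imp_continuous_on)
  \<comment> \<open>These are the conditions of \<open>ball_measure\<close>: parameters within
    \<open>\<rho> / 2\<close> of \<open>a0\<close>, hence in \<open>P\<close>, and points within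
    \<open>r / 2\<close> of \<open>p\<close>.\<close>
  define U where "U = (\<phi> ` V \<inter> ?\<theta> -` ball a0 (\<rho> / 2)) \<inter> ball p (r / 2)"
  have U: "open U" "p \<in> U"
  proof -
    have "open (\<phi> ` V \<inter> ?\<theta> -` ball a0 (\<rho> / 2))"
      using \<theta> by (intro continuous_open_preimage) auto
    then show "open U" by (auto simp: U_def)
    show "p \<in> U" using a0p \<rho> r slice_chart_left_inverse[OF chart a0p(1)] by (auto simp: U_def)
  qed
  obtain C where C: "\<And>a. a \<in> P \<Longrightarrow> deriv_chain d C 0 (\<lambda>k. G ((transp ^^ k) J0) a)"
    using deriv_chain_G by blast
  obtain C' where C': "\<And>g. deriv_chain d C 0 g \<Longrightarrow> \<exists>g'. deriv_chain d C' m g' \<and> (\<forall>t. g' 0 t = t ^ m * g 0 t)"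
    using deriv_chain_power[of d C m] by blast
  define d' where "d' = min d (r / 2)"
  show thesis
  proof (rule that[OF U])
    show "d' > 0" using d_pos r by (simp add: d'_def)
    fix x assume x: "x \<in> M \<inter> U"
    then have "x \<in> \<phi> ` (V \<inter> coord_subspace K)" using chart by (auto simp: slice_chart_def U_def)
    then obtain a where a: "a \<in> V" "a \<in> coord_subspace K" "x = \<phi> a" by auto
    then have "a \<in> P" using x slice_chart_left_inverse[OF chart a(1)] by (auto simp: P_def U_def)
    obtain g where g: "deriv_chain d C' m g" "\<And>t. g 0 t = t ^ m * G J0 a t"
      using C'[OF C[OF \<open>a \<in> P\<close>]] by auto
    have "deriv_chain d' C' m g" by (rule deriv_chain_subset[OF g(1)]) (auto simp: d'_def)
    moreover have "emeasure \<mu> (M \<inter> cball x t) < \<infinity> \<and> measure \<mu> (M \<inter> cball x t) = g 0 t" if "0 < t" "t < d'" for t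
      using ball_measure[OF vol \<open>a \<in> P\<close> a(3), of t] that x a0p by (auto simp: d'_def U_def g)
    ultimately show "\<exists>g. deriv_chain d' C' m g \<and> (\<forall>t. 0 < t \<and> t < d' \<longrightarrow> emeasure \<mu> (M \<inter> cball x t) < \<infinity> \<and> measure \<mu> (M \<inter> cball x t) = g 0 t)"
      by blast
  qed
qed

section \<open>Change of variables and the Riemannian volume\<close>

text \<open>The change of variables theorem of the library needs an index type of class \<^class>\<open>wellorder\<close>.\<close>

typedef 'a ord_copy = "UNIV :: 'a set" by simp

instance ord_copy :: (finite) finite
proof
  have "(UNIV :: 'a ord_copy set) = range Abs_ord_copy"
    by (metis Rep_ord_copy_inverse surjI)
  then show "finite (UNIV :: 'a ord_copy set)" by (metis finite finite_imageI)
qed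

instantiation ord_copy :: (finite) wellorder
begin

definition less_eq_ord_copy :: "'a ord_copy \<Rightarrow> 'a ord_copy \<Rightarrow> bool" where
  "less_eq_ord_copy x y \<longleftrightarrow> to_nat_on (UNIV :: 'a set) (Rep_ord_copy x) \<le> to_nat_on (UNIV :: 'a set) (Rep_ord_copy y)"

definition less_ord_copy :: "'a ord_copy \<Rightarrow> 'a ord_copy \<Rightarrow> bool" where
  "less_ord_copy x y \<longleftrightarrow> to_nat_on (UNIV :: 'a set) (Rep_ord_copy x) < to_nat_on (UNIV :: 'a set) (Rep_ord_copy y)"

instance
proof
  have inj: "inj (to_nat_on (UNIV :: 'a set))" by (rule inj_on_to_nat_on) (simp add: countable_finite)
  fix x y z :: "'a ord_copy"
  show "x < y \<longleftrightarrow> x \<le> y \<and> \<not> y \<le> x" "x \<le> x" "x \<le> y \<or> y \<le> x"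
    by (auto simp: less_eq_ord_copy_def less_ord_copy_def)
  show "x \<le> y \<Longrightarrow> y \<le> z \<Longrightarrow> x \<le> z" by (auto simp: less_eq_ord_copy_def)
  show "x \<le> y \<Longrightarrow> y \<le> x \<Longrightarrow> x = y"
    using inj by (simp add: less_eq_ord_copy_def inj_eq Rep_ord_copy_inject)
next
  fix Q :: "'a ord_copy \<Rightarrow> bool" and a :: "'a ord_copy"
  assume step: "\<And>x. (\<And>y. y < x \<Longrightarrow> Q y) \<Longrightarrow> Q x"
  show "Q a"
  proof (rule measure_induct_rule[of "\<lambda>x. to_nat_on (UNIV :: 'a set) (Rep_ord_copy x)" Q a])
    fix x :: "'a ord_copy"
    assume "\<And>y. to_nat_on (UNIV :: 'a set) (Rep_ord_copy y) < to_nat_on (UNIV :: 'a set) (Rep_ord_copy x) \<Longrightarrow> Q y"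
    then show "Q x" unfolding less_ord_copy_def[symmetric] by (rule step)
  qed
qed

end

section \<open>Change of variables for nonnegative functions\<close>

lemma bij_Rep_ord_copy: "bij (Rep_ord_copy :: 'a ord_copy \<Rightarrow> 'a)"
  by (rule bij_betwI[of _ _ _ Abs_ord_copy]) (auto simp: Rep_ord_copy_inverse Abs_ord_copy_inverse)

text \<open>Conjugation by \<open>f\<close> is a sign-preserving bijection between the permutations
  of the two index types.\<close>

lemma det_reindex:
  fixes A :: "real^'a::finite^'a" and f :: "'b::finite \<Rightarrow> 'a"
  assumes f: "bij f"
  shows "det (\<chi> i j. A $ f i $ f j) = det A"
proof -
  have ff: "f (inv f x) = x" "inv f (f y) = y" for x y
    using f by (auto simp: bij_is_surj bij_is_inj surj_f_inv_f)
  have mp: "map_permutation UNIV f p = f \<circ> p \<circ> inv f" if "p permutes UNIV" for p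
    using that f by (auto simp: map_permutation_def fun_eq_iff bij_is_surj restrict_id_def)
  have "det (\<chi> i j. A $ f i $ f j) = (\<Sum>p\<in>{p. p permutes UNIV}. of_int (sign p) * (\<Prod>i\<in>UNIV. A $ f i $ f (p i)))"
    by (simp add: det_def)
  also have "\<dots> = (\<Sum>q\<in>{q. q permutes UNIV}. of_int (sign q) * (\<Prod>i\<in>UNIV. A $ i $ q i))"
  proof (rule sum.reindex_bij_witness[of _ "\<lambda>q. inv f \<circ> q \<circ> f" "\<lambda>p. f \<circ> p \<circ> inv f"])
    fix p :: "'b \<Rightarrow> 'b" assume "p \<in> {p. p permutes UNIV}"
    then have p: "p permutes UNIV" by simp
    show "inv f \<circ> (f \<circ> p \<circ> inv f) \<circ> f = p" by (auto simp: fun_eq_iff ff)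
    have "bij (f \<circ> p \<circ> inv f)"
      using f p by (intro bij_comp bij_imp_bij_inv) (auto simp: permutes_bij)
    then show "f \<circ> p \<circ> inv f \<in> {q. q permutes UNIV}" by (auto intro!: bij_imp_permutes)
    have "sign (f \<circ> p \<circ> inv f) = sign p"
      using sign_map_permutation[of f UNIV p] f p mp[OF p] by (simp add: bij_is_inj)
    moreover have "(\<Prod>i\<in>UNIV. A $ i $ (f \<circ> p \<circ> inv f) i) = (\<Prod>i\<in>UNIV. A $ f i $ f (p i))"
      by (subst prod.reindex_bij_betw[OF f, symmetric]) (simp add: ff)
    ultimately show "of_int (sign (f \<circ> p \<circ> inv f)) * (\<Prod>i\<in>UNIV. A $ i $ (f \<circ> p \<circ> inv f) i) =
        of_int (sign p) * (\<Prod>i\<in>UNIV. A $ f i $ f (p i))" by simp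
  next
    fix q :: "'a \<Rightarrow> 'a" assume "q \<in> {q. q permutes UNIV}"
    then have q: "q permutes UNIV" by simp
    show "f \<circ> (inv f \<circ> q \<circ> f) \<circ> inv f = q" by (auto simp: fun_eq_iff ff)
    have "bij (inv f \<circ> q \<circ> f)"
      using f q by (intro bij_comp bij_imp_bij_inv) (auto simp: permutes_bij)
    then show "inv f \<circ> q \<circ> f \<in> {p. p permutes UNIV}" by (auto intro!: bij_imp_permutes)
  qed
  also have "\<dots> = det A" by (simp add: det_def)
  finally show ?thesis .
qed

lemma box_vec_eq: "box l u = {x::real^'n::finite. \<forall>i. x $ i \<in> {l $ i <..< u $ i}}"
  by (auto simp: mem_box_cart)

definition reindex :: "('b::finite \<Rightarrow> 'a::finite) \<Rightarrow> real^'a \<Rightarrow> real^'b" where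
  "reindex f x = (\<chi> i. x $ f i)"

lemma reindex_nth [simp]: "reindex f x $ i = x $ f i" by (simp add: reindex_def)

lemma linear_reindex: "linear (reindex f)" by (auto simp: linear_iff vec_eq_iff)

lemma reindex_borel [measurable]: "reindex f \<in> borel_measurable borel"
  by (intro borel_measurable_continuous_onI linear_continuous_on)
     (simp add: linear_reindex linear_conv_bounded_linear[symmetric])

lemma reindex_reindex: "bij f \<Longrightarrow> reindex f (reindex (inv f) x) = x" "bij f \<Longrightarrow> reindex (inv f) (reindex f y) = y"
  by (auto simp: vec_eq_iff bij_is_surj bij_is_inj surj_f_inv_f)

lemma lborel_reindex:
  fixes f :: "'b::finite \<Rightarrow> 'a::finite"
  assumes f: "bij f"
  shows "distr lborel borel (reindex f) = lborel"
proof (rule lborel_eqI[symmetric])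
  fix l u :: "real^'b" assume lu: "\<And>b. b \<in> Basis \<Longrightarrow> l \<bullet> b \<le> u \<bullet> b"
  have "emeasure (distr lborel borel (reindex f)) (box l u) = emeasure lborel (reindex f -` box l u)"
    by (subst emeasure_distr) auto
  also have "reindex f -` box l u = {x. \<forall>i. x $ i \<in> {l $ inv f i <..< u $ inv f i}}"
    using f by (auto simp: box_vec_eq) (metis bij_inv_eq_iff)+
  also have "emeasure lborel \<dots> = (\<Prod>i\<in>UNIV. emeasure lborel {l $ inv f i <..< u $ inv f i})"
    by (rule emeasure_lborel_vec_rectangle) auto
  also have "\<dots> = (\<Prod>i\<in>UNIV. emeasure lborel {l $ i <..< u $ i})"
    by (rule prod.reindex_bij_betw[OF bij_imp_bij_inv[OF f]])
  also have "\<dots> = emeasure lborel (box l u)"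
    unfolding box_vec_eq by (rule emeasure_lborel_vec_rectangle[symmetric]) auto
  also have "\<dots> = (\<Prod>b\<in>Basis. (u - l) \<bullet> b)"
    using lu by (simp add: emeasure_lborel_box)
  finally show "emeasure (distr lborel borel (reindex f)) (box l u) = (\<Prod>b\<in>Basis. (u - l) \<bullet> b)" .
qed simp

lemma has_integral_change_of_variables_nonneg:
  fixes h :: "real^'n::{finite,wellorder} \<Rightarrow> real" and g :: "real^'n::_ \<Rightarrow> real^'n::_"
  assumes S: "S \<in> sets lebesgue"
    and der: "\<And>x. x \<in> S \<Longrightarrow> (g has_derivative g' x) (at x within S)"
    and inj: "inj_on g S" and nonneg: "\<And>x. x \<in> S \<Longrightarrow> 0 \<le> h (g x)"
  shows "((\<lambda>x. \<bar>det (matrix (g' x))\<bar> * h (g x)) has_integral b) S \<longleftrightarrow> (h has_integral b) (g ` S)"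
proof -
  \<comment> \<open>For nonnegative functions gauge integrability and absolute integrability agree,
    so the equivalence for absolute integrals of \<open>real^1\<close>-valued functions carries over
    to \<open>has_integral\<close>.\<close>
  have eq: "(l has_integral b) T \<longleftrightarrow> (\<lambda>x. vec (l x) :: real^1) absolutely_integrable_on T \<and> integral T (\<lambda>x. vec (l x) :: real^1) = vec b"
    if "\<And>x. x \<in> T \<Longrightarrow> 0 \<le> l x" for l :: "real^'n::_ \<Rightarrow> real" and T
  proof -
    have "(l has_integral b) T \<longleftrightarrow> l absolutely_integrable_on T \<and> integral T l = b"
      using nonnegative_absolutely_integrable_1[of l T, OF _ that] by (auto simp: has_integral_iff absolutely_integrable_on_def)
    then show ?thesis
      by (simp add: absolutely_integrable_on_1_iff integral_on_1_eq vec_eq_iff)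
  qed
  have 1: "(\<lambda>x. \<bar>det (matrix (g' x))\<bar> *\<^sub>R (vec (h (g x)) :: real^1)) = (\<lambda>x. vec (\<bar>det (matrix (g' x))\<bar> * h (g x)))"
    by (auto simp: vec_eq_iff)
  have "((\<lambda>x. \<bar>det (matrix (g' x))\<bar> * h (g x)) has_integral b) S \<longleftrightarrow>
     (\<lambda>x. \<bar>det (matrix (g' x))\<bar> *\<^sub>R (vec (h (g x)) :: real^1)) absolutely_integrable_on S \<and>
     integral S (\<lambda>x. \<bar>det (matrix (g' x))\<bar> *\<^sub>R (vec (h (g x)) :: real^1)) = vec b"
    unfolding 1 by (rule eq) (use nonneg in auto)
  also have "\<dots> \<longleftrightarrow> (\<lambda>x. vec (h x) :: real^1) absolutely_integrable_on (g ` S) \<and> integral (g ` S) (\<lambda>x. vec (h x) :: real^1) = vec b"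
    by (rule has_absolute_integral_change_of_variables[OF S der inj])
  also have "\<dots> \<longleftrightarrow> (h has_integral b) (g ` S)"
    by (rule eq[symmetric]) (use nonneg in auto)
  finally show ?thesis .
qed

text \<open>\<open>has_integral\<close> sees finite values only; the infinite case follows by
  symmetry, since finiteness on either side would transfer to the other.\<close>

lemma nn_integral_eq_if_has_integral_iff:
  fixes u v :: "'a::euclidean_space \<Rightarrow> real"
  assumes [measurable]: "u \<in> borel_measurable borel" "v \<in> borel_measurable borel"
    and nn: "\<And>x. 0 \<le> u x" "\<And>x. 0 \<le> v x"
    and iff: "\<And>b. (u has_integral b) UNIV \<longleftrightarrow> (v has_integral b) UNIV"
  shows "(\<integral>\<^sup>+x. ennreal (u x) \<partial>lborel) = (\<integral>\<^sup>+x. ennreal (v x) \<partial>lborel)"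
proof -
  have *: "(\<integral>\<^sup>+x. ennreal (u x) \<partial>lborel) = (\<integral>\<^sup>+x. ennreal (v x) \<partial>lborel)"
    if "(\<integral>\<^sup>+x. ennreal (u x) \<partial>lborel) < \<infinity>" "\<And>b. (u has_integral b) UNIV \<longleftrightarrow> (v has_integral b) UNIV"
      and [measurable]: "u \<in> borel_measurable borel" "v \<in> borel_measurable borel" and "\<And>x. 0 \<le> u x" "\<And>x. 0 \<le> v x"
    for u v :: "'a \<Rightarrow> real"
  proof -
    define r where "r = enn2real (\<integral>\<^sup>+x. ennreal (u x) \<partial>lborel)"
    have r: "(\<integral>\<^sup>+x. ennreal (u x) \<partial>lborel) = ennreal r" "0 \<le> r"
      using that(1) by (simp_all add: r_def)
    have "(v has_integral r) UNIV"
      using nn_integral_has_integral[OF that(3) that(5) r] that(2) by simp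
    from nn_integral_has_integral_lborel[OF that(4) that(6) this] show ?thesis using r by simp
  qed
  show ?thesis
  proof (cases "(\<integral>\<^sup>+x. ennreal (u x) \<partial>lborel) < \<infinity>")
    case True
    show ?thesis by (rule *[OF True iff assms(1,2) nn])
  next
    case False
    have "\<not> (\<integral>\<^sup>+x. ennreal (v x) \<partial>lborel) < \<infinity>"
    proof
      assume fin: "(\<integral>\<^sup>+x. ennreal (v x) \<partial>lborel) < \<infinity>"
      from *[OF fin iff[symmetric] assms(2,1) nn(2,1)] fin False show False by (simp only:)
    qed
    with False show ?thesis by (simp add: less_top[symmetric])
  qed
qed

lemma nn_integral_change_of_variables_wellorder:
  fixes h l :: "real^'n::{finite,wellorder} \<Rightarrow> real" and g :: "real^'n::_ \<Rightarrow> real^'n::_"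
  assumes S: "S \<in> sets borel"
    and der: "\<And>x. x \<in> S \<Longrightarrow> (g has_derivative g' x) (at x within S)"
    and inj: "inj_on g S" and nonneg: "\<And>x. x \<in> S \<Longrightarrow> 0 \<le> h (g x)"
    and l: "\<And>x. x \<in> S \<Longrightarrow> l x = \<bar>det (matrix (g' x))\<bar> * h (g x)"
    and meas: "(\<lambda>x. indicator S x * l x) \<in> borel_measurable borel"
      "(\<lambda>y. indicator (g ` S) y * h y) \<in> borel_measurable borel"
  shows "(\<integral>\<^sup>+x. ennreal (indicator S x * l x) \<partial>lborel) = (\<integral>\<^sup>+y. ennreal (indicator (g ` S) y * h y) \<partial>lborel)"
proof (rule nn_integral_eq_if_has_integral_iff[OF meas])
  fix b
  have ind: "((\<lambda>x. indicator T x * k x) has_integral b) UNIV \<longleftrightarrow> (k has_integral b) T" for T and k :: "real^'n::_ \<Rightarrow> real"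
  proof -
    have "(\<lambda>x. indicator T x * k x) = (\<lambda>x. if x \<in> T then k x else 0)" by (auto simp: indicator_def)
    then show ?thesis by (simp add: has_integral_restrict_UNIV)
  qed
  have "(l has_integral b) S \<longleftrightarrow> ((\<lambda>x. \<bar>det (matrix (g' x))\<bar> * h (g x)) has_integral b) S"
    by (rule has_integral_cong[OF l])
  also have "\<dots> \<longleftrightarrow> (h has_integral b) (g ` S)"
    using S by (intro has_integral_change_of_variables_nonneg der inj nonneg) auto
  finally show "((\<lambda>x. indicator S x * l x) has_integral b) UNIV \<longleftrightarrow> ((\<lambda>y. indicator (g ` S) y * h y) has_integral b) UNIV"
    unfolding ind .
qed (use nonneg l in \<open>auto simp: indicator_def\<close>)

text \<open>The map is conjugated by the relabelling \<open>E\<close>, which preserves Lebesgue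
  measure and, by \<open>det_reindex\<close>, the Jacobian.\<close>

lemma nn_integral_change_of_variables:
  fixes h l :: "real^'n::finite \<Rightarrow> real" and g :: "real^'n \<Rightarrow> real^'n"
  assumes S: "S \<in> sets borel"
    and der: "\<And>x. x \<in> S \<Longrightarrow> (g has_derivative g' x) (at x within S)"
    and inj: "inj_on g S" and nonneg: "\<And>x. x \<in> S \<Longrightarrow> 0 \<le> h (g x)"
    and l: "\<And>x. x \<in> S \<Longrightarrow> l x = \<bar>det (matrix (g' x))\<bar> * h (g x)"
    and meas: "(\<lambda>x. indicator S x * l x) \<in> borel_measurable borel"
      "(\<lambda>y. indicator (g ` S) y * h y) \<in> borel_measurable borel"
  shows "(\<integral>\<^sup>+x. ennreal (indicator S x * l x) \<partial>lborel) = (\<integral>\<^sup>+y. ennreal (indicator (g ` S) y * h y) \<partial>lborel)"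
proof -
  define e where "e = (Rep_ord_copy :: 'n ord_copy \<Rightarrow> 'n)"
  have e: "bij e" unfolding e_def by (rule bij_Rep_ord_copy)
  define E where "E = (reindex e :: real^'n \<Rightarrow> real^'n ord_copy)"
  define E' where "E' = (reindex (inv e) :: real^'n ord_copy \<Rightarrow> real^'n)"
  have EE: "E (E' x) = x" "E' (E y) = y" for x y
    unfolding E_def E'_def by (rule reindex_reindex[OF e])+
  have lin: "linear E" "linear E'" by (auto simp: E_def E'_def linear_reindex)
  have [measurable]: "E \<in> borel_measurable borel" "E' \<in> borel_measurable borel" by (auto simp: E_def E'_def)
  have vi: "E' -` T = E ` T" for T
  proof (intro equalityI subsetI)
    fix x assume "x \<in> E' -` T"
    then show "x \<in> E ` T" by (intro image_eqI[of _ _ "E' x"]) (simp_all only: EE vimage_eq)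
  next
    fix x assume "x \<in> E ` T"
    then show "x \<in> E' -` T" by (auto simp: EE)
  qed
  have tr: "(\<integral>\<^sup>+x. ennreal (k x) \<partial>lborel) = (\<integral>\<^sup>+y. ennreal (k (E' y)) \<partial>lborel)"
    if [measurable]: "k \<in> borel_measurable borel" for k :: "real^'n \<Rightarrow> real"
  proof -
    have "(\<integral>\<^sup>+x. ennreal (k x) \<partial>distr lborel borel E') = (\<integral>\<^sup>+y. ennreal (k (E' y)) \<partial>lborel)"
      by (rule nn_integral_distr) auto
    then show ?thesis by (simp only: E'_def lborel_reindex[OF bij_imp_bij_inv[OF e]])
  qed
  define g2 where "g2 = (\<lambda>y. E (g (E' y)))"
  have im: "g2 ` (E' -` S) = E' -` (g ` S)" unfolding vi g2_def by (auto simp: EE image_iff)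
  have indE: "indicator T (E' y) = indicator (E' -` T) y" for T y by (simp add: indicator_def)
  have "(\<integral>\<^sup>+x. ennreal (indicator S x * l x) \<partial>lborel) = (\<integral>\<^sup>+y. ennreal (indicator (E' -` S) y * l (E' y)) \<partial>lborel)"
    unfolding tr[OF meas(1)] indE ..
  also have "\<dots> = (\<integral>\<^sup>+y. ennreal (indicator (g2 ` (E' -` S)) y * h (E' y)) \<partial>lborel)"
  proof (rule nn_integral_change_of_variables_wellorder[where g'="\<lambda>y v. E (g' (E' y) (E' v))"])
    show "E' -` S \<in> sets borel" using measurable_sets[of E' borel borel S] S by simp
    show "inj_on g2 (E' -` S)"
    proof (rule inj_onI)
      fix x y assume *: "x \<in> E' -` S" "y \<in> E' -` S" "g2 x = g2 y"
      then have "g (E' x) = g (E' y)" unfolding g2_def by (metis EE(2))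
      then have "E' x = E' y" using inj * by (auto dest: inj_onD)
      then show "x = y" by (metis EE(1))
    qed
    show "(\<lambda>y. indicator (E' -` S) y * l (E' y)) \<in> borel_measurable borel"
      using measurable_compose[OF \<open>E' \<in> borel_measurable borel\<close> meas(1)] by (simp add: indE)
    show "(\<lambda>y. indicator (g2 ` (E' -` S)) y * h (E' y)) \<in> borel_measurable borel"
      using measurable_compose[OF \<open>E' \<in> borel_measurable borel\<close> meas(2)] by (simp add: indE im)
    fix y assume y: "y \<in> E' -` S"
    then show "0 \<le> h (E' (g2 y))" using nonneg by (simp add: g2_def EE)
    have bl: "bounded_linear E" "bounded_linear E'" using lin by (simp_all only: linear_conv_bounded_linear)
    have "(E' has_derivative E') (at y within E' -` S)" by (rule bounded_linear_imp_has_derivative[OF bl(2)])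
    moreover have "(g has_derivative g' (E' y)) (at (E' y) within E' ` (E' -` S))"
      by (rule has_derivative_subset[OF der]) (use y in auto)
    ultimately have d1: "((\<lambda>y. g (E' y)) has_derivative (\<lambda>v. g' (E' y) (E' v))) (at y within E' -` S)"
      by (rule has_derivative_in_compose)
    show "(g2 has_derivative (\<lambda>v. E (g' (E' y) (E' v)))) (at y within E' -` S)"
      unfolding g2_def by (rule bounded_linear.has_derivative[OF bl(1) d1])
    have "matrix (\<lambda>v. E (g' (E' y) (E' v))) = (\<chi> i j. matrix (g' (E' y)) $ e i $ e j)"
    proof -
      have "inv e i = j \<longleftrightarrow> i = e j" for i j
        using e by (metis bij_inv_eq_iff)
      then have ax: "E' (axis j 1) = axis (e j) 1" for j
        by (simp add: E'_def vec_eq_iff axis_def)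
      show ?thesis by (simp only: matrix_def ax) (simp add: vec_eq_iff E_def)
    qed
    then have "det (matrix (\<lambda>v. E (g' (E' y) (E' v)))) = det (matrix (g' (E' y)))"
      using det_reindex[OF e] by simp
    then show "l (E' y) = \<bar>det (matrix (\<lambda>v. E (g' (E' y) (E' v))))\<bar> * h (E' (g2 y))"
      using l y by (simp add: g2_def EE)
  qed
  also have "\<dots> = (\<integral>\<^sup>+y. ennreal (indicator (g ` S) y * h y) \<partial>lborel)"
    unfolding tr[OF meas(2)] indE im ..
  finally show ?thesis .
qed

text \<open>In matrix form the Gram matrix of \<open>S' (B x)\<close> is the transpose of
  \<open>B\<close>, times the Gram matrix of \<open>S'\<close>, times \<open>B\<close>.\<close>

lemma det_gram_compose:
  fixes S S' :: "real^'n::finite \<Rightarrow> 'b::real_inner" and B :: "real^'n \<Rightarrow> real^'n"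
  assumes S': "bounded_linear S'" and B: "linear B" and eq: "\<And>x. S x = S' (B x)"
  shows "det (\<chi> i j. S (axis i 1) \<bullet> S (axis j 1)) = (det (matrix B))\<^sup>2 * det (\<chi> i j. S' (axis i 1) \<bullet> S' (axis j 1))"
proof -
  define G' where "G' = ((\<chi> i j. S' (axis i 1) \<bullet> S' (axis j 1)) :: real^'n^'n)"
  have "(\<chi> i j. S (axis i 1) \<bullet> S (axis j 1)) = transpose (matrix B) ** (G' ** matrix B)"
  proof -
    have Sb: "S (axis i 1) = (\<Sum>k\<in>UNIV. matrix B $ k $ i *\<^sub>R S' (axis k 1))" for i
      unfolding eq by (subst linear_axis_expansion[OF S']) (simp add: matrix_def)
    have "S (axis i 1) \<bullet> S (axis j 1) = (\<Sum>k\<in>UNIV. matrix B $ k $ i * (\<Sum>l\<in>UNIV. (S' (axis k 1) \<bullet> S' (axis l 1)) * matrix B $ l $ j))" for i j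
    proof -
      have "S (axis i 1) \<bullet> S (axis j 1) = (\<Sum>k\<in>UNIV. matrix B $ k $ i * (S' (axis k 1) \<bullet> S (axis j 1)))"
        by (subst (1) Sb) (simp add: inner_sum_left)
      moreover have "S' (axis k 1) \<bullet> S (axis j 1) = (\<Sum>l\<in>UNIV. (S' (axis k 1) \<bullet> S' (axis l 1)) * matrix B $ l $ j)" for k
        by (subst (1) Sb) (simp add: inner_sum_right mult.commute)
      ultimately show ?thesis by simp
    qed
    then show ?thesis
      by (simp add: vec_eq_iff matrix_matrix_mult_def transpose_def G'_def)
  qed
  then show ?thesis
    by (simp add: det_mul det_transpose power2_eq_square G'_def)
qed

text \<open>The ordinary Gram matrix of this map is the completed matrix of \<open>gram_det\<close>:
  the second component supplies the identity block. In this form the determinant obeys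
  \<open>det_gram_compose\<close>.\<close>

definition gram_map :: "'n::finite set \<Rightarrow> (real^'n \<Rightarrow> real^'n) \<Rightarrow> real^'n \<Rightarrow> (real^'n) \<times> (real^'n)" where
  "gram_map K D h = (D (coord_proj K h), h - coord_proj K h)"

lemma gram_det_gram_map:
  fixes \<phi> :: "real^'n::finite \<Rightarrow> real^'n"
  assumes "linear (frechet_derivative \<phi> (at x))"
  shows "gram_det K \<phi> x = det (\<chi> i j. gram_map K (frechet_derivative \<phi> (at x)) (axis i 1) \<bullet> gram_map K (frechet_derivative \<phi> (at x)) (axis j 1))"
proof -
  have p: "coord_proj K (axis i 1) = (if i \<in> K then axis i 1 else 0)" for i
    by (auto simp: vec_eq_iff axis_def)
  have "gram_map K (frechet_derivative \<phi> (at x)) (axis i 1) \<bullet> gram_map K (frechet_derivative \<phi> (at x)) (axis j 1)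
     = (if i \<in> K \<and> j \<in> K then frechet_derivative \<phi> (at x) (axis i 1) \<bullet> frechet_derivative \<phi> (at x) (axis j 1)
                 else if i = j then 1 else 0)" for i j
    using linear_0[OF assms] by (auto simp: gram_map_def p inner_axis_axis)
  then show ?thesis by (simp add: gram_det_def)
qed

lemma bounded_linear_gram_map:
  fixes D :: "real^'n::finite \<Rightarrow> real^'n"
  assumes "linear D" shows "bounded_linear (gram_map K D)"
  unfolding linear_conv_bounded_linear[symmetric]
proof (rule linearI)
  fix x y :: "real^'n" and c :: real
  show "gram_map K D (x + y) = gram_map K D x + gram_map K D y"
    using linear_add[OF assms] linear_add[OF linear_coord_proj[of K]] by (simp add: gram_map_def)
  show "gram_map K D (c *\<^sub>R x) = c *\<^sub>R gram_map K D x"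
    using linear_cmul[OF assms] linear_cmul[OF linear_coord_proj[of K]] by (simp add: gram_map_def scaleR_diff_right)
qed

text \<open>Two charts may use different coordinate sets; this matches the free coordinates of one
  slab with those of the other.\<close>

lemma bij_extending:
  fixes K K' :: "'n::finite set"
  assumes "card K = card K'"
  obtains p where "bij p" "p ` K = K'" "p ` (- K) = - K'"
proof -
  obtain f where f: "bij_betw f K K'" using assms by (metis finite_same_card_bij finite)
  have "card (- K) = card (- K')" using assms by (simp add: Compl_eq_Diff_UNIV card_Diff_subset)
  then obtain g where g: "bij_betw g (- K) (- K')" by (metis finite_same_card_bij finite)
  define p where "p = (\<lambda>x. if x \<in> K then f x else g x)"
  have 1: "bij_betw p K K'" using f by (rule bij_betw_cong[THEN iffD1, rotated]) (simp add: p_def)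
  have 2: "bij_betw p (- K) (- K')" using g by (rule bij_betw_cong[THEN iffD1, rotated]) (simp add: p_def)
  have "bij_betw p (K \<union> - K) (K' \<union> - K')" by (rule bij_betw_combine[OF 1 2]) auto
  then show thesis using that[of p] 1 2 by (simp add: bij_betw_def)
qed

section \<open>Volume densities in charts and their independence of the chart\<close>

lemma slice_chart_image_borel:
  assumes c: "slice_chart m M K V \<phi>" and A: "A \<in> sets borel" "A \<subseteq> V"
  shows "\<phi> ` A \<in> sets borel"
proof -
  have o: "open (\<phi> ` V)" and cont: "continuous_on (\<phi> ` V) (inv_into V \<phi>)"
    using c by (auto simp: slice_chart_def smooth_on_imp_continuous_on)
  have [measurable]: "(\<lambda>y. indicator (\<phi> ` V) y *\<^sub>R inv_into V \<phi> y) \<in> borel_measurable borel"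
    using o by (intro borel_measurable_continuous_on_indicator[OF _ cont]) auto
  have [measurable]: "A \<in> sets borel" by fact
  have "{y \<in> space borel. indicator (\<phi> ` V) y *\<^sub>R inv_into V \<phi> y \<in> A} \<in> sets borel" by measurable
  then have "\<phi> ` V \<inter> {y \<in> space borel. indicator (\<phi> ` V) y *\<^sub>R inv_into V \<phi> y \<in> A} \<in> sets borel"
    using o by auto
  also have "\<phi> ` V \<inter> {y \<in> space borel. indicator (\<phi> ` V) y *\<^sub>R inv_into V \<phi> y \<in> A} = \<phi> ` A"
  proof (intro equalityI subsetI)
    fix y assume "y \<in> \<phi> ` V \<inter> {y \<in> space borel. indicator (\<phi> ` V) y *\<^sub>R inv_into V \<phi> y \<in> A}"
    then have "y \<in> \<phi> ` V" "inv_into V \<phi> y \<in> A" by auto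
    then show "y \<in> \<phi> ` A" by (metis f_inv_into_f image_eqI)
  next
    fix y assume "y \<in> \<phi> ` A"
    then obtain a where a: "a \<in> A" "a \<in> V" "y = \<phi> a" using A(2) by auto
    then have "y \<in> \<phi> ` V" "inv_into V \<phi> y = a" using slice_chart_left_inverse[OF c] by auto
    then show "y \<in> \<phi> ` V \<inter> {y \<in> space borel. indicator (\<phi> ` V) y *\<^sub>R inv_into V \<phi> y \<in> A}"
      using a(1) by simp
  qed
  finally show ?thesis .
qed

lemma slice_chart_preimage_borel:
  assumes c: "slice_chart m M K V \<phi>" and B: "B \<in> sets borel"
  shows "{v \<in> V \<inter> coord_subspace K. \<phi> v \<in> B} \<in> sets borel"
proof -
  have o: "open V" and cont: "continuous_on V \<phi>"
    using c by (auto simp: slice_chart_def smooth_on_imp_continuous_on)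
  have [measurable]: "(\<lambda>y. indicator V y *\<^sub>R \<phi> y) \<in> borel_measurable borel"
    using o by (intro borel_measurable_continuous_on_indicator[OF _ cont]) auto
  have [measurable]: "B \<in> sets borel" by fact
  have "{y \<in> space borel. indicator V y *\<^sub>R \<phi> y \<in> B} \<in> sets borel" by measurable
  then have "V \<inter> coord_subspace K \<inter> {y \<in> space borel. indicator V y *\<^sub>R \<phi> y \<in> B} \<in> sets borel"
    using o closed_coord_subspace[of K] by (auto intro!: sets.Int borel_closed)
  also have "V \<inter> coord_subspace K \<inter> {y \<in> space borel. indicator V y *\<^sub>R \<phi> y \<in> B} = {v \<in> V \<inter> coord_subspace K. \<phi> v \<in> B}"
    by (auto simp: indicator_def)
  finally show ?thesis .
qed

lemma slice_chart_sqrt_gram_measurable: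
  assumes c: "slice_chart m M K V \<phi>" and A: "A \<in> sets borel" "A \<subseteq> V"
  shows "(\<lambda>v. indicator A v * sqrt (gram_det K \<phi> v)) \<in> borel_measurable borel"
proof -
  have V: "open V" "smooth_on \<phi> V" using c by (auto simp: slice_chart_def)
  have c: "continuous_on V (\<lambda>v. sqrt (gram_det K \<phi> v))"
    by (intro continuous_intros smooth_on_imp_continuous_on smooth_on_gram_det V)
  have [measurable]: "A \<in> sets borel" by fact
  have [measurable]: "(\<lambda>v. indicator V v *\<^sub>R sqrt (gram_det K \<phi> v)) \<in> borel_measurable borel"
    using V(1) by (intro borel_measurable_continuous_on_indicator[OF _ c]) auto
  have "(\<lambda>v. indicator A v * (indicator V v *\<^sub>R sqrt (gram_det K \<phi> v))) \<in> borel_measurable borel"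
    by measurable
  moreover have "(\<lambda>v. indicator A v * (indicator V v *\<^sub>R sqrt (gram_det K \<phi> v)))
      = (\<lambda>v. indicator A v * sqrt (gram_det K \<phi> v))"
    using A by (auto simp: indicator_def fun_eq_iff)
  ultimately show ?thesis by simp
qed

lemma nn_integral_chart_eq_lborel:
  assumes c: "slice_chart m M K V \<phi>" and A: "A \<in> sets borel" "A \<subseteq> V"
  shows "(\<integral>\<^sup>+x\<in>A. ennreal (sqrt (gram_det K \<phi> x)) \<partial>coord_lborel K)
    = (\<integral>\<^sup>+x. ennreal (indicator {x. coord_proj K x \<in> A \<and> x \<in> unit_slab K} x * sqrt (gram_det K \<phi> (coord_proj K x))) \<partial>lborel)"
proof -
  have "(\<integral>\<^sup>+x\<in>A. ennreal (sqrt (gram_det K \<phi> x)) \<partial>coord_lborel K)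
     = (\<integral>\<^sup>+x. ennreal (indicator A x * sqrt (gram_det K \<phi> x)) \<partial>coord_lborel K)"
    by (intro nn_integral_cong) (auto simp: indicator_def)
  also have "\<dots> = (\<integral>\<^sup>+x. ennreal (indicator A (coord_proj K x) * sqrt (gram_det K \<phi> (coord_proj K x))) * indicator (unit_slab K) x \<partial>lborel)"
    using slice_chart_sqrt_gram_measurable[OF assms] by (intro nn_integral_coord_lborel) auto
  also have "\<dots> = (\<integral>\<^sup>+x. ennreal (indicator {x. coord_proj K x \<in> A \<and> x \<in> unit_slab K} x * sqrt (gram_det K \<phi> (coord_proj K x))) \<partial>lborel)"
    by (intro nn_integral_cong) (auto simp: indicator_def)
  finally show ?thesis .
qed

text \<open>The transition map \<open>\<tau>\<close> between two slices is extended to a map \<open>T\<close> between the products of the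
  slices with unit cubes, so that the change of variables takes place in full dimension.\<close>

lemma chart_volume_independent:
  fixes M :: "(real^'n::finite) set"
  assumes c: "slice_chart m M K V \<phi>" and c': "slice_chart m M K' V' \<phi>'"
    and A: "A \<in> sets borel" "A \<subseteq> V \<inter> coord_subspace K"
    and A': "A' \<in> sets borel" "A' \<subseteq> V' \<inter> coord_subspace K'"
    and im: "\<phi> ` A = \<phi>' ` A'"
  shows "(\<integral>\<^sup>+x\<in>A. ennreal (sqrt (gram_det K \<phi> x)) \<partial>coord_lborel K)
       = (\<integral>\<^sup>+x\<in>A'. ennreal (sqrt (gram_det K' \<phi>' x)) \<partial>coord_lborel K')"
proof -
  note C = c[unfolded slice_chart_def] and C' = c'[unfolded slice_chart_def]
  obtain p where p: "bij p" "p ` K = K'" "p ` (- K) = - K'"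
    using bij_extending[of K K'] C C' by auto
  have pK: "inv p i \<in> K \<longleftrightarrow> i \<in> K'" for i
    using p by (metis (no_types, lifting) bij_inv_eq_iff image_iff ComplD ComplI)
  \<comment> \<open>\<open>Q\<close> carries the coordinates outside \<open>K\<close> to those
    outside \<open>K'\<close>; being an isometry it leaves the identity block of the Gram matrix
    intact.\<close>
  define Q where "Q = (reindex (inv p) :: real^'n \<Rightarrow> real^'n)"
  have linQ: "linear Q" by (simp add: Q_def linear_reindex)
  have innerQ: "Q x \<bullet> Q y = x \<bullet> y" for x y
  proof -
    have "Q x \<bullet> Q y = (\<Sum>i\<in>UNIV. x $ inv p i * y $ inv p i)" by (simp add: inner_vec_def Q_def)
    also have "\<dots> = (\<Sum>i\<in>UNIV. x $ i * y $ i)" by (rule sum.reindex_bij_betw[OF bij_imp_bij_inv[OF p(1)]])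
    finally show ?thesis by (simp add: inner_vec_def)
  qed
  define \<tau> where "\<tau> = (\<lambda>u. inv_into V' \<phi>' (\<phi> u))"
  define W where "W = V \<inter> \<phi> -` (\<phi>' ` V')"
  have W: "open W"
    unfolding W_def using C C' smooth_on_imp_continuous_on by (intro continuous_open_preimage) auto
  have "\<phi> ` A \<subseteq> \<phi>' ` V'" unfolding im using A' by auto
  then have AW: "A \<subseteq> W" using A by (auto simp: W_def)
  have \<phi>\<tau>: "\<phi>' (\<tau> u) = \<phi> u" "\<tau> u \<in> V'" if "u \<in> W" for u
    using that by (auto simp: \<tau>_def W_def f_inv_into_f inv_into_into)
  have \<tau>K: "\<tau> u \<in> coord_subspace K'" if "u \<in> W" "u \<in> coord_subspace K" for u
  proof -
    have "\<phi> u \<in> \<phi>' ` V' \<inter> M" using that C by (auto simp: W_def)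
    then have "\<phi> u \<in> \<phi>' ` (V' \<inter> coord_subspace K')" using C' by simp
    then obtain w where "w \<in> V'" "w \<in> coord_subspace K'" "\<phi> u = \<phi>' w" by auto
    then show ?thesis using slice_chart_left_inverse[OF c'] by (simp add: \<tau>_def)
  qed
  have \<tau>A: "\<tau> ` A = A'"
  proof -
    have "\<tau> ` A = inv_into V' \<phi>' ` (\<phi> ` A)" by (auto simp: \<tau>_def image_image)
    also have "\<dots> = A'" unfolding im using A' slice_chart_left_inverse[OF c'] by (force simp: image_image)
    finally show ?thesis .
  qed
  have \<tau>inj: "inj_on \<tau> A"
  proof (rule inj_onI)
    fix x y assume *: "x \<in> A" "y \<in> A" "\<tau> x = \<tau> y"
    then have "\<phi> x = \<phi> y" using \<phi>\<tau> AW by (metis subsetD)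
    then show "x = y" using C * A by (auto dest: inj_onD)
  qed
  have sm\<tau>: "smooth_on \<tau> W"
    unfolding \<tau>_def
  proof (rule smooth_on_compose[where T="\<phi>' ` V'" and f="inv_into V' \<phi>'" and g=\<phi>, OF W])
    show "smooth_on \<phi> W" by (rule smooth_on_subset[of \<phi> V]) (use C in \<open>auto simp: W_def\<close>)
  qed (use C' in \<open>auto simp: W_def\<close>)
  define D\<tau> where "D\<tau> = (\<lambda>u. frechet_derivative \<tau> (at u))"
  have d\<tau>: "(\<tau> has_derivative D\<tau> u) (at u)" if "u \<in> W" for u
    unfolding D\<tau>_def by (rule smooth_on_has_derivative[OF sm\<tau> that])
  have d\<phi>: "(\<phi> has_derivative frechet_derivative \<phi> (at u)) (at u)" if "u \<in> V" for u
    using C that by (intro smooth_on_has_derivative[of \<phi> V]) auto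
  have d\<phi>': "(\<phi>' has_derivative frechet_derivative \<phi>' (at u)) (at u)" if "u \<in> V'" for u
    using C' that by (intro smooth_on_has_derivative[of \<phi>' V']) auto
  have chain: "frechet_derivative \<phi> (at u) h = frechet_derivative \<phi>' (at (\<tau> u)) (D\<tau> u h)" if u: "u \<in> W" for u h
  proof -
    have "((\<lambda>u. \<phi>' (\<tau> u)) has_derivative (\<lambda>h. frechet_derivative \<phi>' (at (\<tau> u)) (D\<tau> u h))) (at u)"
      by (rule has_derivative_compose[OF d\<tau>[OF u] d\<phi>'[OF \<phi>\<tau>(2)[OF u]]])
    then have "(\<phi> has_derivative (\<lambda>h. frechet_derivative \<phi>' (at (\<tau> u)) (D\<tau> u h))) (at u)"
      by (rule has_derivative_transform_within_open[OF _ W u]) (rule \<phi>\<tau>(1))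
    moreover have "(\<phi> has_derivative frechet_derivative \<phi> (at u)) (at u)" using u by (intro d\<phi>) (simp add: W_def)
    ultimately show ?thesis using has_derivative_unique by metis
  qed
  \<comment> \<open>Along a line in the slice the coordinates of \<tau> outside \<open>K'\<close>
    are constantly 0, so their derivatives vanish.\<close>
  have D\<tau>K: "D\<tau> u h \<in> coord_subspace K'" if u: "u \<in> W" "u \<in> coord_subspace K" and h: "h \<in> coord_subspace K" for u h
    unfolding coord_subspace_def
  proof (intro CollectI allI impI)
    fix i assume i: "i \<notin> K'"
    have du: "(\<tau> has_derivative D\<tau> u) (at (u + 0 *\<^sub>R h))" using d\<tau>[OF u(1)] by simp
    have 1: "((\<lambda>s. \<tau> (u + s *\<^sub>R h)) has_derivative (\<lambda>s. D\<tau> u (s *\<^sub>R h))) (at 0)"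
      by (rule has_derivative_compose[of "\<lambda>s. u + s *\<^sub>R h" "\<lambda>s. s *\<^sub>R h" 0 UNIV \<tau>, OF _ du])
        (auto intro!: derivative_eq_intros)
    have 2: "((\<lambda>s. \<tau> (u + s *\<^sub>R h) $ i) has_derivative (\<lambda>s. D\<tau> u (s *\<^sub>R h) $ i)) (at 0)"
      by (rule bounded_linear.has_derivative[OF bounded_linear_vec_nth 1])
    define T where "T = (\<lambda>s. u + s *\<^sub>R h) -` W"
    have T: "open T" "(0::real) \<in> T" unfolding T_def using W u by (auto intro!: open_vimage continuous_intros)
    have "\<tau> (u + s *\<^sub>R h) $ i = 0" if "s \<in> T" for s
      using \<tau>K[of "u + s *\<^sub>R h"] that u h i by (auto simp: T_def coord_subspace_def)
    then have "((\<lambda>s. 0) has_derivative (\<lambda>s. D\<tau> u (s *\<^sub>R h) $ i)) (at 0)"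
      by (intro has_derivative_transform_within_open[OF 2 T])
    then have "(\<lambda>s. D\<tau> u (s *\<^sub>R h) $ i) = (\<lambda>s. 0)"
      using has_derivative_unique[OF _ has_derivative_const] by blast
    from fun_cong[OF this, of 1] show "D\<tau> u h $ i = 0" by simp
  qed
  define pr pr' where "pr = coord_proj K" and "pr' = coord_proj K'"
  define T where "T = (\<lambda>x. \<tau> (pr x) + Q (x - pr x))"
  define T' where "T' = (\<lambda>x h. D\<tau> (pr x) (pr h) + Q (h - pr h))"
  define S where "S = {x. pr x \<in> A \<and> x \<in> unit_slab K}"
  define S' where "S' = {x. pr' x \<in> A' \<and> x \<in> unit_slab K'}"
  have prQ: "pr' (Q (x - pr x)) = 0" for x
    by (auto simp: vec_eq_iff pr_def pr'_def Q_def pK)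
  have lin_pr: "linear pr" "linear pr'" by (simp_all add: pr_def pr'_def linear_coord_proj)
  have prT: "pr' (T x) = \<tau> (pr x)" if "pr x \<in> A" for x
  proof -
    have "\<tau> (pr x) \<in> coord_subspace K'" using \<tau>K that AW A by blast
    then show ?thesis by (simp add: T_def linear_add[OF lin_pr(2)] prQ) (simp add: pr'_def)
  qed
  have TS: "T ` S = S'"
  proof (intro equalityI subsetI)
    fix y assume "y \<in> T ` S"
    then obtain x where x: "pr x \<in> A" "x \<in> unit_slab K" "y = T x" by (auto simp: S_def)
    have "T x $ i = x $ inv p i" if "i \<notin> K'" for i
      using that \<tau>K[of "pr x"] x AW A by (auto simp: T_def Q_def pr_def pK coord_subspace_def subset_iff)
    then show "y \<in> S'"
      using x prT[OF x(1)] \<tau>A pK by (auto simp: S'_def unit_slab_def)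
  next
    fix y assume y: "y \<in> S'"
    then obtain a where a: "a \<in> A" "pr' y = \<tau> a" using \<tau>A by (auto simp: S'_def)
    \<comment> \<open>The explicit preimage: the slice part is \<open>a\<close>, and the cube part
      is that of \<open>y\<close> relabelled back by \<open>p\<close>.\<close>
    define x where "x = a + reindex p (y - pr' y)"
    have z: "(y - pr' y) $ p i = 0" if "i \<in> K" for i
    proof -
      have "p i \<in> K'" using p(2) that by blast
      then show ?thesis by (simp add: pr'_def)
    qed
    have "a \<in> coord_subspace K" using a(1) A by blast
    then have prx: "pr x = a"
      using z unfolding coord_subspace_def by (simp add: vec_eq_iff x_def pr_def)
    have x1: "x - pr x = reindex p (y - pr' y)" by (simp add: prx) (simp add: x_def)
    have "T x = \<tau> a + (y - pr' y)"
      unfolding T_def x1 using prx reindex_reindex(2)[OF p(1)] by (simp add: Q_def)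
    then have "T x = y" using a by simp
    moreover have "x $ i \<in> {0..1}" if "i \<notin> K" for i
    proof -
      have "p i \<notin> K'" using that pK[of "p i"] p(1) by (simp add: bij_is_inj)
      then have "y $ p i \<in> {0..1}" using y by (auto simp: S'_def unit_slab_def)
      moreover have "a $ i = 0" using \<open>a \<in> coord_subspace K\<close> that by (simp add: coord_subspace_def)
      moreover have "pr' y $ p i = 0" using \<open>p i \<notin> K'\<close> by (simp add: pr'_def)
      ultimately show ?thesis by (simp add: x_def)
    qed
    ultimately show "y \<in> T ` S" using prx a by (auto simp: S_def unit_slab_def image_iff intro!: exI[of _ x])
  qed
  have injT: "inj_on T S"
  proof (rule inj_onI)
    fix x y assume *: "x \<in> S" "y \<in> S" "T x = T y"
    then have "\<tau> (pr x) = \<tau> (pr y)" using prT by (metis (no_types, lifting) S_def mem_Collect_eq)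
    then have 1: "pr x = pr y" using * \<tau>inj by (auto simp: S_def dest: inj_onD)
    then have "Q (x - pr x) = Q (y - pr y)" using * by (simp add: T_def)
    then have "reindex p (Q (x - pr x)) = reindex p (Q (y - pr y))" by simp
    then have "x - pr x = y - pr y" using reindex_reindex(1)[OF p(1)] by (simp add: Q_def)
    then show "x = y" using 1 by simp
  qed
  have blpr: "bounded_linear pr" using lin_pr by (simp add: linear_conv_bounded_linear)
  have derT: "(T has_derivative T' x) (at x)" if x: "x \<in> S" for x
  proof -
    have "pr x \<in> W" using x AW by (auto simp: S_def)
    have "((\<lambda>x. \<tau> (pr x)) has_derivative (\<lambda>h. D\<tau> (pr x) (pr h))) (at x)"
      by (rule has_derivative_compose[OF bounded_linear_imp_has_derivative[OF blpr] d\<tau>[OF \<open>pr x \<in> W\<close>]])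
    moreover have "((\<lambda>x. Q (x - pr x)) has_derivative (\<lambda>h. Q (h - pr h))) (at x)"
    proof (rule bounded_linear_imp_has_derivative)
      have "bounded_linear Q" using linQ by (simp add: linear_conv_bounded_linear)
      then show "bounded_linear (\<lambda>x. Q (x - pr x))"
        by (rule bounded_linear_compose) (intro bounded_linear_sub bounded_linear_ident blpr)
    qed
    ultimately show ?thesis unfolding T_def T'_def by (rule has_derivative_add)
  qed
  define l where "l = (\<lambda>x. sqrt (gram_det K \<phi> (pr x)))"
  define h where "h = (\<lambda>y. sqrt (gram_det K' \<phi>' (pr' y)))"
  have l: "l x = \<bar>det (matrix (T' x))\<bar> * h (T x)" if x: "x \<in> S" for x
  proof -
    have prx: "pr x \<in> A" "pr x \<in> W" "pr x \<in> V" "pr x \<in> coord_subspace K" using x AW A by (auto simp: S_def)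
    have lin\<phi>: "linear (frechet_derivative \<phi> (at (pr x)))" by (rule has_derivative_linear[OF d\<phi>[OF prx(3)]])
    have lin\<phi>': "linear (frechet_derivative \<phi>' (at (\<tau> (pr x))))"
      by (rule has_derivative_linear[OF d\<phi>'[OF \<phi>\<tau>(2)[OF prx(2)]]])
    have linT': "linear (T' x)" by (rule has_derivative_linear[OF derT[OF x]])
    have prT': "pr' (T' x k) = D\<tau> (pr x) (pr k)" for k
    proof -
      have "D\<tau> (pr x) (pr k) \<in> coord_subspace K'" using D\<tau>K[OF prx(2,4)] by (simp add: pr_def)
      then show ?thesis by (simp add: T'_def linear_add[OF lin_pr(2)] prQ) (simp add: pr'_def)
    qed
    \<comment> \<open>\<open>G1\<close> is \<open>gram_map\<close> with its second component moved
      by the isometry \<open>Q\<close>. Its Gram determinant is unchanged, but unlike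
      \<open>gram_map\<close> it factors through \<open>T' x\<close>, so the squared Jacobian comes
      out.\<close>
    define G1 where "G1 = (\<lambda>k. (frechet_derivative \<phi> (at (pr x)) (pr k), Q (k - pr k)))"
    have "gram_det K \<phi> (pr x) = det (\<chi> i j. G1 (axis i 1) \<bullet> G1 (axis j 1))"
      by (subst gram_det_gram_map[OF lin\<phi>]) (simp add: gram_map_def G1_def innerQ pr_def)
    also have "\<dots> = (det (matrix (T' x)))\<^sup>2 * det (\<chi> i j. gram_map K' (frechet_derivative \<phi>' (at (\<tau> (pr x)))) (axis i 1)
        \<bullet> gram_map K' (frechet_derivative \<phi>' (at (\<tau> (pr x)))) (axis j 1))"
    proof (rule det_gram_compose[OF bounded_linear_gram_map[OF lin\<phi>'] linT'])
      fix k
      have "T' x k - pr' (T' x k) = Q (k - pr k)" unfolding prT' by (simp add: T'_def)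
      then show "G1 k = gram_map K' (frechet_derivative \<phi>' (at (\<tau> (pr x)))) (T' x k)"
        using prT'[of k] chain[OF prx(2)] by (simp add: G1_def gram_map_def pr'_def)
    qed
    also have "\<dots> = (det (matrix (T' x)))\<^sup>2 * gram_det K' \<phi>' (\<tau> (pr x))"
      by (simp add: gram_det_gram_map[OF lin\<phi>'])
    finally show ?thesis
      using prT[OF prx(1)] by (simp add: l_def h_def real_sqrt_mult)
  qed
  have [measurable]: "pr \<in> borel_measurable borel" "pr' \<in> borel_measurable borel"
    by (simp_all add: pr_def pr'_def)
  have [measurable]: "A \<in> sets borel" "A' \<in> sets borel" by fact+
  have Sm[measurable]: "S \<in> sets borel" "S' \<in> sets borel" unfolding S_def S'_def by measurable
  have ml: "(\<lambda>x. indicator S x * l x) \<in> borel_measurable borel"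
  proof -
    have [measurable]: "(\<lambda>v. indicator A v * sqrt (gram_det K \<phi> v)) \<in> borel_measurable borel"
      using A by (intro slice_chart_sqrt_gram_measurable[OF c]) auto
    have "(\<lambda>x. indicator S x * (indicator A (pr x) * sqrt (gram_det K \<phi> (pr x)))) \<in> borel_measurable borel" by measurable
    moreover have "(\<lambda>x. indicator S x * (indicator A (pr x) * sqrt (gram_det K \<phi> (pr x)))) = (\<lambda>x. indicator S x * l x)"
      by (auto simp: S_def l_def indicator_def)
    ultimately show ?thesis by simp
  qed
  have mh: "(\<lambda>x. indicator S' x * h x) \<in> borel_measurable borel"
  proof -
    have [measurable]: "(\<lambda>v. indicator A' v * sqrt (gram_det K' \<phi>' v)) \<in> borel_measurable borel"
      using A' by (intro slice_chart_sqrt_gram_measurable[OF c']) auto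
    have "(\<lambda>x. indicator S' x * (indicator A' (pr' x) * sqrt (gram_det K' \<phi>' (pr' x)))) \<in> borel_measurable borel" by measurable
    moreover have "(\<lambda>x. indicator S' x * (indicator A' (pr' x) * sqrt (gram_det K' \<phi>' (pr' x)))) = (\<lambda>x. indicator S' x * h x)"
      by (auto simp: S'_def h_def indicator_def)
    ultimately show ?thesis by simp
  qed
  have "(\<integral>\<^sup>+x\<in>A. ennreal (sqrt (gram_det K \<phi> x)) \<partial>coord_lborel K) = (\<integral>\<^sup>+x. ennreal (indicator S x * l x) \<partial>lborel)"
    unfolding S_def l_def pr_def using A by (intro nn_integral_chart_eq_lborel[OF c]) auto
  also have "\<dots> = (\<integral>\<^sup>+y. ennreal (indicator (T ` S) y * h y) \<partial>lborel)"
  proof (rule nn_integral_change_of_variables[OF Sm(1) _ injT _ l ml])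
    show "(T has_derivative T' x) (at x within S)" if "x \<in> S" for x
      by (rule has_derivative_at_withinI[OF derT[OF that]])
    show "0 \<le> h (T x)" if "x \<in> S" for x
    proof -
      have "pr' (T x) \<in> A'" using TS that by (auto simp: S'_def)
      then have "pr' (T x) \<in> V'" using A' by auto
      then show ?thesis using gram_det_pos[OF c'] by (simp add: h_def less_imp_le)
    qed
    show "(\<lambda>y. indicator (T ` S) y * h y) \<in> borel_measurable borel" unfolding TS by (rule mh)
  qed
  also have "\<dots> = (\<integral>\<^sup>+x\<in>A'. ennreal (sqrt (gram_det K' \<phi>' x)) \<partial>coord_lborel K')"
    unfolding TS S'_def h_def pr'_def using A' by (intro nn_integral_chart_eq_lborel[OF c', symmetric]) auto
  finally show ?thesis .
qed

section \<open>Existence and uniqueness of the Riemannian volume\<close>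

lemma closed_submanifold_finite_atlas:
  fixes M :: "(real^'n::finite) set"
  assumes "closed_submanifold m M"
  obtains N :: nat and K V \<phi> where "\<And>i. i < N \<Longrightarrow> slice_chart m M (K i) (V i) (\<phi> i)" "M \<subseteq> (\<Union>i<N. \<phi> i ` V i)"
proof -
  define \<C> where "\<C> = {c. case c of (K, V, \<phi>) \<Rightarrow> slice_chart m M K V \<phi>}"
  define Oc where "Oc = (\<lambda>c :: 'n set \<times> (real^'n) set \<times> (real^'n \<Rightarrow> real^'n). snd (snd c) ` fst (snd c))"
  have "compact M" using assms by (simp add: closed_submanifold_def)
  have cov: "M \<subseteq> (\<Union>c\<in>\<C>. Oc c)"
  proof
    fix p assume "p \<in> M"
    then obtain K V \<phi> where "slice_chart m M K V \<phi>" "p \<in> \<phi> ` V"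
      using assms unfolding closed_submanifold_def by blast
    then show "p \<in> (\<Union>c\<in>\<C>. Oc c)" by (intro UN_I[of "(K, V, \<phi>)"]) (simp_all add: \<C>_def Oc_def)
  qed
  have "\<And>c. c \<in> \<C> \<Longrightarrow> open (Oc c)" by (auto simp: \<C>_def Oc_def slice_chart_def)
  then obtain D where D: "D \<subseteq> \<C>" "finite D" "M \<subseteq> (\<Union>c\<in>D. Oc c)"
    using compactE_image[OF \<open>compact M\<close> _ cov] by metis
  obtain xs where xs: "set xs = D" using finite_list[OF D(2)] by blast
  show thesis
  proof (rule that[of "length xs" "\<lambda>i. fst (xs ! i)" "\<lambda>i. fst (snd (xs ! i))" "\<lambda>i. snd (snd (xs ! i))"])
    fix i assume "i < length xs"
    then have "xs ! i \<in> \<C>" using xs D(1) nth_mem by blast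
    then show "slice_chart m M (fst (xs ! i)) (fst (snd (xs ! i))) (snd (snd (xs ! i)))"
      by (auto simp: \<C>_def)
  next
    show "M \<subseteq> (\<Union>i<length xs. snd (snd (xs ! i)) ` fst (snd (xs ! i)))"
    proof
      fix y assume "y \<in> M"
      then obtain c where c: "c \<in> set xs" "y \<in> Oc c" using D(3) xs by auto
      then obtain i where "i < length xs" "xs ! i = c" by (auto simp: in_set_conv_nth)
      then show "y \<in> (\<Union>i<length xs. snd (snd (xs ! i)) ` fst (snd (xs ! i)))"
        using c(2) by (intro UN_I[of i]) (auto simp: Oc_def)
    qed
  qed
qed

lemma closed_submanifold_borel: "closed_submanifold m M \<Longrightarrow> M \<in> sets borel"
  by (auto simp: closed_submanifold_def intro: borel_compact)

text \<open>Each point of \<open>M\<close> is credited to the first chart that covers it; the pieces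
  are disjoint, and no partition of unity is required.\<close>

definition chart_piece :: "(nat \<Rightarrow> 'n::finite set) \<Rightarrow> (nat \<Rightarrow> (real^'n) set) \<Rightarrow> (nat \<Rightarrow> real^'n \<Rightarrow> real^'n) \<Rightarrow> (real^'n) set \<Rightarrow> nat \<Rightarrow> (real^'n) set" where
  "chart_piece K V \<phi> M i = (\<phi> i ` V i \<inter> M) - (\<Union>j<i. \<phi> j ` V j)"

definition piece_volume :: "'n::finite set \<Rightarrow> (real^'n) set \<Rightarrow> (real^'n \<Rightarrow> real^'n) \<Rightarrow> (real^'n) set \<Rightarrow> ennreal" where
  "piece_volume K V \<phi> B = (\<integral>\<^sup>+x\<in>{v \<in> V \<inter> coord_subspace K. \<phi> v \<in> B}. ennreal (sqrt (gram_det K \<phi> x)) \<partial>coord_lborel K)"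

lemma piece_volume_measure:
  assumes c: "slice_chart m M K V \<phi>" and A: "range A \<subseteq> sets borel" "disjoint_family A"
  shows "(\<Sum>k. piece_volume K V \<phi> (A k)) = piece_volume K V \<phi> (\<Union>k. A k)"
proof -
  let ?P = "\<lambda>B. {v \<in> V \<inter> coord_subspace K. \<phi> v \<in> B}"
  have mA: "?P (A k) \<in> sets borel" for k using A by (intro slice_chart_preimage_borel[OF c]) auto
  have e: "(\<integral>\<^sup>+x\<in>?P B. ennreal (sqrt (gram_det K \<phi> x)) \<partial>coord_lborel K)
     = (\<integral>\<^sup>+x. ennreal (indicator (?P B) x * sqrt (gram_det K \<phi> x)) \<partial>coord_lborel K)" for B
    by (intro nn_integral_cong) (auto simp: indicator_def)
  have "(\<Sum>k. piece_volume K V \<phi> (A k)) = (\<Sum>k. \<integral>\<^sup>+x. ennreal (indicator (?P (A k)) x * sqrt (gram_det K \<phi> x)) \<partial>coord_lborel K)"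
    by (simp only: piece_volume_def e)
  also have "\<dots> = (\<integral>\<^sup>+x. (\<Sum>k. ennreal (indicator (?P (A k)) x * sqrt (gram_det K \<phi> x))) \<partial>coord_lborel K)"
    using slice_chart_sqrt_gram_measurable[OF c mA] by (intro nn_integral_suminf[symmetric]) auto
  also have "\<dots> = (\<integral>\<^sup>+x. ennreal (indicator (?P (\<Union>k. A k)) x * sqrt (gram_det K \<phi> x)) \<partial>coord_lborel K)"
  proof (intro nn_integral_cong)
    fix x
    have d: "disjoint_family (\<lambda>k. ?P (A k))" using A(2) by (auto simp: disjoint_family_on_def)
    have "(\<Sum>k. ennreal (indicator (?P (A k)) x * sqrt (gram_det K \<phi> x))) = (\<Sum>k. indicator (?P (A k)) x * ennreal (sqrt (gram_det K \<phi> x)))"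
      by (intro arg_cong[where f=suminf] ext) (auto simp: indicator_def)
    also have "\<dots> = (\<Sum>k. indicator (?P (A k)) x) * ennreal (sqrt (gram_det K \<phi> x))"
      by simp
    also have "(\<Sum>k. indicator (?P (A k)) x :: ennreal) = indicator (\<Union>k. ?P (A k)) x"
      by (rule suminf_indicator[OF d])
    also have "(\<Union>k. ?P (A k)) = ?P (\<Union>k. A k)" by auto
    also have "indicator (?P (\<Union>k. A k)) x * ennreal (sqrt (gram_det K \<phi> x)) = ennreal (indicator (?P (\<Union>k. A k)) x * sqrt (gram_det K \<phi> x))"
      by (auto simp: indicator_def)
    finally show "(\<Sum>k. ennreal (indicator (?P (A k)) x * sqrt (gram_det K \<phi> x))) = ennreal (indicator (?P (\<Union>k. A k)) x * sqrt (gram_det K \<phi> x))" .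
  qed
  finally show ?thesis by (simp only: piece_volume_def e)
qed

lemma image_chart_preimage:
  assumes c: "slice_chart m M K V \<phi>" and B: "B \<subseteq> \<phi> ` V \<inter> M"
  shows "\<phi> ` {v \<in> V \<inter> coord_subspace K. \<phi> v \<in> B} = B"
proof -
  have "B \<subseteq> \<phi> ` (V \<inter> coord_subspace K)" using c B by (simp add: slice_chart_def)
  then show ?thesis by auto
qed

context
  fixes m :: nat and M :: "(real^'n::finite) set" and N :: nat and K V \<phi>
  assumes M: "M \<in> sets borel" and charts: "\<And>i. i < N \<Longrightarrow> slice_chart m M (K i) (V i) (\<phi> i)"
    and cover: "M \<subseteq> (\<Union>i<N. \<phi> i ` V i)"
begin

abbreviation "Pc i \<equiv> chart_piece K V \<phi> M i"
abbreviation "vol B \<equiv> (\<Sum>i<N. piece_volume (K i) (V i) (\<phi> i) (Pc i \<inter> B))"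

lemma chart_piece_borel: "i < N \<Longrightarrow> Pc i \<in> sets borel"
proof -
  assume "i < N"
  then have "open (\<phi> j ` V j)" if "j \<le> i" for j using charts[of j] that by (auto simp: slice_chart_def)
  then show ?thesis unfolding chart_piece_def using M by (intro sets.Diff sets.Int sets.finite_UN) auto
qed

lemma chart_piece_disjoint: "disjoint_family_on Pc {..<N}"
  unfolding disjoint_family_on_def
proof (intro ballI impI)
  fix i j :: nat assume "i \<noteq> j"
  then consider "i < j" | "j < i" by linarith
  moreover have "Pc l \<inter> Pc k = {}" if "l < k" for k l
    using that unfolding chart_piece_def by (blast intro: lessThan_iff[THEN iffD2])
  ultimately show "Pc i \<inter> Pc j = {}" by cases blast+
qed

lemma chart_piece_cover: "(\<Union>i<N. Pc i) = M"
proof (intro equalityI subsetI)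
  fix y assume y: "y \<in> M"
  define i where "i = (LEAST i. y \<in> \<phi> i ` V i)"
  obtain k where k: "k < N" "y \<in> \<phi> k ` V k" using cover y by auto
  have "y \<in> \<phi> i ` V i" unfolding i_def by (rule LeastI) (rule k(2))
  moreover have "i < N" using Least_le[of "\<lambda>i. y \<in> \<phi> i ` V i" k] k by (simp add: i_def)
  moreover have "y \<notin> \<phi> j ` V j" if "j < i" for j using not_less_Least that unfolding i_def by blast
  ultimately show "y \<in> (\<Union>i<N. Pc i)" using y by (auto simp: chart_piece_def)
qed (auto simp: chart_piece_def)

text \<open>Additivity over the pieces reduces the volume to the chart condition on each of them.
  The right side involves only the atlas, which proves uniqueness, and it also serves as the
  definition in the existence proof.\<close>

lemma riemannian_volume_formula:
  assumes vol: "is_riemannian_volume m M \<mu>" and B: "B \<in> sets borel" "B \<subseteq> M"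
  shows "emeasure \<mu> B = vol B"
proof -
  have sets: "sets \<mu> = sets (restrict_space borel M)" using vol by (simp add: is_riemannian_volume_def)
  have "B = (\<Union>i<N. Pc i \<inter> B)" using chart_piece_cover B by auto
  then have "emeasure \<mu> B = emeasure \<mu> (\<Union>i<N. Pc i \<inter> B)" by simp
  also have "\<dots> = (\<Sum>i<N. emeasure \<mu> (Pc i \<inter> B))"
  proof (rule sum_emeasure[symmetric])
    show "(\<lambda>i. Pc i \<inter> B) ` {..<N} \<subseteq> sets \<mu>"
      unfolding sets using chart_piece_borel B M by (auto simp: sets_restrict_space_iff)
    show "disjoint_family_on (\<lambda>i. Pc i \<inter> B) {..<N}" using chart_piece_disjoint by (auto simp: disjoint_family_on_def)
  qed auto
  also have "\<dots> = vol B"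
  proof (rule sum.cong)
    fix i assume "i \<in> {..<N}"
    then have i: "i < N" by simp
    have im: "\<phi> i ` {v \<in> V i \<inter> coord_subspace (K i). \<phi> i v \<in> Pc i \<inter> B} = Pc i \<inter> B"
      by (rule image_chart_preimage[OF charts[OF i]]) (auto simp: chart_piece_def)
    have "emeasure \<mu> (\<phi> i ` {v \<in> V i \<inter> coord_subspace (K i). \<phi> i v \<in> Pc i \<inter> B}) = piece_volume (K i) (V i) (\<phi> i) (Pc i \<inter> B)"
      unfolding piece_volume_def
      using vol[unfolded is_riemannian_volume_def, THEN conjunct2, rule_format, OF charts[OF i]
          slice_chart_preimage_borel[OF charts[OF i], of "Pc i \<inter> B"]] chart_piece_borel[OF i] B
      by auto
    then show "emeasure \<mu> (Pc i \<inter> B) = piece_volume (K i) (V i) (\<phi> i) (Pc i \<inter> B)" unfolding im .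
  qed simp
  finally show ?thesis .
qed

lemma riemannian_volume_unique:
  assumes "is_riemannian_volume m M \<mu>" "is_riemannian_volume m M \<mu>'"
  shows "\<mu> = \<mu>'"
proof (rule measure_eqI)
  show "sets \<mu> = sets \<mu>'" using assms by (simp add: is_riemannian_volume_def)
  fix B assume "B \<in> sets \<mu>"
  then have "B \<in> sets borel" "B \<subseteq> M"
    using assms(1) M by (auto simp: is_riemannian_volume_def sets_restrict_space_iff)
  then show "emeasure \<mu> B = emeasure \<mu>' B"
    using riemannian_volume_formula assms by simp
qed

lemma riemannian_volume_exists: "\<exists>\<mu>. is_riemannian_volume m M \<mu>"
proof -
  define \<mu> where "\<mu> = measure_of M (sets (restrict_space borel M)) (\<lambda>B. vol B)"
  have sub: "sets (restrict_space borel M) \<subseteq> Pow M"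
    by (auto simp: sets_restrict_space)
  have sa: "sigma_algebra M (sets (restrict_space borel M))"
    using sets.sigma_algebra_axioms[of "restrict_space borel M"] by (simp add: space_restrict_space)
  have sets: "sets \<mu> = sets (restrict_space borel M)"
    unfolding \<mu>_def using sa sub by (simp add: sigma_algebra.sigma_sets_eq)
  have pos: "positive (sets \<mu>) (\<lambda>B. vol B)" by (simp add: positive_def piece_volume_def)
  have ca: "countably_additive (sets \<mu>) (\<lambda>B. vol B)"
  proof (rule countably_additiveI)
    fix A :: "nat \<Rightarrow> (real^'n) set" assume A: "range A \<subseteq> sets \<mu>" "disjoint_family A"
    have "(\<Sum>k. vol (A k)) = (\<Sum>i<N. \<Sum>k. piece_volume (K i) (V i) (\<phi> i) (Pc i \<inter> A k))"
      by (rule suminf_sum) simp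
    also have "\<dots> = (\<Sum>i<N. piece_volume (K i) (V i) (\<phi> i) (\<Union>k. Pc i \<inter> A k))"
    proof (intro sum.cong refl)
      fix i assume "i \<in> {..<N}"
      then have i: "i < N" by simp
      have "A k \<in> sets borel" for k
      proof -
        have "A k \<in> sets (restrict_space borel M)" using A(1) sets by blast
        then show ?thesis using M by (auto simp: sets_restrict_space_iff)
      qed
      then show "(\<Sum>k. piece_volume (K i) (V i) (\<phi> i) (Pc i \<inter> A k)) = piece_volume (K i) (V i) (\<phi> i) (\<Union>k. Pc i \<inter> A k)"
        using A(2) chart_piece_borel[OF i]
        by (intro piece_volume_measure[OF charts[OF i]]) (auto simp: disjoint_family_on_def)
    qed
    finally show "(\<Sum>k. vol (A k)) = vol (\<Union>k. A k)" by simp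
  qed
  have em: "emeasure \<mu> B = vol B" if "B \<in> sets \<mu>" for B
    by (rule emeasure_measure_of[OF \<mu>_def sub pos ca that])
  have "is_riemannian_volume m M \<mu>"
    unfolding is_riemannian_volume_def
  proof (intro conjI allI impI)
    show "sets \<mu> = sets (restrict_space borel M)" by (rule sets)
    fix L W \<theta> A assume c: "slice_chart m M L W \<theta>" and A: "A \<in> sets borel" "A \<subseteq> W \<inter> coord_subspace L"
    define B where "B = \<theta> ` A"
    have B: "B \<in> sets borel" "B \<subseteq> \<theta> ` W \<inter> M"
      using slice_chart_image_borel[OF c A(1)] A c by (auto simp: B_def slice_chart_def)
    have "B \<in> sets \<mu>" unfolding sets using B M by (auto simp: sets_restrict_space_iff)
    then have "emeasure \<mu> B = vol B" by (rule em)
    also have "\<dots> = (\<Sum>i<N. \<integral>\<^sup>+x. ennreal (indicator {v \<in> A. \<theta> v \<in> Pc i} x * sqrt (gram_det L \<theta> x)) \<partial>coord_lborel L)"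
    proof (intro sum.cong refl)
      fix i assume "i \<in> {..<N}"
      then have i: "i < N" by simp
      have mA: "{v \<in> A. \<theta> v \<in> Pc i} \<in> sets borel"
      proof -
        have "{v \<in> A. \<theta> v \<in> Pc i} = A \<inter> {v \<in> W \<inter> coord_subspace L. \<theta> v \<in> Pc i}" using A by auto
        then show ?thesis using A slice_chart_preimage_borel[OF c chart_piece_borel[OF i]] by auto
      qed
      \<comment> \<open>Independence of the chart moves each piece from its atlas chart to the given
        chart \<theta>; the disjoint pieces then add up to all of \<open>A\<close>.\<close>
      have "piece_volume (K i) (V i) (\<phi> i) (Pc i \<inter> B) = (\<integral>\<^sup>+x\<in>{v \<in> A. \<theta> v \<in> Pc i}. ennreal (sqrt (gram_det L \<theta> x)) \<partial>coord_lborel L)"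
        unfolding piece_volume_def
      proof (rule chart_volume_independent[OF charts[OF i] c])
        show "{v \<in> V i \<inter> coord_subspace (K i). \<phi> i v \<in> Pc i \<inter> B} \<in> sets borel"
          using chart_piece_borel[OF i] B by (intro slice_chart_preimage_borel[OF charts[OF i]]) auto
        show "{v \<in> A. \<theta> v \<in> Pc i} \<subseteq> W \<inter> coord_subspace L" using A by auto
        have "\<phi> i ` {v \<in> V i \<inter> coord_subspace (K i). \<phi> i v \<in> Pc i \<inter> B} = Pc i \<inter> B"
          by (rule image_chart_preimage[OF charts[OF i]]) (auto simp: chart_piece_def)
        also have "\<dots> = \<theta> ` {v \<in> A. \<theta> v \<in> Pc i}" by (auto simp: B_def)
        finally show "\<phi> i ` {v \<in> V i \<inter> coord_subspace (K i). \<phi> i v \<in> Pc i \<inter> B} = \<theta> ` {v \<in> A. \<theta> v \<in> Pc i}" .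
      qed (use mA in auto)
      also have "\<dots> = (\<integral>\<^sup>+x. ennreal (indicator {v \<in> A. \<theta> v \<in> Pc i} x * sqrt (gram_det L \<theta> x)) \<partial>coord_lborel L)"
        by (intro nn_integral_cong) (auto simp: indicator_def)
      finally show "piece_volume (K i) (V i) (\<phi> i) (Pc i \<inter> B) = (\<integral>\<^sup>+x. ennreal (indicator {v \<in> A. \<theta> v \<in> Pc i} x * sqrt (gram_det L \<theta> x)) \<partial>coord_lborel L)" .
    qed
    also have "\<dots> = (\<integral>\<^sup>+x. (\<Sum>i<N. ennreal (indicator {v \<in> A. \<theta> v \<in> Pc i} x * sqrt (gram_det L \<theta> x))) \<partial>coord_lborel L)"
    proof (rule nn_integral_sum[symmetric])
      fix i assume "i \<in> {..<N}"
      then have i: "i < N" by simp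
      have "{v \<in> A. \<theta> v \<in> Pc i} = A \<inter> {v \<in> W \<inter> coord_subspace L. \<theta> v \<in> Pc i}" using A by auto
      then have mA: "{v \<in> A. \<theta> v \<in> Pc i} \<in> sets borel" using A slice_chart_preimage_borel[OF c chart_piece_borel[OF i]] by auto
      have "{v \<in> A. \<theta> v \<in> Pc i} \<subseteq> W" using A by auto
      from slice_chart_sqrt_gram_measurable[OF c mA this]
      show "(\<lambda>x. ennreal (indicator {v \<in> A. \<theta> v \<in> Pc i} x * sqrt (gram_det L \<theta> x))) \<in> borel_measurable (coord_lborel L)"
        by auto
    qed
    also have "\<dots> = (\<integral>\<^sup>+x\<in>A. ennreal (sqrt (gram_det L \<theta> x)) \<partial>coord_lborel L)"
    proof (intro nn_integral_cong)
      fix x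
      show "(\<Sum>i<N. ennreal (indicator {v \<in> A. \<theta> v \<in> Pc i} x * sqrt (gram_det L \<theta> x))) = ennreal (sqrt (gram_det L \<theta> x)) * indicator A x"
      proof (cases "x \<in> A")
        case True
        then have "\<theta> x \<in> M" using B(2) by (auto simp: B_def)
        then obtain i where i: "i < N" "\<theta> x \<in> Pc i" using chart_piece_cover by auto
        have "(\<Sum>j<N. ennreal (indicator {v \<in> A. \<theta> v \<in> Pc j} x * sqrt (gram_det L \<theta> x)))
            = (\<Sum>j<N. if j = i then ennreal (sqrt (gram_det L \<theta> x)) else 0)"
        proof (intro sum.cong refl)
          fix j assume "j \<in> {..<N}"
          then show "ennreal (indicator {v \<in> A. \<theta> v \<in> Pc j} x * sqrt (gram_det L \<theta> x)) = (if j = i then ennreal (sqrt (gram_det L \<theta> x)) else 0)"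
            using True i chart_piece_disjoint by (cases "j = i") (auto simp: disjoint_family_on_def indicator_def)
        qed
        then show ?thesis using i True by simp
      qed simp
    qed
    finally show "emeasure \<mu> (\<theta> ` A) = (\<integral>\<^sup>+x\<in>A. ennreal (sqrt (gram_det L \<theta> x)) \<partial>coord_lborel L)"
      by (simp add: B_def)
  qed
  then show ?thesis ..
qed

end

lemma is_riemannian_volume_riemannian_volume:
  fixes M :: "(real^'n::finite) set"
  assumes "closed_submanifold m M"
  shows "is_riemannian_volume m M (riemannian_volume m M)"
proof -
  obtain N :: nat and K V \<phi> where a: "\<And>i. i < N \<Longrightarrow> slice_chart m M (K i) (V i) (\<phi> i)" "M \<subseteq> (\<Union>i<N. \<phi> i ` V i)"
    using closed_submanifold_finite_atlas[OF assms] by metis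
  note M = closed_submanifold_borel[OF assms]
  obtain \<mu> where \<mu>: "is_riemannian_volume m M \<mu>"
    using riemannian_volume_exists[OF M a] by blast
  show ?thesis unfolding riemannian_volume_def
    by (rule theI[of _ \<mu>]) (use \<mu> riemannian_volume_unique[OF M a] in blast)+
qed

section \<open>Analytic continuation and finite parts of radial integrals\<close>

text \<open>The value 0 at \<open>r = 0\<close> agrees with \<open>0 powr z = 0\<close> on the
  diagonal, and an atom of the distance distribution at 0 never contributes.\<close>

definition radial_powr :: "complex \<Rightarrow> real \<Rightarrow> complex" where
  "radial_powr z r = indicator {0<..} r *\<^sub>R (complex_of_real r powr z)"

lemma norm_radial_powr: "norm (radial_powr z r) = indicator {0<..} r * r powr Re z"
  by (auto simp: radial_powr_def indicator_def norm_powr_real_powr)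

lemma radial_powr_nonneg: "0 \<le> r \<Longrightarrow> radial_powr z r = complex_of_real r powr z"
  by (cases "r = 0") (auto simp: radial_powr_def)

lemma borel_measurable_radial_powr [measurable]: "radial_powr z \<in> borel_measurable borel"
  unfolding radial_powr_def[abs_def]
  by (rule borel_measurable_continuous_on_indicator) (auto intro!: continuous_intros simp: complex_nonpos_Reals_iff)

text \<open>Differentiating \<open>r powr z\<close> in \<open>z\<close> brings in
  \<open>ln r\<close>; it is absorbed by giving up \<open>e\<close> in the exponent on either
  side.\<close>

lemma abs_ln_le_powr:
  assumes "r > 0" "e > (0::real)"
  shows "\<bar>ln r\<bar> \<le> (1 / e) * (r powr e + r powr (- e))"
proof -
  have "e * ln r \<le> r powr e" "- e * ln r \<le> r powr (- e)"
    using ln_bound[of "r powr e"] ln_bound[of "r powr (- e)"] assms by (auto simp: ln_powr)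
  moreover have "r powr e \<ge> 0" "r powr (- e) \<ge> 0" by auto
  ultimately have "e * \<bar>ln r\<bar> \<le> r powr e + r powr (- e)"
    by (auto simp: abs_if intro: add_increasing add_increasing2)
  then show ?thesis using assms by (simp add: field_simps)
qed

lemma powr_le_sum:
  assumes "r > (0::real)" "a \<le> x" "x \<le> b" shows "r powr x \<le> r powr a + r powr b"
proof (cases "r \<le> 1")
  case True
  then have "r powr x \<le> r powr a" using assms by (intro powr_mono') auto
  moreover have "r powr b \<ge> 0" by simp
  ultimately show ?thesis by linarith
next
  case False
  then have "r powr x \<le> r powr b" using assms by (intro powr_mono) auto
  moreover have "r powr a \<ge> 0" by simp
  ultimately show ?thesis by linarith
qed

context
  fixes N :: "real measure" and h :: "real \<Rightarrow> real" and s0 :: real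
  assumes sets_N [measurable_cong]: "sets N = sets borel" and h [measurable]: "h \<in> borel_measurable borel"
    and int: "\<And>s. s > s0 \<Longrightarrow> integrable N (\<lambda>r. indicator {0<..} r * (\<bar>h r\<bar> * r powr s))"
begin

lemma integrable_radial_powr: "Re z > s0 \<Longrightarrow> integrable N (\<lambda>r. h r *\<^sub>R radial_powr z r)"
proof (rule Bochner_Integration.integrable_bound[OF int])
  show "AE r in N. norm (h r *\<^sub>R radial_powr z r) \<le> norm (indicator {0<..} r * (\<bar>h r\<bar> * r powr Re z))"
    by (rule AE_I2) (auto simp: norm_radial_powr indicator_def abs_mult)
qed auto

lemma holomorphic_pw_integral: "(\<lambda>z. \<integral>r. h r *\<^sub>R radial_powr z r \<partial>N) holomorphic_on {z. Re z > s0}"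
proof -
  have "\<exists>D. ((\<lambda>z. \<integral>r. h r *\<^sub>R radial_powr z r \<partial>N) has_field_derivative D) (at z0)" if z0: "Re z0 > s0" for z0
  proof -
    \<comment> \<open>A third of the distance to the boundary: the disc uses one \<open>e\<close>,
      the logarithm another, and the smallest exponent \<open>a - e = s0 + e\<close> is still
      admissible.\<close>
    define e where "e = (Re z0 - s0) / 3"
    have e: "e > 0" using z0 by (simp add: e_def)
    define a b where "a = Re z0 - e" and "b = Re z0 + e"
    have "3 * e = Re z0 - s0" by (simp add: e_def)
    then have ab: "a - e > s0" "a + e > s0" "b - e > s0" "b + e > s0" using e unfolding a_def b_def by linarith+
    define w where "w = (\<lambda>r. (1 / e) * (indicator {0<..} r * (\<bar>h r\<bar> * r powr (a - e)) + indicator {0<..} r * (\<bar>h r\<bar> * r powr (a + e))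
       + indicator {0<..} r * (\<bar>h r\<bar> * r powr (b - e)) + indicator {0<..} r * (\<bar>h r\<bar> * r powr (b + e))))"
    define S where "S = ball z0 e"
    have S: "z0 \<in> S" "convex S" "open S" using e by (auto simp: S_def)
    have Re: "a \<le> Re z" "Re z \<le> b" if "z \<in> S" for z
    proof -
      have "\<bar>Re (z - z0)\<bar> < e" using that abs_Re_le_cmod[of "z - z0"] by (simp add: S_def dist_norm norm_minus_commute)
      then show "a \<le> Re z" "Re z \<le> b" by (auto simp: a_def b_def)
    qed
    have "((\<lambda>z. \<integral>r. h r *\<^sub>R radial_powr z r \<partial>N) has_field_derivative (\<integral>r. h r *\<^sub>R (complex_of_real (ln r) * radial_powr z0 r) \<partial>N)) (at z0 within S)"
    proof (rule has_field_derivative_integral[OF S(2,1), where w=w])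
      show "integrable N (\<lambda>r. h r *\<^sub>R radial_powr z r)" if "z \<in> S" for z
        using Re(1)[OF that] ab e by (intro integrable_radial_powr) auto
      show "integrable N w" unfolding w_def using ab
        by (intro integrable_mult_right Bochner_Integration.integrable_add int)
      show "((\<lambda>z. h r *\<^sub>R radial_powr z r) has_field_derivative h r *\<^sub>R (complex_of_real (ln r) * radial_powr z r)) (at z within S)" for z r
      proof (cases "r > 0")
        case True
        have "((\<lambda>z. complex_of_real r powr z) has_field_derivative Ln (complex_of_real r) * complex_of_real r powr z) (at z)"
          using True by (intro has_field_derivative_powr_right) auto
        from DERIV_cmult[OF this, of "complex_of_real (h r)"] show ?thesis
          using True by (auto simp: radial_powr_def scaleR_conv_of_real Ln_of_real intro: has_field_derivative_at_within)
      qed (simp add: radial_powr_def)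
      show "norm (h r *\<^sub>R (complex_of_real (ln r) * radial_powr z r)) \<le> w r" if "z \<in> S" for z r
      proof (cases "r > 0")
        case True
        have "\<bar>ln r\<bar> * r powr Re z \<le> ((1 / e) * (r powr e + r powr (- e))) * (r powr a + r powr b)"
          using abs_ln_le_powr[OF True e] powr_le_sum[OF True Re[OF that]] by (intro mult_mono) (auto simp: e less_imp_le)
        then have "\<bar>h r\<bar> * (\<bar>ln r\<bar> * r powr Re z) \<le> \<bar>h r\<bar> * (((1 / e) * (r powr e + r powr (- e))) * (r powr a + r powr b))"
          by (intro mult_left_mono) auto
        also have "\<dots> = w r"
          using True by (simp add: w_def powr_diff powr_add powr_minus field_simps)
        finally show ?thesis using True by (simp add: norm_mult norm_radial_powr)
      qed (simp add: radial_powr_def w_def)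
    qed auto
    then show ?thesis using at_within_open[OF S(1,3)] by auto
  qed
  then show ?thesis
    unfolding holomorphic_on_def field_differentiable_def by (auto intro: has_field_derivative_at_within)
qed

end

section \<open>Measures on the half-line with a smooth distribution function near 0\<close>

lemma integrable_powr_Ioc:
  fixes a \<delta> :: real
  assumes "a > -1" "\<delta> \<ge> 0"
  shows "integrable lborel (\<lambda>r. indicator {0<..\<delta>} r * r powr a)"
proof -
  have "(\<integral>\<^sup>+r. ennreal (r powr a) * indicator {0..\<delta>} r \<partial>lborel) = ennreal (\<delta> powr (a + 1) / (a + 1))"
    by (rule nn_integral_has_integral_lebesgue'[OF _ has_integral_powr_from_0]) (use assms in auto)
  moreover have "(\<integral>\<^sup>+r. ennreal (norm (indicator {0<..\<delta>} r * r powr a)) \<partial>lborel) \<le> (\<integral>\<^sup>+r. ennreal (r powr a) * indicator {0..\<delta>} r \<partial>lborel)"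
    by (intro nn_integral_mono) (auto simp: indicator_def)
  ultimately have "(\<integral>\<^sup>+r. ennreal (norm (indicator {0<..\<delta>} r * r powr a)) \<partial>lborel) < \<infinity>"
    by (simp add: order_le_less_trans)
  then show ?thesis by (intro integrableI_bounded) auto
qed

text \<open>An abstraction of the distribution of distances: \<open>\<Gamma> 0\<close> stands for
  \<psi>_M near 0 and \<open>\<Gamma> k\<close> for its derivatives, one-sided at 0. An atom of mass
  \<open>\<Gamma> 0 0\<close> at 0 is permitted, and geometry enters only through
  \<open>parity\<close>.\<close>

locale radial_measure = finite_measure \<nu> for \<nu> :: "real measure" +
  fixes D d :: real and \<Gamma> :: "nat \<Rightarrow> real \<Rightarrow> real" and C :: "nat \<Rightarrow> real" and m :: nat
  assumes sets_nu [measurable_cong, simp]: "sets \<nu> = sets borel"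
    and range_nu: "AE r in \<nu>. 0 \<le> r \<and> r \<le> D"
    and d_pos: "d > 0"
    and cdf: "\<And>t. 0 \<le> t \<Longrightarrow> t < d \<Longrightarrow> measure \<nu> {..t} = \<Gamma> 0 t"
    and der: "\<And>k t. 0 \<le> t \<Longrightarrow> t < d \<Longrightarrow> (\<Gamma> k has_real_derivative \<Gamma> (Suc k) t) (at t within {0..<d})"
    and bnd: "\<And>k t. 0 \<le> t \<Longrightarrow> t < d \<Longrightarrow> \<bar>\<Gamma> k t\<bar> \<le> C k"
    and parity: "\<And>k. \<Gamma> k 0 \<noteq> 0 \<Longrightarrow> \<exists>i. k = m + 2 * i"
begin

definition \<delta> where "\<delta> = d / 2"
text \<open>For \<open>j \<ge> 1\<close> this is the coefficient of \<open>r ^ (j - 1)\<close> in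
  the Taylor polynomial of the density \<open>\<Gamma> 1\<close>, that is, \<open>j\<close> times
  the \<open>j\<close>-th Taylor coefficient of \<open>\<Gamma> 0\<close>. It is also the factor of
  the counterterm of index \<open>j\<close>.\<close>

definition c :: "nat \<Rightarrow> real" where "c j = \<Gamma> j 0 / fact (j - 1)"
definition Rem :: "nat \<Rightarrow> real \<Rightarrow> real" where "Rem k r = \<Gamma> 1 r - (\<Sum>j=1..k. c j * r ^ (j - 1))"
definition rz :: "real \<Rightarrow> complex \<Rightarrow> complex" where "rz \<epsilon> z = (\<integral>r. indicator {\<epsilon><..} r *\<^sub>R radial_powr z r \<partial>\<nu>)"
text \<open>The part common to continuation and finite part, holomorphic for
  \<open>Re z > - k - 1\<close>: distances beyond \<delta> cause no singularity, and below \<delta>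
  the density has lost its Taylor polynomial.\<close>

definition Ak :: "nat \<Rightarrow> complex \<Rightarrow> complex" where
  "Ak k z = rz \<delta> z + (\<integral>r. (indicator {0<..\<delta>} r * Rem k r) *\<^sub>R radial_powr z r \<partial>lborel)"
definition Ek :: "nat \<Rightarrow> complex \<Rightarrow> complex" where
  "Ek k z = Ak k z + (\<Sum>j=1..k. of_real (c j) * counterterm z j \<delta>)"

lemma \<delta>: "\<delta> > 0" "\<delta> < d" using d_pos by (auto simp: \<delta>_def)

lemma c_nonzero: "c j \<noteq> 0 \<Longrightarrow> \<exists>i. j = m + 2 * i"
  using parity by (auto simp: c_def)

lemma cont_Gamma: "continuous_on {0..<d} (\<Gamma> k)"
  using der by (intro DERIV_continuous_on[of _ _ "\<Gamma> (Suc k)"]) auto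

text \<open>The derivative of the remainder of order \<open>Suc k\<close> at level \<open>l\<close>
  is the remainder of order \<open>k\<close> at level \<open>Suc l\<close>, so the mean value
  inequality drives the induction. The factorial of the sharp estimate is given away.\<close>

lemma Rem_bound:
  assumes "0 \<le> r" "r < d"
  shows "\<bar>\<Gamma> l r - (\<Sum>i<k. \<Gamma> (l + i) 0 / fact i * r ^ i)\<bar> \<le> C (l + k) * r ^ k"
  using assms
proof (induction k arbitrary: l r)
  case 0
  then show ?case using bnd by simp
next
  case (Suc k)
  define h where "h = (\<lambda>r. \<Gamma> l r - (\<Sum>i<Suc k. \<Gamma> (l + i) 0 / fact i * r ^ i))"
  define h' where "h' = (\<lambda>r. \<Gamma> (Suc l) r - (\<Sum>i<k. \<Gamma> (Suc l + i) 0 / fact i * r ^ i))"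
  have "norm (h r - h 0) \<le> (C (Suc l + k) * r ^ k) * norm (r - 0)"
  proof (rule field_differentiable_bound[of "{0..r}" h h'])
    fix s assume s: "s \<in> {0..r}"
    have "C (Suc l + k) \<ge> 0" using bnd[of 0 "Suc l + k"] d_pos by (auto intro: order_trans[OF abs_ge_zero])
    then have "C (Suc l + k) * s ^ k \<le> C (Suc l + k) * r ^ k" using s by (intro mult_left_mono power_mono) auto
    then show "norm (h' s) \<le> C (Suc l + k) * r ^ k"
      using Suc.IH[of s "Suc l"] s Suc.prems by (auto simp: h'_def)
    have d1: "(\<Gamma> l has_real_derivative \<Gamma> (Suc l) s) (at s within {0..r})"
      using s Suc.prems by (intro has_field_derivative_subset[OF der]) auto
    have "((\<lambda>r. \<Sum>i<Suc k. \<Gamma> (l + i) 0 / fact i * r ^ i) has_real_derivative (\<Sum>i<Suc k. \<Gamma> (l + i) 0 / fact i * (real i * s ^ (i - 1)))) (at s within {0..r})"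
      by (rule DERIV_sum) (auto intro!: derivative_eq_intros)
    also have "(\<Sum>i<Suc k. \<Gamma> (l + i) 0 / fact i * (real i * s ^ (i - 1))) = (\<Sum>i<k. \<Gamma> (Suc l + i) 0 / fact i * s ^ i)"
    proof -
      have "\<Gamma> (l + Suc i) 0 / fact (Suc i) * (real (Suc i) * s ^ (Suc i - 1)) = \<Gamma> (Suc l + i) 0 / fact i * s ^ i" for i
        by (simp del: of_nat_Suc)
      then show ?thesis by (subst sum.lessThan_Suc_shift) simp
    qed
    finally show "(h has_field_derivative h' s) (at s within {0..r})"
      unfolding h_def h'_def using d1 by (intro DERIV_diff)
  qed (use Suc.prems in auto)
  moreover have "h 0 = 0" by (simp add: h_def sum.lessThan_Suc_shift del: sum.lessThan_Suc)
  ultimately have "\<bar>h r\<bar> \<le> (C (Suc l + k) * r ^ k) * r" using Suc.prems by simp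
  then show ?case by (simp add: h_def mult_ac del: sum.lessThan_Suc)
qed

lemma Rem_le: "0 \<le> r \<Longrightarrow> r < d \<Longrightarrow> \<bar>Rem k r\<bar> \<le> C (Suc k) * r ^ k"
proof -
  assume r: "0 \<le> r" "r < d"
  have "(\<Sum>j=1..k. c j * r ^ (j - 1)) = (\<Sum>i<k. \<Gamma> (1 + i) 0 / fact i * r ^ i)"
    by (rule sum.reindex_bij_witness[of _ Suc "\<lambda>j. j - 1"]) (auto simp: c_def)
  then show ?thesis using Rem_bound[OF r, of 1 k] by (simp add: Rem_def)
qed

lemma Gamma_0_mono: "0 \<le> s \<Longrightarrow> s \<le> t \<Longrightarrow> t < d \<Longrightarrow> \<Gamma> 0 s \<le> \<Gamma> 0 t"
  using cdf[of s] cdf[of t] finite_measure_mono[of "{..s}" "{..t}"] by auto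

text \<open>The right difference quotients of a distribution function are nonnegative. This is
  needed before \<open>\<Gamma> 1\<close> can serve as a density.\<close>

lemma Gamma_1_nonneg:
  assumes t: "0 \<le> t" "t < d" shows "0 \<le> \<Gamma> 1 t"
proof (rule tendsto_lowerbound)
  have "((\<lambda>y. (\<Gamma> 0 y - \<Gamma> 0 t) / (y - t)) \<longlongrightarrow> \<Gamma> 1 t) (at t within {0..<d})"
    using der[OF t, of 0] by (simp add: has_field_derivative_iff)
  then have "((\<lambda>y. (\<Gamma> 0 y - \<Gamma> 0 t) / (y - t)) \<longlongrightarrow> \<Gamma> 1 t) (at t within {t..(t + d) / 2})"
    by (rule tendsto_within_subset) (use t in auto)
  then show "((\<lambda>y. (\<Gamma> 0 y - \<Gamma> 0 t) / (y - t)) \<longlongrightarrow> \<Gamma> 1 t) (at_right t)"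
    using at_within_Icc_at_right[of t "(t + d) / 2"] t by simp
  have "\<forall>\<^sub>F y in at_right t. y \<in> {t<..<d}" using t by (intro eventually_at_right_real) auto
  then show "\<forall>\<^sub>F y in at_right t. 0 \<le> (\<Gamma> 0 y - \<Gamma> 0 t) / (y - t)"
    by eventually_elim (use Gamma_0_mono[of t] t in auto)
qed simp

lemma meas_Gamma [measurable]: "(\<lambda>r. indicator {0<..\<delta>} r * \<Gamma> k r) \<in> borel_measurable borel"
proof -
  have "continuous_on {0<..\<delta>} (\<Gamma> k)" by (rule continuous_on_subset[OF cont_Gamma]) (use \<delta> in auto)
  from borel_measurable_continuous_on_indicator[OF _ this] show ?thesis by simp
qed

lemma meas_Rem [measurable]: "(\<lambda>r. indicator {0<..\<delta>} r * Rem k r) \<in> borel_measurable borel"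
proof -
  have "(\<lambda>r. indicator {0<..\<delta>} r * \<Gamma> 1 r - indicator {0<..\<delta>} r * (\<Sum>j=1..k. c j * r ^ (j - 1))) \<in> borel_measurable borel"
    by measurable
  then show ?thesis by (simp add: Rem_def right_diff_distrib)
qed

text \<open>Both measures are compared on rays, where one side is an increment of the distribution
  function and the other the integral of its derivative. The interval is open at 0 so as to leave
  out a possible atom; \<open>y\<close> clips \<open>x\<close> to the range from 0 to
  \<delta>.\<close>

lemma density_nu: "density \<nu> (indicator {0<..\<delta>}) = density lborel (\<lambda>r. ennreal (indicator {0<..\<delta>} r * \<Gamma> 1 r))"
proof (rule measure_eqI_lessThan)
  fix x :: real
  define y where "y = min \<delta> (max 0 x)"
  have y: "0 \<le> y" "y \<le> \<delta>" using \<delta> by (auto simp: y_def)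
  have "emeasure (density \<nu> (indicator {0<..\<delta>})) {x<..} = emeasure \<nu> ({0<..\<delta>} \<inter> {x<..})"
    by (subst emeasure_density) (auto simp: indicator_inter_arith[symmetric] nn_integral_indicator[symmetric] simp del: nn_integral_indicator)
  also have "{0<..\<delta>} \<inter> {x<..} = {..\<delta>} - {..y}" by (auto simp: y_def)
  also have "emeasure \<nu> ({..\<delta>} - {..y}) = ennreal (\<Gamma> 0 \<delta> - \<Gamma> 0 y)"
    using y \<delta> cdf[of \<delta>] cdf[of y] by (simp add: emeasure_eq_measure finite_measure_Diff)
  finally have 1: "emeasure (density \<nu> (indicator {0<..\<delta>})) {x<..} = ennreal (\<Gamma> 0 \<delta> - \<Gamma> 0 y)" .
  have "emeasure (density lborel (\<lambda>r. ennreal (indicator {0<..\<delta>} r * \<Gamma> 1 r))) {x<..}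
     = (\<integral>\<^sup>+r. ennreal (indicator {0<..\<delta>} r * \<Gamma> 1 r) * indicator {x<..} r \<partial>lborel)"
    by (subst emeasure_density) auto
  also have "\<dots> = (\<integral>\<^sup>+r. ennreal (\<Gamma> 1 r) * indicator {y..\<delta>} r \<partial>lborel)"
  proof (rule nn_integral_cong_AE)
    show "AE r in lborel. ennreal (indicator {0<..\<delta>} r * \<Gamma> 1 r) * indicator {x<..} r = ennreal (\<Gamma> 1 r) * indicator {y..\<delta>} r"
      using AE_lborel_singleton[of y] AE_lborel_singleton[of \<delta>]
      by eventually_elim (auto simp: indicator_def y_def split: if_splits)
  qed
  also have "\<dots> = ennreal (\<Gamma> 0 \<delta> - \<Gamma> 0 y)"
  proof (rule nn_integral_has_integral_lebesgue')
    show "0 \<le> \<Gamma> 1 r" if "r \<in> {y..\<delta>}" for r using that y \<delta> by (intro Gamma_1_nonneg) auto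
    show "(\<Gamma> 1 has_integral \<Gamma> 0 \<delta> - \<Gamma> 0 y) {y..\<delta>}"
    proof (rule fundamental_theorem_of_calculus[OF y(2)])
      fix r assume "r \<in> {y..\<delta>}"
      then have "(\<Gamma> 0 has_real_derivative \<Gamma> (Suc 0) r) (at r within {y..\<delta>})"
        using y \<delta> by (intro has_field_derivative_subset[OF der]) auto
      then show "(\<Gamma> 0 has_vector_derivative \<Gamma> 1 r) (at r within {y..\<delta>})"
        by (simp add: has_real_derivative_iff_has_vector_derivative)
    qed
  qed
  finally show "emeasure (density \<nu> (indicator {0<..\<delta>})) {x<..} = emeasure (density lborel (\<lambda>r. ennreal (indicator {0<..\<delta>} r * \<Gamma> 1 r))) {x<..}"
    using 1 by simp
  show "emeasure (density \<nu> (indicator {0<..\<delta>})) {x<..} < \<infinity>" using 1 by simp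
qed auto

lemma integral_nu_lborel:
  fixes F :: "real \<Rightarrow> complex"
  assumes [measurable]: "F \<in> borel_measurable borel"
  shows "(\<integral>r. indicator {0<..\<delta>} r *\<^sub>R F r \<partial>\<nu>) = (\<integral>r. (indicator {0<..\<delta>} r * \<Gamma> 1 r) *\<^sub>R F r \<partial>lborel)"
proof -
  have nn: "0 \<le> indicator {0<..\<delta>} r * \<Gamma> 1 r" for r using Gamma_1_nonneg[of r] \<delta> by (auto simp: indicator_def)
  have "(\<integral>r. indicator {0<..\<delta>} r *\<^sub>R F r \<partial>\<nu>) = (\<integral>r. F r \<partial>density \<nu> (\<lambda>r. ennreal (indicator {0<..\<delta>} r)))"
    by (rule integral_density[symmetric]) auto
  also have "density \<nu> (\<lambda>r. ennreal (indicator {0<..\<delta>} r)) = density \<nu> (indicator {0<..\<delta>})"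
    by (intro arg_cong[where f="density \<nu>"] ext) (auto simp: indicator_def)
  also have "(\<integral>r. F r \<partial>\<dots>) = (\<integral>r. (indicator {0<..\<delta>} r * \<Gamma> 1 r) *\<^sub>R F r \<partial>lborel)"
    unfolding density_nu by (rule integral_density) (use nn in auto)
  finally show ?thesis .
qed

lemma integrable_nu_lborel:
  fixes F :: "real \<Rightarrow> complex"
  assumes [measurable]: "F \<in> borel_measurable borel"
  shows "integrable \<nu> (\<lambda>r. indicator {0<..\<delta>} r *\<^sub>R F r) \<longleftrightarrow> integrable lborel (\<lambda>r. (indicator {0<..\<delta>} r * \<Gamma> 1 r) *\<^sub>R F r)"
proof -
  have nn: "0 \<le> indicator {0<..\<delta>} r * \<Gamma> 1 r" for r using Gamma_1_nonneg[of r] \<delta> by (auto simp: indicator_def)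
  have "integrable \<nu> (\<lambda>r. indicator {0<..\<delta>} r *\<^sub>R F r) \<longleftrightarrow> integrable (density \<nu> (\<lambda>r. ennreal (indicator {0<..\<delta>} r))) F"
    by (rule integrable_density[symmetric]) auto
  also have "density \<nu> (\<lambda>r. ennreal (indicator {0<..\<delta>} r)) = density \<nu> (indicator {0<..\<delta>})"
    by (intro arg_cong[where f="density \<nu>"] ext) (auto simp: indicator_def)
  also have "integrable \<dots> F \<longleftrightarrow> integrable lborel (\<lambda>r. (indicator {0<..\<delta>} r * \<Gamma> 1 r) *\<^sub>R F r)"
    unfolding density_nu by (rule integrable_density) (use nn in auto)
  finally show ?thesis .
qed

lemma integrable_tail:
  assumes "\<epsilon> > 0"
  shows "integrable \<nu> (\<lambda>r. indicator {0<..} r * (\<bar>indicator {\<epsilon><..} r\<bar> * r powr s))"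
proof (rule integrable_const_bound)
  show "AE r in \<nu>. norm (indicator {0<..} r * (\<bar>indicator {\<epsilon><..} r\<bar> * r powr s)) \<le> \<epsilon> powr s + (\<epsilon> + \<bar>D\<bar>) powr s"
    using range_nu
  proof eventually_elim
    case (elim r)
    have "r powr s \<le> \<epsilon> powr s + (\<epsilon> + \<bar>D\<bar>) powr s" if r: "\<epsilon> < r"
    proof (cases "s \<ge> 0")
      case True
      then have "r powr s \<le> (\<epsilon> + \<bar>D\<bar>) powr s" using elim r assms by (intro powr_mono2) auto
      then show ?thesis by (simp add: add_increasing)
    next
      case False
      then have "r powr s \<le> \<epsilon> powr s" using r assms by (intro powr_mono2') auto
      then show ?thesis by (simp add: add_increasing2)
    qed
    then show ?case by (auto simp: indicator_def)
  qed
qed auto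

lemma integrable_Rem:
  assumes "s > - real k - 1"
  shows "integrable lborel (\<lambda>r. indicator {0<..} r * (\<bar>indicator {0<..\<delta>} r * Rem k r\<bar> * r powr s))"
proof (rule Bochner_Integration.integrable_bound[of _ "\<lambda>r. C (Suc k) * (indicator {0<..\<delta>} r * r powr (real k + s))"])
  show "integrable lborel (\<lambda>r. C (Suc k) * (indicator {0<..\<delta>} r * r powr (real k + s)))"
    using assms \<delta> by (intro integrable_mult_right integrable_powr_Ioc) auto
  have "\<bar>Rem k r\<bar> * r powr s \<le> C (Suc k) * r powr (real k + s)" if r: "0 < r" "r \<le> \<delta>" for r
  proof -
    have "\<bar>Rem k r\<bar> * r powr s \<le> (C (Suc k) * r ^ k) * r powr s"
      using Rem_le[of r k] r \<delta> by (intro mult_right_mono) auto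
    also have "\<dots> = C (Suc k) * r powr (real k + s)" using r by (simp add: powr_add powr_realpow)
    finally show ?thesis .
  qed
  moreover have "0 \<le> C (Suc k)" using bnd[of 0 "Suc k"] d_pos by (auto intro: order_trans[OF abs_ge_zero])
  ultimately show "AE r in lborel. norm (indicator {0<..} r * (\<bar>indicator {0<..\<delta>} r * Rem k r\<bar> * r powr s))
      \<le> norm (C (Suc k) * (indicator {0<..\<delta>} r * r powr (real k + s)))"
    by (intro AE_I2) (auto simp: indicator_def abs_mult)
  have "(\<lambda>r. indicator {0<..} r * (\<bar>indicator {0<..\<delta>} r * Rem k r\<bar> * r powr s)) \<in> borel_measurable borel"
    by measurable
  then show "(\<lambda>r. indicator {0<..} r * (\<bar>indicator {0<..\<delta>} r * Rem k r\<bar> * r powr s)) \<in> borel_measurable lborel" by simp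
qed

lemma holomorphic_Ak: "Ak k holomorphic_on {z. Re z > - real k - 1}"
proof -
  have "rz \<delta> holomorphic_on {z. Re z > - real k - 1}"
    unfolding rz_def[abs_def]
    by (rule holomorphic_pw_integral) (use integrable_tail[OF \<delta>(1)] in auto)
  moreover have "(\<lambda>z. \<integral>r. (indicator {0<..\<delta>} r * Rem k r) *\<^sub>R radial_powr z r \<partial>lborel) holomorphic_on {z. Re z > - real k - 1}"
    by (rule holomorphic_pw_integral) (use integrable_Rem in auto)
  ultimately show ?thesis unfolding Ak_def[abs_def] by (rule holomorphic_on_add)
qed

text \<open>The logarithm is the primitive precisely in the exceptional case
  \<open>z + j = 0\<close>, so polar and logarithmic counterterms obey one rule and later proofs
  need not tell them apart.\<close>

lemma counterterm_deriv:
  assumes r: "r > 0" and j: "j \<ge> 1"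
  shows "((\<lambda>r. counterterm z j r) has_vector_derivative r ^ (j - 1) *\<^sub>R (complex_of_real r powr z)) (at r)"
proof -
  have rr: "complex_of_real r \<notin> \<real>\<^sub>\<le>\<^sub>0" using r by (simp add: complex_nonpos_Reals_iff)
  have p: "complex_of_real r powr (z + of_nat j - 1) = r ^ (j - 1) *\<^sub>R (complex_of_real r powr z)"
  proof -
    obtain i where i: "j = Suc i" using j by (cases j) auto
    have "complex_of_real r powr (z + of_nat j - 1) = complex_of_real r powr (z + of_nat i)" by (simp add: i)
    also have "\<dots> = complex_of_real r powr z * complex_of_real r ^ i" using r by (simp add: powr_add powr_nat')
    finally show ?thesis by (simp add: i scaleR_conv_of_real mult.commute)
  qed
  show ?thesis
  proof (cases "z + of_nat j = 0")
    case True
    have "((\<lambda>r. complex_of_real (ln r)) has_vector_derivative complex_of_real (1 / r)) (at r)"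
      using r by (auto intro!: derivative_eq_intros has_vector_derivative_of_real simp: has_real_derivative_iff_has_vector_derivative[symmetric] field_simps)
    moreover have "r ^ (j - 1) *\<^sub>R (complex_of_real r powr z) = complex_of_real (1 / r)"
      unfolding p[symmetric] using True r by (simp add: powr_minus divide_inverse)
    ultimately show ?thesis using True by (simp add: counterterm_def)
  next
    case False
    have "((\<lambda>w. w powr (z + of_nat j) / (z + of_nat j)) has_field_derivative complex_of_real r powr (z + of_nat j - 1)) (at (complex_of_real r))"
      using False rr by (auto intro!: derivative_eq_intros)
    from has_vector_derivative_real_field[OF this]
    show ?thesis using False by (simp add: counterterm_def p)
  qed
qed

lemma integral_power_radial_powr:
  assumes \<epsilon>: "0 < \<epsilon>" "\<epsilon> \<le> \<delta>" and j: "j \<ge> 1"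
  shows "(\<integral>r. (indicator {\<epsilon><..\<delta>} r * r ^ (j - 1)) *\<^sub>R radial_powr z r \<partial>lborel) = counterterm z j \<delta> - counterterm z j \<epsilon>"
    "integrable lborel (\<lambda>r. (indicator {\<epsilon><..\<delta>} r * r ^ (j - 1)) *\<^sub>R radial_powr z r)"
proof -
  have cont: "continuous_on {\<epsilon>..\<delta>} (\<lambda>r. r ^ (j - 1) *\<^sub>R (complex_of_real r powr z))"
    using \<epsilon> by (intro continuous_intros) (auto simp: complex_nonpos_Reals_iff)
  have hi: "((\<lambda>r. r ^ (j - 1) *\<^sub>R (complex_of_real r powr z)) has_integral (counterterm z j \<delta> - counterterm z j \<epsilon>)) {\<epsilon>..\<delta>}"
    using \<epsilon> j by (intro fundamental_theorem_of_calculus has_vector_derivative_at_within[OF counterterm_deriv]) auto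
  have si: "set_integrable lborel {\<epsilon>..\<delta>} (\<lambda>r. r ^ (j - 1) *\<^sub>R (complex_of_real r powr z))"
    by (rule borel_integrable_atLeastAtMost'[OF cont])
  then have 1: "(LINT r:{\<epsilon>..\<delta>}|lborel. r ^ (j - 1) *\<^sub>R (complex_of_real r powr z)) = counterterm z j \<delta> - counterterm z j \<epsilon>"
    using set_borel_integral_eq_integral(2)[OF si] hi by (simp add: integral_unique)
  have ae: "AE r in lborel. indicator {\<epsilon>..\<delta>} r *\<^sub>R (r ^ (j - 1) *\<^sub>R (complex_of_real r powr z)) = (indicator {\<epsilon><..\<delta>} r * r ^ (j - 1)) *\<^sub>R radial_powr z r"
    using AE_lborel_singleton[of \<epsilon>]
    by eventually_elim (use \<epsilon> in \<open>auto simp: indicator_def radial_powr_def\<close>)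
  have m1: "(\<lambda>r. indicator {\<epsilon>..\<delta>} r *\<^sub>R (r ^ (j - 1) *\<^sub>R (complex_of_real r powr z))) \<in> borel_measurable lborel"
    using si unfolding set_integrable_def by (rule borel_measurable_integrable)
  have m2: "(\<lambda>r. (indicator {\<epsilon><..\<delta>} r * r ^ (j - 1)) *\<^sub>R radial_powr z r) \<in> borel_measurable lborel" by measurable
  show "integrable lborel (\<lambda>r. (indicator {\<epsilon><..\<delta>} r * r ^ (j - 1)) *\<^sub>R radial_powr z r)"
    using integrable_cong_AE[OF m1 m2 ae] si unfolding set_integrable_def by blast
  show "(\<integral>r. (indicator {\<epsilon><..\<delta>} r * r ^ (j - 1)) *\<^sub>R radial_powr z r \<partial>lborel) = counterterm z j \<delta> - counterterm z j \<epsilon>"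
    using integral_cong_AE[OF m1 m2 ae] 1 unfolding set_lebesgue_integral_def by simp
qed

end

text \<open>Identity theorem for the difference: with its singularities removed it is either
  identically 0 or avoids 0 off a sparse set, and vanishing on a half-plane excludes the latter.
  Agreement at every single point, poles included, is due to the normalization.\<close>

lemma nicely_meromorphic_unique:
  assumes f: "f nicely_meromorphic_on UNIV" and g: "g nicely_meromorphic_on UNIV"
    and eq: "\<And>z. Re z > s \<Longrightarrow> f z = g z"
  shows "f = g"
proof
  fix z
  have fm: "f meromorphic_on UNIV" and gm: "g meromorphic_on UNIV"
    using f g by (auto simp: nicely_meromorphic_on_def)
  define h where "h = remove_sings (\<lambda>w. f w - g w)"
  have dm: "(\<lambda>w. f w - g w) meromorphic_on UNIV" using fm gm by (intro meromorphic_intros)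
  have h: "h nicely_meromorphic_on UNIV" unfolding h_def by (rule remove_sings_nicely_meromorphic[OF dm])
  define w0 where "w0 = complex_of_real (s + 1)"
  have ev0: "\<forall>\<^sub>F w in at w0. h w = 0"
  proof -
    have "\<forall>\<^sub>F w in at w0. remove_sings (\<lambda>w. f w - g w) w = f w - g w"
      using meromorphic_on_isolated_singularity[of "\<lambda>w. f w - g w" w0] meromorphic_on_subset[OF dm]
      by (intro eventually_remove_sings_eq_at) auto
    moreover have "\<forall>\<^sub>F w in at w0. w \<in> {w. Re w > s}"
      by (rule eventually_at_in_open') (auto simp: w0_def open_halfspace_Re_gt)
    ultimately show ?thesis by eventually_elim (use eq in \<open>auto simp: h_def\<close>)
  qed
  have "h w = 0" for w
    using nicely_meromorphic_imp_constant_or_avoid[OF h open_UNIV connected_UNIV, of 0]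
  proof
    assume "\<forall>\<^sub>\<approx>x\<in>UNIV. h x \<noteq> 0"
    then have "\<forall>\<^sub>F w in at w0. h w \<noteq> 0" by (rule eventually_cosparse_imp_eventually_at) auto
    with ev0 have "\<forall>\<^sub>F w in at w0. False" by eventually_elim auto
    then show ?thesis by simp
  qed auto
  moreover have "\<forall>\<^sub>F w in at z. h w = f w - g w"
    unfolding h_def using meromorphic_on_isolated_singularity[of "\<lambda>w. f w - g w" z] meromorphic_on_subset[OF dm]
    by (intro eventually_remove_sings_eq_at) auto
  ultimately have ev: "\<forall>\<^sub>F w in at z. f w = g w" by (auto elim: eventually_mono)
  have pole: "is_pole f z \<longleftrightarrow> is_pole g z" by (rule is_pole_cong[OF ev refl])
  show "f z = g z"
  proof (cases "is_pole f z")
    case True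
    \<comment> \<open>At a pole the function does not tend to its value, so the normalization forces
      both values to be 0.\<close>
    then have "\<not> f \<midarrow>z\<rightarrow> f z" "\<not> g \<midarrow>z\<rightarrow> g z" using pole
      by (auto simp: is_pole_def dest: not_tendsto_and_filterlim_at_infinity[rotated])
    then show ?thesis using f g unfolding nicely_meromorphic_on_def by (metis UNIV_I)
  next
    case False
    then have "f \<midarrow>z\<rightarrow> f z" "g \<midarrow>z\<rightarrow> g z" using f g pole unfolding nicely_meromorphic_on_def by auto
    moreover from this(1) have "g \<midarrow>z\<rightarrow> f z" by (rule Lim_transform_eventually[OF _ ev])
    ultimately show ?thesis using LIM_unique by blast
  qed
qed

lemma counterterm_tendsto_0:
  assumes "Re z + real j > 0" shows "((\<lambda>\<epsilon>. counterterm z j \<epsilon>) \<longlongrightarrow> 0) (at_right 0)"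
proof -
  have nz: "z + of_nat j \<noteq> 0" using assms by (auto simp: complex_eq_iff)
  have "((\<lambda>\<epsilon>::real. \<epsilon> powr (Re z + real j)) \<longlongrightarrow> 0) (at_right 0)"
    using assms by (intro tendsto_zero_powrI[of _ _ _ "Re z + real j"] tendsto_const)
      (auto intro!: tendsto_ident_at eventually_at_right_less[THEN eventually_mono])
  from tendsto_divide_zero[OF this, of "cmod (z + of_nat j)"]
  show ?thesis
  proof (rule Lim_null_comparison[rotated])
    show "\<forall>\<^sub>F \<epsilon> in at_right 0. norm (counterterm z j \<epsilon>) \<le> \<epsilon> powr (Re z + real j) / cmod (z + of_nat j)"
      using eventually_at_right_less[of 0]
      by eventually_elim (use nz in \<open>auto simp: counterterm_def norm_divide norm_powr_real_powr\<close>)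
  qed
qed

section \<open>Finite part and meromorphic continuation compared\<close>

context radial_measure
begin

lemma integrable_tail_radial_powr: "\<epsilon> > 0 \<Longrightarrow> integrable \<nu> (\<lambda>r. indicator {\<epsilon><..} r *\<^sub>R radial_powr z r)"
  by (rule integrable_radial_powr[of _ _ "Re z - 1"]) (use integrable_tail in auto)

text \<open>Below \<delta> the density is its Taylor polynomial plus \<open>Rem k\<close>. The
  polynomial integrates to differences of counterterms, so all divergence as \<epsilon> tends to 0
  sits in the explicit terms at \<epsilon>.\<close>

lemma rz_split:
  assumes \<epsilon>: "0 < \<epsilon>" "\<epsilon> \<le> \<delta>"
  shows "rz \<epsilon> z = rz \<delta> z + (\<Sum>j=1..k. of_real (c j) * (counterterm z j \<delta> - counterterm z j \<epsilon>))
     + (\<integral>r. (indicator {\<epsilon><..\<delta>} r * Rem k r) *\<^sub>R radial_powr z r \<partial>lborel)"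
proof -
  define q where "q = (\<lambda>r. indicator {\<epsilon><..} r *\<^sub>R radial_powr z r)"
  have [measurable]: "q \<in> borel_measurable borel" unfolding q_def by measurable
  have i1: "integrable \<nu> q" unfolding q_def by (rule integrable_tail_radial_powr[OF \<epsilon>(1)])
  have i2: "integrable \<nu> (\<lambda>r. indicator {\<delta><..} r *\<^sub>R radial_powr z r)" by (rule integrable_tail_radial_powr[OF \<delta>(1)])
  have qs: "q r = indicator {\<delta><..} r *\<^sub>R radial_powr z r + indicator {0<..\<delta>} r *\<^sub>R q r" for r
    using \<epsilon> by (auto simp: q_def indicator_def)
  have i3: "integrable \<nu> (\<lambda>r. indicator {0<..\<delta>} r *\<^sub>R q r)"
  proof -
    have "integrable \<nu> (\<lambda>r. q r - indicator {\<delta><..} r *\<^sub>R radial_powr z r)" by (rule Bochner_Integration.integrable_diff[OF i1 i2])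
    moreover have "q r - indicator {\<delta><..} r *\<^sub>R radial_powr z r = indicator {0<..\<delta>} r *\<^sub>R q r" for r
      using \<epsilon> by (auto simp: q_def indicator_def)
    ultimately show ?thesis by (simp only:)
  qed
  have eq: "(indicator {0<..\<delta>} r * \<Gamma> 1 r) *\<^sub>R q r = (indicator {\<epsilon><..\<delta>} r * Rem k r) *\<^sub>R radial_powr z r
      + (\<Sum>j=1..k. of_real (c j) * ((indicator {\<epsilon><..\<delta>} r * r ^ (j - 1)) *\<^sub>R radial_powr z r))" for r
  proof (cases "r \<in> {\<epsilon><..\<delta>}")
    case True
    have "(\<Gamma> 1 r) *\<^sub>R radial_powr z r = (Rem k r + (\<Sum>j=1..k. c j * r ^ (j - 1))) *\<^sub>R radial_powr z r" by (simp add: Rem_def)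
    also have "\<dots> = Rem k r *\<^sub>R radial_powr z r + (\<Sum>j=1..k. of_real (c j) * ((r ^ (j - 1)) *\<^sub>R radial_powr z r))"
      by (simp add: scaleR_conv_of_real distrib_right sum_distrib_right mult.assoc)
    finally show ?thesis using True \<epsilon> by (simp add: q_def indicator_def)
  next
    case False
    then show ?thesis using \<epsilon> by (auto simp: q_def indicator_def)
  qed
  have "rz \<epsilon> z = (\<integral>r. indicator {\<delta><..} r *\<^sub>R radial_powr z r + indicator {0<..\<delta>} r *\<^sub>R q r \<partial>\<nu>)"
    unfolding rz_def by (rule Bochner_Integration.integral_cong[OF refl]) (use qs in \<open>simp only: q_def\<close>)
  also have "\<dots> = rz \<delta> z + (\<integral>r. indicator {0<..\<delta>} r *\<^sub>R q r \<partial>\<nu>)"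
    unfolding rz_def by (rule Bochner_Integration.integral_add[OF i2 i3])
  also have "(\<integral>r. indicator {0<..\<delta>} r *\<^sub>R q r \<partial>\<nu>) = (\<integral>r. (indicator {0<..\<delta>} r * \<Gamma> 1 r) *\<^sub>R q r \<partial>lborel)"
    by (rule integral_nu_lborel) simp
  also have "\<dots> = (\<integral>r. (indicator {\<epsilon><..\<delta>} r * Rem k r) *\<^sub>R radial_powr z r
      + (\<Sum>j=1..k. of_real (c j) * ((indicator {\<epsilon><..\<delta>} r * r ^ (j - 1)) *\<^sub>R radial_powr z r)) \<partial>lborel)"
    (is "_ = (\<integral>r. ?R r + ?S r \<partial>lborel)")
    by (simp only: eq)
  also have "\<dots> = (\<integral>r. ?R r \<partial>lborel) + (\<integral>r. ?S r \<partial>lborel)"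
  proof (rule Bochner_Integration.integral_add)
    show iS: "integrable lborel ?S"
      by (intro Bochner_Integration.integrable_sum integrable_mult_right integral_power_radial_powr(2) \<epsilon>) auto
    have "integrable lborel (\<lambda>r. (indicator {0<..\<delta>} r * \<Gamma> 1 r) *\<^sub>R q r)"
      using i3 by (subst integrable_nu_lborel[symmetric]) auto
    then have "integrable lborel (\<lambda>r. (indicator {0<..\<delta>} r * \<Gamma> 1 r) *\<^sub>R q r - ?S r)"
      using iS by (rule Bochner_Integration.integrable_diff)
    then show "integrable lborel ?R" by (simp only: eq add_diff_cancel_right')
  qed
  also have "(\<integral>r. ?S r \<partial>lborel) = (\<Sum>j=1..k. of_real (c j) * (counterterm z j \<delta> - counterterm z j \<epsilon>))"
  proof -
    have "(\<integral>r. ?S r \<partial>lborel) = (\<Sum>j=1..k. \<integral>r. of_real (c j) * ((indicator {\<epsilon><..\<delta>} r * r ^ (j - 1)) *\<^sub>R radial_powr z r) \<partial>lborel)"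
      by (intro Bochner_Integration.integral_sum integrable_mult_right integral_power_radial_powr(2) \<epsilon>) auto
    also have "\<dots> = (\<Sum>j=1..k. of_real (c j) * (counterterm z j \<delta> - counterterm z j \<epsilon>))"
    proof (rule sum.cong[OF refl])
      fix j assume "j \<in> {1..k}"
      then have "1 \<le> j" by simp
      from integral_power_radial_powr(1)[OF \<epsilon> this]
      show "(\<integral>r. of_real (c j) * ((indicator {\<epsilon><..\<delta>} r * r ^ (j - 1)) *\<^sub>R radial_powr z r) \<partial>lborel) = of_real (c j) * (counterterm z j \<delta> - counterterm z j \<epsilon>)"
        by (simp only: integral_mult_right_zero)
    qed
    finally show ?thesis .
  qed
  finally show ?thesis by (simp add: algebra_simps)
qed

lemma tendsto_cut_integral:
  fixes F :: "real \<Rightarrow> complex"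
  assumes F: "integrable N F" and sets: "sets N = sets borel" and F0: "\<And>r. r \<le> 0 \<Longrightarrow> F r = 0"
  shows "((\<lambda>\<epsilon>. \<integral>r. indicator {\<epsilon><..} r *\<^sub>R F r \<partial>N) \<longlongrightarrow> (\<integral>r. F r \<partial>N)) (at_right 0)"
  unfolding tendsto_at_iff_sequentially
proof (intro allI impI)
  fix X :: "nat \<Rightarrow> real" assume X: "\<forall>i. X i \<in> {0<..} - {0}" "X \<longlonglongrightarrow> 0"
  note [measurable_cong] = sets
  note [measurable] = borel_measurable_integrable[OF F]
  show "((\<lambda>\<epsilon>. \<integral>r. indicator {\<epsilon><..} r *\<^sub>R F r \<partial>N) \<circ> X) \<longlonglongrightarrow> (\<integral>r. F r \<partial>N)"
    unfolding o_def
  proof (rule integral_dominated_convergence[where w="\<lambda>r. norm (F r)"])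
    show "AE r in N. (\<lambda>i. indicator {X i<..} r *\<^sub>R F r) \<longlonglongrightarrow> F r"
    proof (rule AE_I2)
      fix r
      show "(\<lambda>i. indicator {X i<..} r *\<^sub>R F r) \<longlonglongrightarrow> F r"
      proof (cases "r > 0")
        case True
        have "\<forall>\<^sub>F i in sequentially. X i < r" using order_tendstoD(2)[OF X(2) True] .
        then have "\<forall>\<^sub>F i in sequentially. F r = indicator {X i<..} r *\<^sub>R F r" by eventually_elim simp
        then show ?thesis by (rule Lim_transform_eventually[OF tendsto_const])
      qed (simp add: F0)
    qed
    show "AE r in N. norm (indicator {X i<..} r *\<^sub>R F r) \<le> norm (F r)" for i
      by (rule AE_I2) (auto simp: indicator_def)
    show "integrable N (\<lambda>r. norm (F r))" by (rule integrable_norm[OF F])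
  qed auto
qed

lemma Ek_tendsto:
  assumes z: "Re z > - real k - 1"
  shows "((\<lambda>\<epsilon>. rz \<epsilon> z + (\<Sum>j=1..k. of_real (c j) * counterterm z j \<epsilon>)) \<longlongrightarrow> Ek k z) (at_right 0)"
proof -
  let ?F = "\<lambda>r. (indicator {0<..\<delta>} r * Rem k r) *\<^sub>R radial_powr z r"
  have F: "integrable lborel ?F"
    by (rule integrable_radial_powr[of _ _ "- real k - 1"]) (use integrable_Rem z in auto)
  have "((\<lambda>\<epsilon>. \<integral>r. indicator {\<epsilon><..} r *\<^sub>R ?F r \<partial>lborel) \<longlongrightarrow> (\<integral>r. ?F r \<partial>lborel)) (at_right 0)"
    by (rule tendsto_cut_integral[OF F]) auto
  then have "((\<lambda>\<epsilon>. rz \<delta> z + (\<Sum>j=1..k. of_real (c j) * counterterm z j \<delta>) + (\<integral>r. indicator {\<epsilon><..} r *\<^sub>R ?F r \<partial>lborel)) \<longlongrightarrow>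
     rz \<delta> z + (\<Sum>j=1..k. of_real (c j) * counterterm z j \<delta>) + (\<integral>r. ?F r \<partial>lborel)) (at_right 0)"
    by (intro tendsto_add tendsto_const)
  also have "rz \<delta> z + (\<Sum>j=1..k. of_real (c j) * counterterm z j \<delta>) + (\<integral>r. ?F r \<partial>lborel) = Ek k z"
    by (simp add: Ek_def Ak_def)
  finally show ?thesis
  proof (rule Lim_transform_eventually)
    have "\<forall>\<^sub>F \<epsilon> in at_right 0. \<epsilon> \<in> {0<..<\<delta>}" using \<delta> by (intro eventually_at_right_real) auto
    then show "\<forall>\<^sub>F \<epsilon> in at_right 0. rz \<delta> z + (\<Sum>j=1..k. of_real (c j) * counterterm z j \<delta>) + (\<integral>r. indicator {\<epsilon><..} r *\<^sub>R ?F r \<partial>lborel)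
        = rz \<epsilon> z + (\<Sum>j=1..k. of_real (c j) * counterterm z j \<epsilon>)"
    proof eventually_elim
      case (elim \<epsilon>)
      have "(\<lambda>r. indicator {\<epsilon><..} r *\<^sub>R ?F r) = (\<lambda>r. (indicator {\<epsilon><..\<delta>} r * Rem k r) *\<^sub>R radial_powr z r)"
        using elim by (auto simp: indicator_def fun_eq_iff)
      then show ?case
        using rz_split[of \<epsilon> z k] elim by (simp add: right_diff_distrib sum_subtractf)
    qed
  qed
qed

text \<open>Both are limits of the same expression up to one counterterm, and that one tends to 0 in
  this half-plane; uniqueness of limits replaces a computation with remainders.\<close>

lemma Ek_Suc: "Re z > - real k - 1 \<Longrightarrow> Ek (Suc k) z = Ek k z"
proof -
  assume z: "Re z > - real k - 1"
  have "((\<lambda>\<epsilon>. counterterm z (Suc k) \<epsilon>) \<longlongrightarrow> 0) (at_right 0)"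
    using z by (intro counterterm_tendsto_0) auto
  then have "((\<lambda>\<epsilon>. (rz \<epsilon> z + (\<Sum>j=1..k. of_real (c j) * counterterm z j \<epsilon>)) + of_real (c (Suc k)) * counterterm z (Suc k) \<epsilon>) \<longlongrightarrow> Ek k z + of_real (c (Suc k)) * 0) (at_right 0)"
    using z by (intro tendsto_add Ek_tendsto tendsto_mult tendsto_const)
  then have "((\<lambda>\<epsilon>. rz \<epsilon> z + (\<Sum>j=1..Suc k. of_real (c j) * counterterm z j \<epsilon>)) \<longlongrightarrow> Ek k z) (at_right 0)"
    by (simp add: add.assoc)
  moreover have "((\<lambda>\<epsilon>. rz \<epsilon> z + (\<Sum>j=1..Suc k. of_real (c j) * counterterm z j \<epsilon>)) \<longlongrightarrow> Ek (Suc k) z) (at_right 0)"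
    using z by (intro Ek_tendsto) auto
  ultimately show ?thesis using tendsto_unique trivial_limit_at_right_real by blast
qed

text \<open>At \<open>z = - j\<close> the division by zero drops the polar term, whereas \<open>Ek\<close> has \<open>ln \<delta>\<close> in its place.\<close>

definition Bk :: "nat \<Rightarrow> complex \<Rightarrow> complex" where
  "Bk k z = Ak k z + (\<Sum>j=1..k. of_real (c j) * (of_real \<delta> powr (z + of_nat j) / (z + of_nat j)))"

text \<open>The least admissible order of expansion at \<open>z\<close>.\<close>

definition level :: "complex \<Rightarrow> nat" where "level z = nat \<lfloor>- Re z\<rfloor>"
definition B0 :: "complex \<Rightarrow> complex" where "B0 z = Bk (level z) z"
definition E0 :: "complex \<Rightarrow> complex" where "E0 z = Ek (level z) z"

lemma level: "Re z > - real (level z) - 1" "Re z > - real k - 1 \<Longrightarrow> level z \<le> k"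
  unfolding level_def by linarith+

text \<open>\<open>Ek\<close> and \<open>Bk\<close> differ only in terms with
  \<open>z + j = 0\<close> and \<open>j \<le> k\<close>; the added term has a nonzero denominator
  here, so \<open>Ek_Suc\<close> carries over.\<close>

lemma Bk_Suc: "Re z > - real k - 1 \<Longrightarrow> Bk (Suc k) z = Bk k z"
proof -
  assume z: "Re z > - real k - 1"
  then have "z + of_nat (Suc k) \<noteq> 0" by (auto simp: complex_eq_iff)
  then show ?thesis using Ek_Suc[OF z] by (simp add: Ek_def Bk_def counterterm_def algebra_simps)
qed

lemma Ek_eq_E0: assumes "Re z > - real k - 1" shows "Ek k z = E0 z"
  using level(2)[OF assms]
proof (induction k rule: dec_induct)
  case (step n)
  then have "Re z > - real n - 1" using level(1)[of z] by linarith
  then show ?case using step Ek_Suc by simp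
qed (simp add: E0_def)

lemma Bk_eq_B0: assumes "Re z > - real k - 1" shows "Bk k z = B0 z"
  using level(2)[OF assms]
proof (induction k rule: dec_induct)
  case (step n)
  then have "Re z > - real n - 1" using level(1)[of z] by linarith
  then show ?case using step Bk_Suc by simp
qed (simp add: B0_def)

lemma E0_tendsto:
  assumes "Re z > - real k - 1"
  shows "((\<lambda>\<epsilon>. rz \<epsilon> z + (\<Sum>j=1..k. of_real (c j) * counterterm z j \<epsilon>)) \<longlongrightarrow> E0 z) (at_right 0)"
  using Ek_tendsto[OF assms] Ek_eq_E0[OF assms] by simp

lemma open_Uk: "open {z. Re z > - real k - 1}" by (rule open_halfspace_Re_gt)

lemma eventually_B0_Bk: "Re z > - real k - 1 \<Longrightarrow> \<forall>\<^sub>F w in nhds z. B0 w = Bk k w"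
proof -
  assume "Re z > - real k - 1"
  then have "\<forall>\<^sub>F w in nhds z. w \<in> {z. Re z > - real k - 1}"
    by (intro eventually_nhds_in_open open_Uk) auto
  then show ?thesis by eventually_elim (simp add: Bk_eq_B0)
qed

lemma Ak_analytic: "Re z > - real k - 1 \<Longrightarrow> Ak k analytic_on {z}"
  using holomorphic_Ak[of k] open_Uk[of k] by (intro holomorphic_on_imp_analytic_at) auto

lemma powr_delta_analytic: "(\<lambda>w. complex_of_real \<delta> powr (w + of_nat j)) analytic_on A"
proof -
  have "(\<lambda>w. complex_of_real \<delta> powr (w + of_nat j)) holomorphic_on UNIV" by (intro holomorphic_intros)
  then show ?thesis by (meson analytic_on_open analytic_on_subset open_UNIV subset_UNIV)
qed

lemma B0_meromorphic: "B0 meromorphic_on UNIV"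
proof -
  have "B0 meromorphic_on {z}" for z
  proof -
    let ?k = "level z"
    have "Bk ?k meromorphic_on {z}"
      unfolding Bk_def[abs_def]
      by (intro meromorphic_intros analytic_on_imp_meromorphic_on[OF Ak_analytic] analytic_on_imp_meromorphic_on[OF powr_delta_analytic] level)
    moreover have "\<forall>\<^sub>F w in at z. Bk ?k w = B0 w"
      using eventually_B0_Bk[OF level(1)[of z]] by (auto simp: eventually_at_filter elim: eventually_mono)
    ultimately show ?thesis using meromorphic_on_cong[of "{z}" "Bk ?k" B0 "{z}"] by auto
  qed
  then have "B0 meromorphic_on (\<Union>z\<in>UNIV. {z})" by (intro meromorphic_on_UN)
  then show ?thesis by simp
qed

text \<open>Only indices with a nonzero coefficient are excluded. The notion thus includes integers
  \<open>-k\<close> whose coefficient vanishes, which the second half of (ii) is about.\<close>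

definition regular :: "complex \<Rightarrow> bool" where
  "regular z \<longleftrightarrow> (\<forall>j\<ge>1. c j \<noteq> 0 \<longrightarrow> z \<noteq> - of_nat j)"

lemma Bk_analytic:
  assumes z: "Re z > - real k - 1" and r: "regular z"
  shows "Bk k analytic_on {z}"
  unfolding Bk_def[abs_def]
proof (intro analytic_on_add Ak_analytic z analytic_on_sum)
  fix j assume j: "j \<in> {1..k}"
  show "(\<lambda>w. of_real (c j) * (of_real \<delta> powr (w + of_nat j) / (w + of_nat j))) analytic_on {z}"
  proof (cases "c j = 0")
    case False
    then have "z + of_nat j \<noteq> 0" using r j by (auto simp: regular_def add_eq_0_iff2)
    then show ?thesis by (intro analytic_intros powr_delta_analytic) auto
  qed simp
qed

lemma B0_analytic: "regular z \<Longrightarrow> B0 analytic_on {z}"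
  using Bk_analytic[OF level(1)] analytic_at_cong[OF eventually_B0_Bk[OF level(1)] refl] by blast

lemma B0_eq_E0: assumes "regular z" shows "B0 z = E0 z"
proof -
  have "of_real (c j) * (of_real \<delta> powr (z + of_nat j) / (z + of_nat j)) = of_real (c j) * counterterm z j \<delta>" if "j \<ge> 1" for j
    using assms that by (auto simp: counterterm_def regular_def add_eq_0_iff2)
  then show ?thesis by (simp add: B0_def E0_def Bk_def Ek_def)
qed

text \<open>At its poles \<open>B0\<close> has the accidental values left by division by zero;
  \<open>remove_sings\<close> puts in those demanded by the normalization of
  \<open>beta_function\<close>.\<close>

definition betaf where "betaf = remove_sings B0"

lemma betaf_nice: "betaf nicely_meromorphic_on UNIV"
  unfolding betaf_def by (rule remove_sings_nicely_meromorphic[OF B0_meromorphic])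

lemma betaf_regular: "regular z \<Longrightarrow> betaf z = E0 z"
  unfolding betaf_def by (simp add: remove_sings_at_analytic[OF B0_analytic] B0_eq_E0)

lemma B0_isolated: "isolated_singularity_at B0 z"
  using meromorphic_on_isolated_singularity meromorphic_on_subset[OF B0_meromorphic] by blast

lemma eventually_betaf: "\<forall>\<^sub>F w in at z. betaf w = B0 w"
  unfolding betaf_def by (rule eventually_remove_sings_eq_at[OF B0_isolated])

lemma betaf_pole_iff: "is_pole betaf z \<longleftrightarrow> is_pole B0 z"
  by (rule is_pole_cong[OF eventually_betaf refl])

lemma betaf_pole:
  assumes "is_pole betaf z" obtains j where "j \<ge> 1" "c j \<noteq> 0" "z = - of_nat j"
proof -
  have "\<not> regular z"
    using assms betaf_pole_iff B0_analytic analytic_at_imp_no_pole by blast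
  then show thesis using that by (auto simp: regular_def)
qed

lemma betaf_pole_form: "is_pole betaf z \<Longrightarrow> \<exists>i::nat. z = - of_nat m - 2 * of_nat i"
  by (erule betaf_pole) (use c_nonzero in fastforce)

text \<open>With \<open>w = z + k\<close>, subtracting \<open>c k / w\<close> from the term
  \<open>c k * \<delta> powr w / w\<close> leaves a difference quotient of
  \<open>\<delta> powr w\<close> at 0. Its limit \<open>c k * ln \<delta>\<close> is exactly the
  logarithmic counterterm in \<open>Ek\<close>. The case \<open>c k = 0\<close> is included.\<close>

lemma betaf_at_pole:
  assumes k: "k \<ge> 1"
  shows "((\<lambda>w. betaf w - of_real (c k) / (w + of_nat k)) \<longlongrightarrow> E0 (- of_nat k)) (at (- of_nat k))"
    "residue betaf (- of_nat k) = of_real (c k)"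
proof -
  define z0 where "z0 = - (of_nat k :: complex)"
  have z0: "Re z0 > - real k - 1" by (simp add: z0_def)
  define G where "G = (\<lambda>w. Ak k w + (\<Sum>j\<in>{1..k}-{k}. of_real (c j) * (of_real \<delta> powr (w + of_nat j) / (w + of_nat j))))"
  have G: "G analytic_on {z0}"
    unfolding G_def
  proof (intro analytic_on_add Ak_analytic z0 analytic_on_sum)
    fix j assume "j \<in> {1..k} - {k}"
    then have "z0 + of_nat j \<noteq> 0" by (simp add: z0_def complex_eq_iff)
    then show "(\<lambda>w. of_real (c j) * (of_real \<delta> powr (w + of_nat j) / (w + of_nat j))) analytic_on {z0}"
      by (intro analytic_intros powr_delta_analytic) auto
  qed
  have Gt: "G \<midarrow>z0\<rightarrow> G z0" using analytic_at_imp_isCont[OF G] by (simp add: isCont_def)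
  have S: "(\<Sum>j=1..k. f j) = f k + (\<Sum>j\<in>{1..k}-{k}. f j)" for f :: "nat \<Rightarrow> complex"
    by (rule sum.remove) (use k in auto)
  have Bk: "Bk k w = G w + of_real (c k) * (of_real \<delta> powr (w + of_nat k) / (w + of_nat k))" for w
    by (simp only: Bk_def G_def S add_ac)
  have ev: "\<forall>\<^sub>F w in at z0. betaf w = G w + of_real (c k) * (of_real \<delta> powr (w + of_nat k) / (w + of_nat k))"
  proof -
    have "\<forall>\<^sub>F w in at z0. B0 w = Bk k w"
      using eventually_B0_Bk[OF z0] by (auto simp: eventually_at_filter elim: eventually_mono)
    with eventually_betaf[of z0] show ?thesis by eventually_elim (simp add: Bk)
  qed
  have dq: "((\<lambda>w. (of_real \<delta> powr (w + of_nat k) - 1) / (w + of_nat k)) \<longlongrightarrow> of_real (ln \<delta>)) (at z0)"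
  proof -
    have "((\<lambda>w. complex_of_real \<delta> powr (w + of_nat k)) has_field_derivative Ln (of_real \<delta>) * of_real \<delta> powr (z0 + of_nat k) * 1) (at z0)"
      by (rule DERIV_chain2[of "\<lambda>w. complex_of_real \<delta> powr w"]) (use \<delta> in \<open>auto intro!: derivative_eq_intros\<close>)
    then have "((\<lambda>w. (complex_of_real \<delta> powr (w + of_nat k) - complex_of_real \<delta> powr (z0 + of_nat k)) / (w - z0)) \<longlongrightarrow> Ln (of_real \<delta>) * of_real \<delta> powr (z0 + of_nat k)) (at z0)"
      by (simp add: has_field_derivative_iff)
    then show ?thesis using \<delta> by (simp add: z0_def Ln_of_real)
  qed
  have "((\<lambda>w. G w + of_real (c k) * ((of_real \<delta> powr (w + of_nat k) - 1) / (w + of_nat k))) \<longlongrightarrow> G z0 + of_real (c k) * of_real (ln \<delta>)) (at z0)"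
    by (intro tendsto_add tendsto_mult tendsto_const Gt dq)
  moreover have "\<forall>\<^sub>F w in at z0. G w + of_real (c k) * ((of_real \<delta> powr (w + of_nat k) - 1) / (w + of_nat k)) = betaf w - of_real (c k) / (w + of_nat k)"
    using ev by eventually_elim (simp add: diff_divide_distrib right_diff_distrib)
  ultimately have lim: "((\<lambda>w. betaf w - of_real (c k) / (w + of_nat k)) \<longlongrightarrow> G z0 + of_real (c k) * of_real (ln \<delta>)) (at z0)"
    by (rule Lim_transform_eventually)
  have "E0 z0 = Ek k z0" using Ek_eq_E0[OF z0] by simp
  also have "\<dots> = Ak k z0 + ((\<Sum>j\<in>{1..k}-{k}. of_real (c j) * counterterm z0 j \<delta>) + of_real (c k) * counterterm z0 k \<delta>)"
    by (simp only: Ek_def S add_ac)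
  also have "(\<Sum>j\<in>{1..k}-{k}. of_real (c j) * counterterm z0 j \<delta>) = (\<Sum>j\<in>{1..k}-{k}. of_real (c j) * (of_real \<delta> powr (z0 + of_nat j) / (z0 + of_nat j)))"
    by (intro sum.cong refl) (auto simp: counterterm_def z0_def complex_eq_iff)
  also have "counterterm z0 k \<delta> = of_real (ln \<delta>)" by (simp add: counterterm_def z0_def)
  finally have "E0 z0 = G z0 + of_real (c k) * of_real (ln \<delta>)" by (simp add: G_def add_ac)
  with lim show "((\<lambda>w. betaf w - of_real (c k) / (w + of_nat k)) \<longlongrightarrow> E0 (- of_nat k)) (at (- of_nat k))"
    by (simp add: z0_def)
  obtain e where e: "e > 0" "betaf analytic_on ball z0 e - {z0}"
    using meromorphic_on_isolated_singularity[of betaf z0] betaf_nice meromorphic_on_subset[of betaf UNIV "{z0}"]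
    by (auto simp: nicely_meromorphic_on_def isolated_singularity_at_def)
  have "residue betaf z0 = of_real (c k)"
  proof (rule residue_simple')
    show "open (ball z0 e)" "z0 \<in> ball z0 e" using e by auto
    show "betaf holomorphic_on ball z0 e - {z0}" using e by (intro analytic_imp_holomorphic)
    have "((\<lambda>w. G w * (w - z0) + of_real (c k) * of_real \<delta> powr (w + of_nat k)) \<longlongrightarrow> G z0 * (z0 - z0) + of_real (c k) * of_real \<delta> powr (z0 + of_nat k)) (at z0)"
    proof -
      have "isCont (\<lambda>w. complex_of_real \<delta> powr (w + of_nat k)) z0"
        by (rule analytic_at_imp_isCont[OF powr_delta_analytic])
      then show ?thesis by (intro tendsto_add tendsto_mult tendsto_const tendsto_diff Gt tendsto_ident_at) (simp add: isCont_def)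
    qed
    also have "G z0 * (z0 - z0) + of_real (c k) * of_real \<delta> powr (z0 + of_nat k) = of_real (c k)" using \<delta> by (simp add: z0_def)
    finally show "((\<lambda>w. betaf w * (w - z0)) \<longlongrightarrow> of_real (c k)) (at z0)"
    proof (rule Lim_transform_eventually)
      have "\<forall>\<^sub>F w in at z0. w \<noteq> z0" by (simp add: eventually_at_filter)
      with ev show "\<forall>\<^sub>F w in at z0. G w * (w - z0) + of_real (c k) * of_real \<delta> powr (w + of_nat k) = betaf w * (w - z0)"
        by eventually_elim (simp add: z0_def add_eq_0_iff2 field_simps)
    qed
  qed
  then show "residue betaf (- of_nat k) = of_real (c k)" by (simp add: z0_def)
qed

text \<open>As \<open>c j = 0\<close> for \<open>j < m\<close>, the Taylor polynomial of order
  \<open>m - 1\<close> is 0 and the density is of order \<open>r ^ (m - 1)\<close>. For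
  \<open>m = 0\<close> the truncated subtraction leaves a bounded density, which suffices for
  \<open>Re z > 0\<close>.\<close>

lemma integrable_nu_radial_powr:
  assumes "Re z > - real m" shows "integrable \<nu> (\<lambda>r. radial_powr z r)"
proof -
  have b: "\<bar>\<Gamma> 1 r\<bar> \<le> C (Suc (m - 1)) * r ^ (m - 1)" if "0 \<le> r" "r < d" for r
  proof -
    have "c j = 0" if "j < m" for j using c_nonzero[of j] that by force
    then have "(\<Sum>j=1..m - 1. c j * r ^ (j - 1)) = 0" by (intro sum.neutral) auto
    then show ?thesis using Rem_le[OF that, of "m - 1"] by (simp add: Rem_def)
  qed
  have "integrable lborel (\<lambda>r. (indicator {0<..\<delta>} r * \<Gamma> 1 r) *\<^sub>R radial_powr z r)"
  proof (rule Bochner_Integration.integrable_bound[of _ "\<lambda>r. C (Suc (m - 1)) * (indicator {0<..\<delta>} r * r powr (real (m - 1) + Re z))"])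
    show "integrable lborel (\<lambda>r. C (Suc (m - 1)) * (indicator {0<..\<delta>} r * r powr (real (m - 1) + Re z)))"
      using assms \<delta> by (intro integrable_mult_right integrable_powr_Ioc) (auto simp: of_nat_diff)
    have C0: "0 \<le> C (Suc (m - 1))" using bnd[of 0 "Suc (m - 1)"] d_pos by (auto intro: order_trans[OF abs_ge_zero])
    have "\<bar>\<Gamma> 1 r\<bar> * r powr Re z \<le> C (Suc (m - 1)) * r powr (real (m - 1) + Re z)" if r: "0 < r" "r \<le> \<delta>" for r
    proof -
      have "\<bar>\<Gamma> 1 r\<bar> * r powr Re z \<le> (C (Suc (m - 1)) * r ^ (m - 1)) * r powr Re z"
        using b[of r] r \<delta> by (intro mult_right_mono) auto
      also have "\<dots> = C (Suc (m - 1)) * r powr (real (m - 1) + Re z)"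
        using r by (simp add: powr_add powr_realpow)
      finally show ?thesis .
    qed
    then show "AE r in lborel. norm ((indicator {0<..\<delta>} r * \<Gamma> 1 r) *\<^sub>R radial_powr z r) \<le> norm (C (Suc (m - 1)) * (indicator {0<..\<delta>} r * r powr (real (m - 1) + Re z)))"
      using C0 by (intro AE_I2) (auto simp: indicator_def norm_radial_powr abs_mult)
  qed auto
  then have "integrable \<nu> (\<lambda>r. indicator {0<..\<delta>} r *\<^sub>R radial_powr z r)" by (subst integrable_nu_lborel) auto
  then have "integrable \<nu> (\<lambda>r. indicator {0<..\<delta>} r *\<^sub>R radial_powr z r + indicator {\<delta><..} r *\<^sub>R radial_powr z r)"
    by (intro Bochner_Integration.integrable_add integrable_tail_radial_powr \<delta>)
  moreover have "indicator {0<..\<delta>} r *\<^sub>R radial_powr z r + indicator {\<delta><..} r *\<^sub>R radial_powr z r = radial_powr z r" for r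
    using \<delta> by (auto simp: indicator_def radial_powr_def)
  ultimately show ?thesis by (simp only:)
qed

text \<open>A counterterm with nonzero coefficient has \<open>j \<ge> m\<close> and tends to 0 in
  this half-plane, so the finite part is the plain integral.\<close>

lemma betaf_eq_integral:
  assumes z: "Re z > - real m" shows "betaf z = (\<integral>r. radial_powr z r \<partial>\<nu>)"
proof -
  have reg: "regular z"
    unfolding regular_def
  proof (intro allI impI)
    fix j assume "c j \<noteq> 0"
    then have "j \<ge> m" using c_nonzero[of j] by force
    then show "z \<noteq> - of_nat j" using z by auto
  qed
  let ?k = "level z"
  have "((\<lambda>\<epsilon>. of_real (c j) * counterterm z j \<epsilon>) \<longlongrightarrow> 0) (at_right 0)" for j
  proof (cases "c j = 0")
    case False
    then have "j \<ge> m" using c_nonzero[of j] by force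
    then have "Re z + real j > 0" using z by linarith
    from tendsto_mult[OF tendsto_const counterterm_tendsto_0[OF this]] show ?thesis by simp
  qed simp
  then have "((\<lambda>\<epsilon>. rz \<epsilon> z + (\<Sum>j=1..?k. of_real (c j) * counterterm z j \<epsilon>)) \<longlongrightarrow> (\<integral>r. radial_powr z r \<partial>\<nu>) + (\<Sum>j=1..?k. 0)) (at_right 0)"
    unfolding rz_def
    by (intro tendsto_add tendsto_cut_integral integrable_nu_radial_powr z tendsto_sum) (auto simp: radial_powr_def)
  then have "((\<lambda>\<epsilon>. rz \<epsilon> z + (\<Sum>j=1..?k. of_real (c j) * counterterm z j \<epsilon>)) \<longlongrightarrow> (\<integral>r. radial_powr z r \<partial>\<nu>)) (at_right 0)"
    by simp
  from tendsto_unique[OF trivial_limit_at_right_real this E0_tendsto[OF level(1)]] show ?thesis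
    using betaf_regular[OF reg] by simp
qed

end

section \<open>The energy of a closed submanifold\<close>

lemma halfline_deriv_eq:
  assumes f: "\<And>t. 0 \<le> t \<Longrightarrow> t < d \<Longrightarrow> f t = g 0 t"
    and g: "\<And>k t. 0 \<le> t \<Longrightarrow> t < d \<Longrightarrow> (g k has_real_derivative g (Suc k) t) (at t within {0..<d})"
    and t: "0 \<le> t" "t < d"
  shows "halfline_deriv k f t = g k t"
  using t
proof (induction k arbitrary: t)
  case 0
  then show ?case using f by (simp add: halfline_deriv_def)
next
  case (Suc k)
  \<comment> \<open>Below \<open>d\<close> the two sets coincide near \<open>t\<close>, so the
    derivatives within them agree, one-sided ones at 0 included.\<close>
  have nb: "at t within {0..<d} = at t within {0..}"
    by (rule at_within_nhd[of t "{..<d}"]) (use Suc.prems in auto)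
  have "(g k has_vector_derivative g (Suc k) t) (at t within {0..})"
    using g[OF Suc.prems, of k] by (simp add: nb has_real_derivative_iff_has_vector_derivative)
  then have "(halfline_deriv k f has_vector_derivative g (Suc k) t) (at t within {0..})"
  proof (rule has_vector_derivative_transform_within[of _ _ _ _ "d - t"])
    fix s assume "s \<in> {0..}" "dist s t < d - t"
    then show "g k s = halfline_deriv k f s" using Suc.IH[of s] by (auto simp: dist_real_def abs_less_iff)
  qed (use Suc.prems in auto)
  moreover have "at t within {0..} \<noteq> bot"
  proof -
    have "at t within {t..t + 1} \<noteq> bot" by (simp add: at_within_Icc_at_right)
    then show ?thesis using at_le[of "{t..t + 1}" "{0..}" t] Suc.prems by (auto simp: bot_unique)
  qed
  ultimately have "vector_derivative (halfline_deriv k f) (at t within {0..}) = g (Suc k) t"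
    by (rule vector_derivative_within[rotated])
  then show ?case by (simp add: halfline_deriv_def)
qed

lemma uniform_deriv_chain:
  fixes M :: "(real^'n::finite) set"
  assumes M: "closed_submanifold m M" and vol: "is_riemannian_volume m M \<mu>"
  obtains d C where "d > 0"
    "\<And>x. x \<in> M \<Longrightarrow> \<exists>g. deriv_chain d C m g \<and> (\<forall>t. 0 < t \<and> t < d \<longrightarrow> emeasure \<mu> (M \<inter> cball x t) < \<infinity> \<and> measure \<mu> (M \<inter> cball x t) = g 0 t)"
proof -
  define good where "good = (\<lambda>x d C. \<exists>g. deriv_chain d C m g \<and> (\<forall>t. 0 < t \<and> t < d \<longrightarrow> emeasure \<mu> (M \<inter> cball x t) < \<infinity> \<and> measure \<mu> (M \<inter> cball x t) = g 0 t))"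
  have good_mono: "good x d C \<Longrightarrow> d' \<le> d \<Longrightarrow> (\<And>k. C k \<le> C' k) \<Longrightarrow> good x d' C'" for x d d' C C'
    unfolding good_def by (meson deriv_chain_subset order_less_le_trans)
  have "\<forall>p\<in>M. \<exists>U d C. open U \<and> p \<in> U \<and> d > 0 \<and> (\<forall>x\<in>M \<inter> U. good x d C)"
    unfolding good_def using local_deriv_chain[OF M vol] by metis
  then obtain U dd CC where U: "\<And>p. p \<in> M \<Longrightarrow> open (U p) \<and> p \<in> U p \<and> dd p > 0 \<and> (\<forall>x\<in>M \<inter> U p. good x (dd p) (CC p))"
    by metis
  have "compact M" using M by (simp add: closed_submanifold_def)
  moreover have "M \<subseteq> (\<Union>p\<in>M. U p)" using U by blast
  ultimately obtain T where T: "T \<subseteq> M" "finite T" "M \<subseteq> (\<Union>p\<in>T. U p)"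
    using compactE_image[of M M U] U by metis
  \<comment> \<open>The 1 keeps the set nonempty when \<open>M\<close> is empty. The sum in the next
    line dominates each of the finitely many local bounds.\<close>
  define d where "d = Min (insert 1 (dd ` T))"
  define C where "C = (\<lambda>k. \<Sum>p\<in>T. \<bar>CC p k\<bar>)"
  have "d > 0" unfolding d_def using T U by (subst Min_gr_iff) auto
  moreover have "good x d C" if xM: "x \<in> M" for x
  proof -
    obtain p where p: "p \<in> T" "x \<in> U p" using subsetD[OF T(3) xM] by blast
    have "good x (dd p) (CC p)" using U[of p] p T(1) xM by blast
    moreover have "d \<le> dd p" unfolding d_def using T p by (intro Min_le) auto
    moreover have "CC p k \<le> C k" for k
      unfolding C_def using member_le_sum[of p T "\<lambda>p. \<bar>CC p k\<bar>"] p T by auto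
    ultimately show ?thesis by (rule good_mono)
  qed
  ultimately show thesis using that unfolding good_def by blast
qed

text \<open>Finitely many balls of radius \<open>d / 2\<close> cover \<open>M\<close>, and each has
  finite volume by the local expansion.\<close>

lemma emeasure_riemannian_volume_finite:
  fixes M :: "(real^'n::finite) set"
  assumes M: "closed_submanifold m M" and vol: "is_riemannian_volume m M \<mu>"
  shows "emeasure \<mu> M < \<infinity>"
proof -
  obtain d C where d: "d > 0"
    "\<And>x. x \<in> M \<Longrightarrow> \<exists>g. deriv_chain d C m g \<and> (\<forall>t. 0 < t \<and> t < d \<longrightarrow> emeasure \<mu> (M \<inter> cball x t) < \<infinity> \<and> measure \<mu> (M \<inter> cball x t) = g 0 t)"
    using uniform_deriv_chain[OF M vol] by metis
  have sets: "sets \<mu> = sets (restrict_space borel M)" using vol by (simp add: is_riemannian_volume_def)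
  have MB: "M \<in> sets borel" by (rule closed_submanifold_borel[OF M])
  have fin: "emeasure \<mu> (M \<inter> cball x (d / 2)) < \<infinity>" if "x \<in> M" for x
    using d(2)[OF that] d(1) by force
  have "compact M" using M by (simp add: closed_submanifold_def)
  moreover have "M \<subseteq> (\<Union>x\<in>M. ball x (d / 2))" using d by auto
  ultimately obtain T where T: "T \<subseteq> M" "finite T" "M \<subseteq> (\<Union>x\<in>T. ball x (d / 2))"
    using compactE_image[of M M "\<lambda>x. ball x (d / 2)"] by (metis open_ball)
  have csets: "M \<inter> cball x (d / 2) \<in> sets \<mu>" for x
    unfolding sets using MB by (auto simp: sets_restrict_space_iff)
  have "M \<subseteq> (\<Union>x\<in>T. M \<inter> cball x (d / 2))" using T(3) ball_subset_cball by blast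
  then have "emeasure \<mu> M \<le> emeasure \<mu> (\<Union>x\<in>T. M \<inter> cball x (d / 2))"
    by (rule emeasure_mono) (intro sets.finite_UN T csets)
  also have "\<dots> \<le> (\<Sum>x\<in>T. emeasure \<mu> (M \<inter> cball x (d / 2)))"
    using T csets by (intro emeasure_subadditive_finite) auto
  also have "\<dots> < \<infinity>" using fin T by (auto simp: subset_iff)
  finally show ?thesis .
qed

section \<open>The distribution of distances on a closed submanifold\<close>

locale submanifold =
  fixes m :: nat and M :: "(real^'n::finite) set"
  assumes M: "closed_submanifold m M"
begin

definition "\<mu> = riemannian_volume m M"

lemma vol: "is_riemannian_volume m M \<mu>"
  unfolding \<mu>_def by (rule is_riemannian_volume_riemannian_volume[OF M])

lemma M_borel: "M \<in> sets borel" by (rule closed_submanifold_borel[OF M])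

lemma sets_mu: "sets \<mu> = sets (restrict_space borel M)"
  using vol by (simp add: is_riemannian_volume_def)

lemma space_mu: "space \<mu> = M"
  using sets_eq_imp_space_eq[OF sets_mu] by (simp add: space_restrict_space)

sublocale finite_measure \<mu>
proof
  have "emeasure \<mu> (space \<mu>) < \<infinity>" unfolding space_mu by (rule emeasure_riemannian_volume_finite[OF M vol])
  then show "emeasure \<mu> (space \<mu>) \<noteq> \<infinity>" by simp
qed

lemma id_measurable: "(\<lambda>x. x) \<in> \<mu> \<rightarrow>\<^sub>M borel"
  using measurable_cong_sets[OF sets_mu refl] measurable_restrict_space1[OF measurable_ident, of borel M] by (auto simp: id_def)

lemma dist_measurable [measurable]: "(\<lambda>p. norm (fst p - snd p)) \<in> borel_measurable (\<mu> \<Otimes>\<^sub>M \<mu>)"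
proof -
  have [measurable]: "fst \<in> \<mu> \<Otimes>\<^sub>M \<mu> \<rightarrow>\<^sub>M borel" "snd \<in> \<mu> \<Otimes>\<^sub>M \<mu> \<rightarrow>\<^sub>M borel"
    using measurable_compose[OF measurable_fst id_measurable] measurable_compose[OF measurable_snd id_measurable] by auto
  show ?thesis by measurable
qed

definition near :: "real \<Rightarrow> ((real^'n) \<times> (real^'n)) set" where
  "near t = {p \<in> space (\<mu> \<Otimes>\<^sub>M \<mu>). norm (fst p - snd p) \<le> t}"

lemma near_sets: "near t \<in> sets (\<mu> \<Otimes>\<^sub>M \<mu>)" unfolding near_def by measurable

lemma near_slice: "x \<in> M \<Longrightarrow> Pair x -` near t = M \<inter> cball x t"
  by (auto simp: near_def space_pair_measure space_mu dist_norm)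

lemma psi_at_measurable: "(\<lambda>x. psi_at m M x t) \<in> borel_measurable \<mu>"
proof -
  have "(\<lambda>x. emeasure \<mu> (Pair x -` near t)) \<in> borel_measurable \<mu>"
    by (rule measurable_emeasure_Pair[OF near_sets])
  then have "(\<lambda>x. enn2real (emeasure \<mu> (Pair x -` near t))) \<in> borel_measurable \<mu>" by measurable
  then show ?thesis
    by (rule measurable_cong[THEN iffD1, rotated]) (simp add: psi_at_def measure_def \<mu>_def[symmetric] space_mu near_slice)
qed

lemma cball_sets: "M \<inter> cball x t \<in> sets \<mu>"
  unfolding sets_mu using M_borel by (auto simp: sets_restrict_space_iff)

lemma psi_at_bounds: "0 \<le> psi_at m M x t" "psi_at m M x t \<le> measure \<mu> M"
  using finite_measure_mono[of "M \<inter> cball x t" M] sets.top[of \<mu>] by (auto simp: psi_at_def \<mu>_def[symmetric] space_mu)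

text \<open>The rescaling argument covers positive radii only. At \<open>t = 0\<close> continuity of
  the measure from above and continuity of \<open>\<gamma> x 0\<close> give the same limit.\<close>

lemma psi_at_chain:
  obtains d C \<gamma> where "d > 0" "\<And>x. x \<in> M \<Longrightarrow> deriv_chain d C m (\<gamma> x)"
    "\<And>x t. x \<in> M \<Longrightarrow> 0 \<le> t \<Longrightarrow> t < d \<Longrightarrow> psi_at m M x t = \<gamma> x 0 t"
proof -
  obtain d C where d: "d > 0"
    "\<And>x. x \<in> M \<Longrightarrow> \<exists>g. deriv_chain d C m g \<and> (\<forall>t. 0 < t \<and> t < d \<longrightarrow> emeasure \<mu> (M \<inter> cball x t) < \<infinity> \<and> measure \<mu> (M \<inter> cball x t) = g 0 t)"
    using uniform_deriv_chain[OF M vol] by metis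
  then obtain \<gamma> where \<gamma>: "\<And>x. x \<in> M \<Longrightarrow> deriv_chain d C m (\<gamma> x)"
    "\<And>x t. x \<in> M \<Longrightarrow> 0 < t \<Longrightarrow> t < d \<Longrightarrow> measure \<mu> (M \<inter> cball x t) = \<gamma> x 0 t" by metis
  have "psi_at m M x t = \<gamma> x 0 t" if x: "x \<in> M" and t: "0 \<le> t" "t < d" for x t
  proof (cases "t = 0")
    case False
    then show ?thesis using \<gamma>(2) x t by (simp add: psi_at_def \<mu>_def)
  next
    case True
    \<comment> \<open>The shift by 2 gives \<open>s n < d\<close> already for
      \<open>n = 0\<close>.\<close>
    define s where "s = (\<lambda>n. d / real (n + 2))"
    have s: "0 < s n" "s n < d" for n
    proof -
      show "0 < s n" using d(1) by (simp add: s_def divide_pos_pos)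
      have "d / real (n + 2) < d / 1" using d(1) by (intro divide_strict_left_mono) auto
      then show "s n < d" by (simp add: s_def)
    qed
    have s0: "s \<longlonglongrightarrow> 0"
      unfolding s_def by (rule LIMSEQ_ignore_initial_segment[OF lim_const_over_n[of d], of 2])
    have "(\<lambda>n. measure \<mu> (M \<inter> cball x (s n))) \<longlonglongrightarrow> measure \<mu> (\<Inter>n. M \<inter> cball x (s n))"
    proof (rule finite_Lim_measure_decseq)
      show "range (\<lambda>n. M \<inter> cball x (s n)) \<subseteq> sets \<mu>" using cball_sets by auto
      show "decseq (\<lambda>n. M \<inter> cball x (s n))"
      proof (rule antimonoI)
        fix i j :: nat assume "i \<le> j"
        then have "s j \<le> s i" using d(1) by (auto simp: s_def frac_le)
        then show "M \<inter> cball x (s j) \<subseteq> M \<inter> cball x (s i)" by auto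
      qed
    qed
    also have "(\<Inter>n. M \<inter> cball x (s n)) = M \<inter> cball x 0"
    proof (intro equalityI subsetI)
      fix y assume "y \<in> (\<Inter>n. M \<inter> cball x (s n))"
      then have "y \<in> M" "\<And>n. dist x y \<le> s n" by auto
      then have "dist x y \<le> 0" using LIMSEQ_le_const[OF s0] by blast
      then show "y \<in> M \<inter> cball x 0" using \<open>y \<in> M\<close> by simp
    qed (use s in \<open>auto simp: less_imp_le\<close>)
    finally have 1: "(\<lambda>n. \<gamma> x 0 (s n)) \<longlonglongrightarrow> psi_at m M x 0"
      using \<gamma>(2)[OF x s] by (simp add: psi_at_def \<mu>_def)
    have "isCont (\<gamma> x 0) 0"
      using \<gamma>(1)[OF x] d(1) by (intro DERIV_isCont[of _ "\<gamma> x (Suc 0) 0"]) (auto simp: deriv_chain_def)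
    then have "(\<lambda>n. \<gamma> x 0 (s n)) \<longlonglongrightarrow> \<gamma> x 0 0" using s0 by (rule isCont_tendsto_compose)
    then show ?thesis using 1 True LIMSEQ_unique by blast
  qed
  with d(1) \<gamma>(1) show thesis by (rule that)
qed

lemma psi_chain:
  obtains d \<Gamma> C where "d > 0"
    "\<And>t. 0 \<le> t \<Longrightarrow> t < d \<Longrightarrow> psi m M t = \<Gamma> 0 t"
    "\<And>k t. 0 \<le> t \<Longrightarrow> t < d \<Longrightarrow> (\<Gamma> k has_real_derivative \<Gamma> (Suc k) t) (at t within {0..<d})"
    "\<And>k t. 0 \<le> t \<Longrightarrow> t < d \<Longrightarrow> \<bar>\<Gamma> k t\<bar> \<le> C k"
    "\<And>k. \<Gamma> k 0 \<noteq> 0 \<Longrightarrow> \<exists>i. k = m + 2 * i"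
    "\<And>k. (LINT x|\<mu>. taylor_b m M k x) = \<Gamma> k 0 / fact k"
proof -
  obtain d C \<gamma> where d: "d > 0" and ch: "\<And>x. x \<in> M \<Longrightarrow> deriv_chain d C m (\<gamma> x)"
    and psi: "\<And>x t. x \<in> M \<Longrightarrow> 0 \<le> t \<Longrightarrow> t < d \<Longrightarrow> psi_at m M x t = \<gamma> x 0 t"
    by (rule psi_at_chain, rule that)
  have \<gamma>D: "(\<gamma> x k has_real_derivative \<gamma> x (Suc k) t) (at t within {0..<d})" if "x \<in> M" "0 \<le> t" "t < d" for x k t
    using ch[OF that(1)] that by (auto simp: deriv_chain_def intro: has_field_derivative_at_within)
  have \<gamma>C: "\<bar>\<gamma> x k t\<bar> \<le> C k" if "x \<in> M" "0 \<le> t" "t < d" for x k t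
    using ch[OF that(1)] that by (auto simp: deriv_chain_def)
  have meas: "(\<lambda>x. \<gamma> x k t) \<in> borel_measurable \<mu>" if "0 \<le> t" "t < d" for k t
    using that
  proof (induction k arbitrary: t)
    case 0
    show ?case by (rule measurable_cong[THEN iffD1, OF _ psi_at_measurable[of t]]) (use psi 0 in \<open>auto simp: space_mu\<close>)
  next
    case (Suc k)
    \<comment> \<open>The families \<open>\<gamma> x\<close> come from a choice at each
      \<open>x\<close>, so measurability in \<open>x\<close> has to be earned: the next derivative
      is a limit of difference quotients along a sequence to the right of \<open>t\<close>.\<close>
    define s where "s = (\<lambda>n. t + (d - t) / real (n + 2))"
    have s: "t < s n" "s n < d" for n
    proof -
      show "t < s n" using Suc.prems by (simp add: s_def divide_pos_pos)
      have "(d - t) / real (n + 2) < (d - t) / 1" using Suc.prems by (intro divide_strict_left_mono) auto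
      then show "s n < d" by (simp add: s_def)
    qed
    have st: "s \<longlonglongrightarrow> t + 0"
      unfolding s_def by (intro tendsto_add tendsto_const LIMSEQ_ignore_initial_segment[OF lim_const_over_n[of "d - t"], of 2])
    show ?case
    proof (rule borel_measurable_LIMSEQ_real)
      fix x assume "x \<in> space \<mu>"
      then have "((\<lambda>y. (\<gamma> x k y - \<gamma> x k t) / (y - t)) \<longlongrightarrow> \<gamma> x (Suc k) t) (at t within {0..<d})"
        using \<gamma>D[of x t k] Suc.prems by (simp add: has_field_derivative_iff space_mu)
      moreover have "filterlim s (at t within {0..<d}) sequentially"
      proof -
        have "s n \<in> {0..<d}" "s n \<noteq> t" for n using s[of n] Suc.prems by auto
        then show ?thesis using st by (simp add: filterlim_at)
      qed
      ultimately show "(\<lambda>n. (\<gamma> x k (s n) - \<gamma> x k t) / (s n - t)) \<longlonglongrightarrow> \<gamma> x (Suc k) t"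
        by (rule filterlim_compose)
    next
      fix n
      have "(\<lambda>x. \<gamma> x k (s n)) \<in> borel_measurable \<mu>" "(\<lambda>x. \<gamma> x k t) \<in> borel_measurable \<mu>"
        using Suc.IH[of "s n"] Suc.IH[of t] s[of n] Suc.prems by auto
      then show "(\<lambda>x. (\<gamma> x k (s n) - \<gamma> x k t) / (s n - t)) \<in> borel_measurable \<mu>" by measurable
    qed
  qed
  have integ: "integrable \<mu> (\<lambda>x. \<gamma> x k t)" if "0 \<le> t" "t < d" for k t
    by (rule integrable_const_bound[of _ "C k"]) (use meas[OF that] \<gamma>C that in \<open>auto simp: space_mu\<close>)
  define \<Gamma> where "\<Gamma> = (\<lambda>k t. LINT x|\<mu>. \<gamma> x k t)"
  show thesis
  proof (rule that[of d \<Gamma> "\<lambda>k. C k * measure \<mu> M"])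
    show "d > 0" by (rule d)
    show "psi m M t = \<Gamma> 0 t" if "0 \<le> t" "t < d" for t
      unfolding psi_def \<Gamma>_def \<mu>_def[symmetric]
      by (rule Bochner_Integration.integral_cong[OF refl]) (use psi that in \<open>auto simp: space_mu\<close>)
    show "(\<Gamma> k has_real_derivative \<Gamma> (Suc k) t) (at t within {0..<d})" if "0 \<le> t" "t < d" for k t
      unfolding \<Gamma>_def
    proof (rule has_field_derivative_integral[where w="\<lambda>_. C (Suc k)"])
      show "(\<lambda>x. \<gamma> x (Suc k) t) \<in> borel_measurable \<mu>" by (rule meas[OF that])
    qed (use that integ \<gamma>D \<gamma>C in \<open>auto simp: space_mu\<close>)
    show "\<bar>\<Gamma> k t\<bar> \<le> C k * measure \<mu> M" if "0 \<le> t" "t < d" for k t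
    proof -
      have "\<bar>\<Gamma> k t\<bar> \<le> (LINT x|\<mu>. \<bar>\<gamma> x k t\<bar>)" unfolding \<Gamma>_def by (rule integral_abs_bound)
      also have "\<dots> \<le> (LINT x|\<mu>. C k)"
        using \<gamma>C that integ[OF that] by (intro integral_mono) (auto simp: space_mu)
      finally show ?thesis by (simp add: space_mu mult.commute)
    qed
    show "\<exists>i. k = m + 2 * i" if "\<Gamma> k 0 \<noteq> 0" for k
    proof (rule ccontr)
      assume no: "\<nexists>i. k = m + 2 * i"
      have "\<gamma> x k 0 = 0" if "x \<in> M" for x
        using deriv_chain_zero[OF ch[OF that] d, of k] no by blast
      then have "\<Gamma> k 0 = (LINT x|\<mu>. 0)"
        unfolding \<Gamma>_def by (intro Bochner_Integration.integral_cong) (auto simp: space_mu)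
      then show False using that by simp
    qed
    show "(LINT x|\<mu>. taylor_b m M k x) = \<Gamma> k 0 / fact k" for k
    proof -
      have "taylor_b m M k x = \<gamma> x k 0 / fact k" if "x \<in> M" for x
        unfolding taylor_b_def
        using halfline_deriv_eq[of d "psi_at m M x" "\<gamma> x" 0 k] psi[OF that] \<gamma>D[OF that] d by simp
      then have "(LINT x|\<mu>. taylor_b m M k x) = (LINT x|\<mu>. \<gamma> x k 0 / fact k)"
        by (intro Bochner_Integration.integral_cong) (auto simp: space_mu)
      then show ?thesis by (simp add: \<Gamma>_def)
    qed
  qed
qed

definition \<nu> :: "real measure" where "\<nu> = distr (\<mu> \<Otimes>\<^sub>M \<mu>) borel (\<lambda>p. norm (fst p - snd p))"

lemma pair_finite: "finite_measure (\<mu> \<Otimes>\<^sub>M \<mu>)"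
  by (rule finite_measure_pair_measure) unfold_locales

lemma finite_nu: "finite_measure \<nu>"
  unfolding \<nu>_def by (rule finite_measure.finite_measure_distr[OF pair_finite dist_measurable])

lemma measure_nu: "0 \<le> t \<Longrightarrow> measure \<nu> {..t} = psi m M t"
proof -
  assume t: "0 \<le> t"
  have "emeasure \<nu> {..t} = emeasure (\<mu> \<Otimes>\<^sub>M \<mu>) (near t)"
    unfolding \<nu>_def near_def by (subst emeasure_distr) (auto intro!: arg_cong[where f="emeasure (\<mu> \<Otimes>\<^sub>M \<mu>)"])
  also have "\<dots> = (\<integral>\<^sup>+x. emeasure \<mu> (Pair x -` near t) \<partial>\<mu>)"
    by (rule emeasure_pair_measure_alt[OF near_sets])
  also have "\<dots> = (\<integral>\<^sup>+x. ennreal (psi_at m M x t) \<partial>\<mu>)"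
    by (rule nn_integral_cong) (simp add: space_mu near_slice psi_at_def \<mu>_def[symmetric] emeasure_eq_measure)
  also have "\<dots> = ennreal (psi m M t)"
    unfolding psi_def \<mu>_def[symmetric]
  proof (rule nn_integral_eq_integral)
    show "integrable \<mu> (\<lambda>x. psi_at m M x t)"
      by (rule integrable_const_bound[of _ "measure \<mu> M"]) (use psi_at_measurable psi_at_bounds in auto)
  qed (use psi_at_bounds in auto)
  finally have "emeasure \<nu> {..t} = ennreal (psi m M t)" .
  moreover have "0 \<le> psi m M t"
    unfolding psi_def by (rule integral_nonneg_AE) (use psi_at_bounds in auto)
  ultimately show ?thesis by (simp add: measure_def)
qed

lemma range_nu: obtains D where "AE r in \<nu>. 0 \<le> r \<and> r \<le> D"
proof -
  have "bounded M" using M by (simp add: closed_submanifold_def compact_imp_bounded)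
  then obtain D where D: "\<And>x. x \<in> M \<Longrightarrow> norm x \<le> D" by (auto simp: bounded_iff)
  have "AE p in \<mu> \<Otimes>\<^sub>M \<mu>. 0 \<le> norm (fst p - snd p) \<and> norm (fst p - snd p) \<le> 2 * D"
  proof (rule AE_I2)
    fix p assume "p \<in> space (\<mu> \<Otimes>\<^sub>M \<mu>)"
    then have "norm (fst p) \<le> D" "norm (snd p) \<le> D" using D by (auto simp: space_pair_measure space_mu)
    then show "0 \<le> norm (fst p - snd p) \<and> norm (fst p - snd p) \<le> 2 * D"
      using norm_triangle_ineq4[of "fst p" "snd p"] by auto
  qed
  then have "AE r in \<nu>. 0 \<le> r \<and> r \<le> 2 * D" unfolding \<nu>_def by (subst AE_distr_iff) auto
  then show thesis by (rule that)
qed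

lemma riesz_all: "riesz_integral_on m M (M \<times> M) z = (\<integral>r. radial_powr z r \<partial>\<nu>)"
proof -
  have "riesz_integral_on m M (M \<times> M) z = (\<integral>p. radial_powr z (norm (fst p - snd p)) \<partial>(\<mu> \<Otimes>\<^sub>M \<mu>))"
    unfolding riesz_integral_on_def set_lebesgue_integral_def \<mu>_def[symmetric]
    by (rule Bochner_Integration.integral_cong) (auto simp: space_pair_measure space_mu radial_powr_nonneg)
  also have "\<dots> = (\<integral>r. radial_powr z r \<partial>\<nu>)" unfolding \<nu>_def by (rule integral_distr[symmetric]) auto
  finally show ?thesis .
qed

lemma riesz_off_diagonal: "riesz_integral_on m M (M \<times> M - diagonal_nbhd \<epsilon>) z = (\<integral>r. indicator {\<epsilon><..} r *\<^sub>R radial_powr z r \<partial>\<nu>)"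
proof -
  have "riesz_integral_on m M (M \<times> M - diagonal_nbhd \<epsilon>) z = (\<integral>p. indicator {\<epsilon><..} (norm (fst p - snd p)) *\<^sub>R radial_powr z (norm (fst p - snd p)) \<partial>(\<mu> \<Otimes>\<^sub>M \<mu>))"
    unfolding riesz_integral_on_def set_lebesgue_integral_def \<mu>_def[symmetric]
    by (rule Bochner_Integration.integral_cong) (auto simp: space_pair_measure space_mu radial_powr_nonneg diagonal_nbhd_def indicator_def)
  also have "\<dots> = (\<integral>r. indicator {\<epsilon><..} r *\<^sub>R radial_powr z r \<partial>\<nu>)" unfolding \<nu>_def by (rule integral_distr[symmetric]) auto
  finally show ?thesis .
qed

end

text \<open>The second conjunct gives meaning to \<open>regularized_energy\<close>, a definite
  description: limits are unique, so existence is the only question. In the last one, residue and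
  Taylor integral are two forms of the same coefficient \<open>c k\<close>.\<close>

theorem proposition3p6:
  fixes M :: "(real^'n::finite) set" and m :: nat
  assumes "closed_submanifold m M"
  shows "(\<forall>z. is_pole (beta_function m M) z \<longrightarrow> (\<exists>i::nat. z = - of_nat m - 2 * of_nat i)) \<and>
    (\<forall>z. \<exists>E. has_regularized_energy m M z E) \<and>
    (\<forall>z. (\<forall>i::nat. z \<noteq> - of_nat m - 2 * of_nat i) \<longrightarrow>
         regularized_energy m M z = beta_function m M z) \<and>
    (\<forall>k::nat. (LINT x|riemannian_volume m M. taylor_b m M k x) = 0 \<longrightarrow>
         regularized_energy m M (- of_nat k) = beta_function m M (- of_nat k)) \<and>
    (\<forall>k::nat. is_pole (beta_function m M) (- of_nat k) \<longrightarrow>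
         ((\<lambda>z. beta_function m M z
                 - 1 / (z + of_nat k) * residue (beta_function m M) (- of_nat k))
            \<longlongrightarrow> regularized_energy m M (- of_nat k)) (at (- of_nat k)) \<and>
         ((\<lambda>z. beta_function m M z
                 - of_nat k / (z + of_nat k)
                   * of_real (LINT x|riemannian_volume m M. taylor_b m M k x))
            \<longlongrightarrow> regularized_energy m M (- of_nat k)) (at (- of_nat k)))"
proof -
  interpret submanifold m M by (rule submanifold.intro[OF assms])
  obtain d \<Gamma> C where d: "d > 0"
    and psi: "\<And>t. 0 \<le> t \<Longrightarrow> t < d \<Longrightarrow> psi m M t = \<Gamma> 0 t"
    and der: "\<And>k t. 0 \<le> t \<Longrightarrow> t < d \<Longrightarrow> (\<Gamma> k has_real_derivative \<Gamma> (Suc k) t) (at t within {0..<d})"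
    and bnd: "\<And>k t. 0 \<le> t \<Longrightarrow> t < d \<Longrightarrow> \<bar>\<Gamma> k t\<bar> \<le> C k"
    and par: "\<And>k. \<Gamma> k 0 \<noteq> 0 \<Longrightarrow> \<exists>i. k = m + 2 * i"
    and tb: "\<And>k. (LINT x|\<mu>. taylor_b m M k x) = \<Gamma> k 0 / fact k"
    by (rule psi_chain, rule that)
  obtain D where D: "AE r in \<nu>. 0 \<le> r \<and> r \<le> D" by (rule range_nu, rule that)
  interpret R: radial_measure \<nu> D d \<Gamma> C m
  proof (intro radial_measure.intro radial_measure_axioms.intro finite_nu)
    show "sets \<nu> = sets borel" by (simp add: \<nu>_def)
  qed (use d D psi der bnd par measure_nu in auto)
  have beta: "beta_function m M = R.betaf"
    unfolding beta_function_def
  proof (rule the_equality)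
    show "R.betaf nicely_meromorphic_on UNIV \<and> (\<forall>z. Re z > - real m \<longrightarrow> R.betaf z = riesz_integral_on m M (M \<times> M) z)"
      using R.betaf_nice R.betaf_eq_integral riesz_all by simp
    fix B assume "B nicely_meromorphic_on UNIV \<and> (\<forall>z. Re z > - real m \<longrightarrow> B z = riesz_integral_on m M (M \<times> M) z)"
    then show "B = R.betaf"
      using R.betaf_nice R.betaf_eq_integral riesz_all by (intro nicely_meromorphic_unique[of B R.betaf "- real m"]) auto
  qed
  have hd: "halfline_deriv j (psi m M) 0 / fact (j - 1) = R.c j" for j
    using halfline_deriv_eq[OF psi der, of 0 j] d by (simp add: R.c_def)
  have hre: "has_regularized_energy m M z (R.E0 z)" for z
    unfolding has_regularized_energy_def hd riesz_off_diagonal R.rz_def[symmetric]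
    using R.E0_tendsto by blast
  have uniq: "E = R.E0 z" if E: "has_regularized_energy m M z E" for z E
  proof -
    have "Re z > - real (R.level z) - 1" by (rule R.level)
    then show ?thesis
      using E hre[of z] tendsto_unique[OF trivial_limit_at_right_real] unfolding has_regularized_energy_def by blast
  qed
  have reg: "regularized_energy m M z = R.E0 z" for z
    unfolding regularized_energy_def by (rule the_equality) (use hre uniq in blast)+
  \<comment> \<open>\<open>c k\<close> has \<open>(k - 1)!\<close> in the denominator, being a
    Taylor coefficient of the derivative of \<psi>_M, and \<open>taylor_b\<close> has
    \<open>k!\<close>; hence the factor \<open>k\<close>.\<close>
  have ck: "R.c k = real k * (LINT x|\<mu>. taylor_b m M k x)" if "k \<ge> 1" for k
    using that by (cases k) (simp_all add: tb R.c_def del: of_nat_Suc)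
  show ?thesis
    unfolding beta reg \<mu>_def[symmetric]
  proof (intro conjI allI impI)
    show "is_pole R.betaf z \<Longrightarrow> \<exists>i::nat. z = - of_nat m - 2 * of_nat i" for z by (rule R.betaf_pole_form)
    show "\<exists>E. has_regularized_energy m M z E" for z using hre by blast
  next
    fix z :: complex assume z: "\<forall>i::nat. z \<noteq> - of_nat m - 2 * of_nat i"
    have "R.regular z"
      unfolding R.regular_def
    proof (intro allI impI notI)
      fix j assume "R.c j \<noteq> 0" "z = - of_nat j"
      then obtain i where "j = m + 2 * i" using R.c_nonzero by blast
      with \<open>z = - of_nat j\<close> have "z = - of_nat m - 2 * of_nat i" by simp
      with z show False by blast
    qed
    then show "R.E0 z = R.betaf z" by (simp add: R.betaf_regular)
  next
    fix k :: nat assume "(LINT x|\<mu>. taylor_b m M k x) = 0"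
    \<comment> \<open>The case \<open>k = 0\<close> is covered too: only indices
      \<open>j \<ge> 1\<close> can spoil regularity.\<close>
    then have "R.regular (- of_nat k)"
      unfolding R.regular_def using ck by (auto simp: minus_equation_iff)
    then show "R.E0 (- of_nat k) = R.betaf (- of_nat k)" by (simp add: R.betaf_regular)
  next
    fix k :: nat assume "is_pole R.betaf (- of_nat k)"
    then obtain j where "j \<ge> 1" "R.c j \<noteq> 0" "- (of_nat k :: complex) = - of_nat j" by (rule R.betaf_pole)
    then have k: "k \<ge> 1" by simp
    show "((\<lambda>z. R.betaf z - 1 / (z + of_nat k) * residue R.betaf (- of_nat k)) \<longlongrightarrow> R.E0 (- of_nat k)) (at (- of_nat k))"
      using R.betaf_at_pole[OF k] by simp
    show "((\<lambda>z. R.betaf z - of_nat k / (z + of_nat k) * of_real (LINT x|\<mu>. taylor_b m M k x)) \<longlongrightarrow> R.E0 (- of_nat k)) (at (- of_nat k))"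
      using R.betaf_at_pole(1)[OF k] by (simp add: ck[OF k])
  qed
qed

end
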